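(* Let $(X,d_X)$ be a locally compact length space and let $(T,d_T)$ be a metric tree. For every closed subset $Y\subseteq X$, every Lipschitz mapping $f:Y\to T$ has a unique absolutely minimal Lipschitz extension (AMLE) $\widetilde f:X\to T$.
   Context: A metric space $(X,d_X)$ is a length space if for all $x,y\in X$ the distance $d_X(x,y)$ is the infimum of the lengths of curves in $X$ that connect $x$ to $y$. A metric tree is the one-dimensional simplicial complex associated to a finite graph-theoretical tree with arbitrary edge lengths: each edge is present as an actual interval of the given length, and the space is equipped with the graphical shortest-path metric $d_T$. For metric spaces $(X,d_X)$, $(Z,d_Z)$, a mapping $h:X\to Z$ and $S\subseteq X$, put $\mathrm{Lip}_S(h)=\sup_{x,y\in S,\ x\neq y}\frac{d_Z(h(x),h(y))}{d_X(x,y)}$. Given a closed $Y\subseteq X$ and a Lipschitz mapping $f:Y\to Z$, a Lipschitz mapping $\widetilde f:X\to Z$ is called an absolutely minimal Lipschitz extension (AMLE) of $f$ if its restriction to $Y$ coincides with $f$, and for every open subset $U\subseteq X\setminus Y$ and every Lipschitz mapping $h:X\to Z$ that coincides with $\widetilde f$ on $X\setminus U$ one has $\mathrm{Lip}_U(h)\ge \mathrm{Lip}_U(\widetilde f)$.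
   Formalization: The closed subset Y is assumed nonempty: for empty Y every constant map X → T is an AMLE, so uniqueness fails as soon as X is nonempty and T has at least two points. *)

theory Defs
  imports "HOL-Analysis.Analysis"
begin

text \<open>The length of a curve takes values in \<^typ>\<open>ennreal\<close>, so that non-rectifiable
  curves have length \<open>\<infinity>\<close>, and the infimum over an empty set of curves is \<open>\<infinity>\<close> as well.\<close>

definition curve_length :: "'a metric \<Rightarrow> (real \<Rightarrow> 'a) \<Rightarrow> ennreal" where
  "curve_length X g =
     (SUP ts \<in> {ts. sorted ts \<and> set ts \<subseteq> {0..1}}.
        \<Sum>i<length ts - 1. ennreal (mdist X (g (ts ! i)) (g (ts ! Suc i))))"

definition length_space :: "'a metric \<Rightarrow> bool" where
  "length_space X \<longleftrightarrow>
     (\<forall>x\<in>mspace X. \<forall>y\<in>mspace X.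
        ennreal (mdist X x y) =
          (INF g \<in> {g. pathin (mtopology_of X) g \<and> g 0 = x \<and> g 1 = y}. curve_length X g))"


definition simple_graph :: "'v set \<Rightarrow> 'v set set \<Rightarrow> bool" where
  "simple_graph V E \<longleftrightarrow> (\<forall>e\<in>E. \<exists>u\<in>V. \<exists>v\<in>V. u \<noteq> v \<and> e = {u, v})"

definition graph_connected :: "'v set \<Rightarrow> 'v set set \<Rightarrow> bool" where
  "graph_connected V E \<longleftrightarrow> (\<forall>u\<in>V. \<forall>v\<in>V. (u, v) \<in> {(a, b). {a, b} \<in> E}\<^sup>*)"

definition graph_cycle :: "'v set set \<Rightarrow> 'v list \<Rightarrow> bool" where
  "graph_cycle E c \<longleftrightarrow>
     3 \<le> length c \<and> distinct c \<and> (\<forall>i<length c. {c ! i, c ! (Suc i mod length c)} \<in> E)"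

definition finite_tree :: "'v set \<Rightarrow> 'v set set \<Rightarrow> bool" where
  "finite_tree V E \<longleftrightarrow>
     finite V \<and> V \<noteq> {} \<and> simple_graph V E \<and> graph_connected V E \<and> \<not> (\<exists>c. graph_cycle E c)"


text \<open>Points of the one-dimensional simplicial complex of a graph are given by barycentric
  coordinates, that is, weights on the vertices with total mass \<open>1\<close> whose support is contained
  in a vertex or in an edge.\<close>

definition face_points :: "'v set \<Rightarrow> ('v \<Rightarrow> real) set" where
  "face_points s = {p. (\<forall>v. 0 \<le> p v) \<and> (\<forall>v. v \<notin> s \<longrightarrow> p v = 0) \<and> (\<Sum>v\<in>s. p v) = 1}"

definition complex_points :: "'v set \<Rightarrow> 'v set set \<Rightarrow> ('v \<Rightarrow> real) set" where
  "complex_points V E = (\<Union>v\<in>V. face_points {v}) \<union> (\<Union>e\<in>E. face_points e)"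

text \<open>Distance in an edge \<open>e = {u, v}\<close> regarded as an interval of length \<open>len e\<close>: for
  \<open>p, q \<in> face_points e\<close> one has \<open>\<bar>p u - q u\<bar> = \<bar>p v - q v\<bar>\<close>, so this is
  \<open>len e * \<bar>p u - q u\<bar>\<close>.\<close>

definition edge_dist :: "('v set \<Rightarrow> real) \<Rightarrow> 'v set \<Rightarrow> ('v \<Rightarrow> real) \<Rightarrow> ('v \<Rightarrow> real) \<Rightarrow> real" where
  "edge_dist len e p q = len e * ((\<Sum>v\<in>e. \<bar>p v - q v\<bar>) / 2)"

text \<open>\<open>complex_path E len p q L\<close>: some concatenation of finitely many segments, each contained in
  a single edge, leads from \<open>p\<close> to \<open>q\<close> and has total length \<open>L\<close>.\<close>

inductive complex_path ::
    "'v set set \<Rightarrow> ('v set \<Rightarrow> real) \<Rightarrow> ('v \<Rightarrow> real) \<Rightarrow> ('v \<Rightarrow> real) \<Rightarrow> real \<Rightarrow> bool"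
  for E len where
  refl: "complex_path E len p p 0"
| step: "complex_path E len p q L \<Longrightarrow> e \<in> E \<Longrightarrow> q \<in> face_points e \<Longrightarrow> r \<in> face_points e
          \<Longrightarrow> complex_path E len p r (L + edge_dist len e q r)"

definition complex_dist ::
    "'v set set \<Rightarrow> ('v set \<Rightarrow> real) \<Rightarrow> ('v \<Rightarrow> real) \<Rightarrow> ('v \<Rightarrow> real) \<Rightarrow> real" where
  "complex_dist E len p q = Inf {L. complex_path E len p q L}"

text \<open>A metric tree is a metric space isometric to such a complex. Since the vertex set is finite,
  it is no restriction to take natural numbers as vertices.\<close>

definition metric_tree :: "'b metric \<Rightarrow> bool" where
  "metric_tree T \<longleftrightarrow>
     (\<exists>(V :: nat set) E len \<phi>.
        finite_tree V E \<and> (\<forall>e\<in>E. 0 < len e) \<and>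
        bij_betw \<phi> (complex_points V E) (mspace T) \<and>
        (\<forall>p\<in>complex_points V E. \<forall>q\<in>complex_points V E.
           mdist T (\<phi> p) (\<phi> q) = complex_dist E len p q))"


text \<open>In \<^typ>\<open>ennreal\<close> the supremum of the empty set is \<open>0\<close>.\<close>

definition Lip :: "'a metric \<Rightarrow> 'b metric \<Rightarrow> 'a set \<Rightarrow> ('a \<Rightarrow> 'b) \<Rightarrow> ennreal" where
  "Lip X Z S h =
     (SUP (x, y) \<in> {(x, y). x \<in> S \<and> y \<in> S \<and> x \<noteq> y}. ennreal (mdist Z (h x) (h y) / mdist X x y))"

definition AMLE :: "'a metric \<Rightarrow> 'b metric \<Rightarrow> 'a set \<Rightarrow> ('a \<Rightarrow> 'b) \<Rightarrow> ('a \<Rightarrow> 'b) \<Rightarrow> bool" where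
  "AMLE X Z Y f F \<longleftrightarrow>
     Lipschitz_continuous_map X Z F \<and> (\<forall>y\<in>Y. F y = f y) \<and>
     (\<forall>U h. openin (mtopology_of X) U \<and> U \<subseteq> mspace X - Y \<and>
            Lipschitz_continuous_map X Z h \<and> (\<forall>x\<in>mspace X - U. h x = F x)
        \<longrightarrow> Lip X Z U F \<le> Lip X Z U h)"

end

theory Submission
  imports Defs
begin

text \<open>A Lipschitz map \<open>F\<close> into a tree is called subharmonic if \<open>u = d(t, F)\<close> satisfies
  \<open>2 u(y) \<le> u(x) + sup u(B(x, 2R))\<close> for all \<open>t\<close>, all balls \<open>B(x, 3R)\<close> off \<open>Y\<close> and \<open>y \<in> B(x, R)\<close>.

  Comparison: for subharmonic \<open>F\<close>, \<open>G\<close> let \<open>D(x)\<close> be the largest distance between values of \<open>F\<close> and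
  \<open>G\<close> on \<open>B(x, \<epsilon>)\<close>. Where \<open>D\<close> is large, \<open>D\<close> is the sum of the suprema of \<open>d(t, F)\<close> and \<open>d(t, G)\<close> for a
  point \<open>t\<close> between the values, and subharmonicity lets one of the two values run away from the other
  in steps of fixed size without essentially decreasing \<open>D\<close>, which is impossible in a bounded tree.
  Hence \<open>D\<close> is controlled by its values near \<open>Y\<close>.

  Existence: sets in a tree have canonical centers, and the map sending \<open>F\<close> to the centers of the sets
  \<open>F(B(x, \<epsilon>))\<close> is nonexpansive and has a fixed point \<open>F\<^sub>\<epsilon>\<close>. By comparison the \<open>F\<^sub>\<epsilon>\<close>, \<open>\<epsilon> = 2\<^sup>-\<^sup>n\<close>, converge
  uniformly; the limit is subharmonic, and subharmonic maps are absolutely minimal by comparison with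
  the cones \<open>K d(w, \<cdot>)\<close>.

  Uniqueness: an absolutely minimal map is subharmonic. By induction on the number of branch points one
  shows this for the distance from \<open>p\<close> measured in one component of \<open>T - {p}\<close> only. If it fails,
  let \<open>U\<close> be the set where this function exceeds a cone of slope \<open>s\<close> by almost as much as possible. The
  induction hypothesis for the smaller components shows that \<open>F\<close> is \<open>s\<close>-Lipschitz on the boundary of \<open>U\<close>,
  so an \<open>s\<close>-Lipschitz competitor exists on \<open>U\<close>, and \<open>F\<close> cannot exceed the cone there.\<close>

section \<open>Trees as 0-hyperbolic geodesic spaces\<close>

text \<open>A tree resembles the line in that the maximum of two cones d(., c) + const is again such
  a cone. Hence the largest distance from t to a set equals d(t, center) + radius, as an equality
  for every t. This is behind the nonexpansive centers, the Lipschitz extension with the same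
  constant and the mean value inequality of the maps at scale eps. Suprema over balls need not be
  attained, so every maximum principle here runs through points that almost attain a supremum, with
  errors fixed in advance for a bounded number of steps. For real functions, minimality yields
  comparison with cones by replacing the function with the cone where it is larger. In a tree,
  lowering d(p, F) does not define a map: on the boundary of the exceptional set only the distances
  to p are known, and the values may lie in different branches. So the s-Lipschitz bound there must
  be proved for F itself. Two values that split at q are controlled by their distances from q, each
  within its own component of T - {q}; these components lie in the one at p and have lost the branch
  point q. The full distance from q would give no such decrease.\<close>

locale rtree = tr: Metric_space T e for T :: "'b set" and e :: "'b \<Rightarrow> 'b \<Rightarrow> real" +
  assumes geodesic: "\<lbrakk>a \<in> T; b \<in> T; 0 \<le> r; r \<le> e a b\<rbrakk> \<Longrightarrow> \<exists>c\<in>T. e a c = r \<and> e c b = e a b - r"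
    and four_point: "\<lbrakk>x \<in> T; y \<in> T; z \<in> T; w \<in> T\<rbrakk> \<Longrightarrow>
      e x y + e z w \<le> max (e x z + e y w) (e x w + e y z)"
    and bounded: "\<exists>D. \<forall>x\<in>T. \<forall>y\<in>T. e x y \<le> D"
    and complete: "tr.mcomplete"
    and finite_branching: "\<exists>B. finite B \<and> (\<forall>p\<in>T. \<forall>x\<in>T. \<forall>y\<in>T. \<forall>q\<in>T.
      q \<noteq> p \<longrightarrow> q \<noteq> x \<longrightarrow> q \<noteq> y \<longrightarrow> e p x = e p q + e q x \<longrightarrow> e p y = e p q + e q y \<longrightarrow>
      e x y = e x q + e q y \<longrightarrow> q \<in> B)"
begin

text \<open>\<open>x\<close> and \<open>y\<close> lie in the same component of \<open>T - {t}\<close>.\<close>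

definition same :: "'b \<Rightarrow> 'b \<Rightarrow> 'b \<Rightarrow> bool" where
  "same t x y \<longleftrightarrow> e x y < e x t + e t y"

lemma same_sym: "same t x y \<Longrightarrow> same t y x"
  unfolding same_def by (metis add.commute tr.commute)

text \<open>In the four-point condition for \<open>t\<close>, \<open>y\<close>, \<open>x\<close>,
  \<open>z\<close> both alternatives on the right are strictly below the sum of the three distances
  from \<open>t\<close>.\<close>

lemma same_trans:
  assumes "t \<in> T" "x \<in> T" "y \<in> T" "z \<in> T" "same t x y" "same t y z"
  shows "same t x z"
proof -
  have "e t y + e x z \<le> max (e t x + e y z) (e t z + e y x)"
    using four_point[of t y x z] assms by simp
  moreover have "e y z < e t y + e t z" "e y x < e t x + e t y"
    using assms(5,6) unfolding same_def by (auto simp: tr.commute)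
  ultimately show ?thesis unfolding same_def by (smt (verit) tr.commute)
qed

lemma not_same:
  assumes "t \<in> T" "x \<in> T" "y \<in> T"
  shows "\<not> same t x y \<longleftrightarrow> e x y = e x t + e t y"
  using tr.triangle[of x t y] assms unfolding same_def by auto

lemma same_close:
  assumes "a \<in> T" "a' \<in> T" "t \<in> T" "e a a' < e a' t"
  shows "same t a a'"
  using assms tr.nonneg[of a t] unfolding same_def by (simp add: tr.commute add_strict_increasing2)

text \<open>A move shorter than the distance to \<open>t\<close> cannot leave a component of the
  complement of \<open>t\<close>, so separation by \<open>t\<close> survives.\<close>

lemma between_stable:
  assumes "t \<in> T" "a0 \<in> T" "b0 \<in> T" "a \<in> T" "b \<in> T" "e a0 b0 = e a0 t + e t b0"
    "e a a0 < e a0 t" "e b b0 < e b0 t"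
  shows "e a b = e a t + e t b"
proof -
  have "same t a a0" "same t b b0" using assms same_close by auto
  moreover have "\<not> same t a0 b0" using assms not_same by auto
  ultimately have "\<not> same t a b" using assms same_trans same_sym by metis
  then show ?thesis using assms not_same by auto
qed

lemma between_stable1:
  assumes "t \<in> T" "a0 \<in> T" "b \<in> T" "a \<in> T" "e a0 b = e a0 t + e t b" "e a a0 < e a0 t"
  shows "e a b = e a t + e t b"
proof -
  have "same t a a0" using assms same_close by auto
  moreover have "\<not> same t a0 b" using assms not_same by auto
  ultimately have "\<not> same t a b" using assms same_trans same_sym by metis
  then show ?thesis using assms not_same by auto
qed

text \<open>If neither cone dominates the other, the new apex is the point \<open>c\<close> of the
  segment at which both have the same value. Every \<open>t\<close> is separated by \<open>c\<close>
  from \<open>c1\<close> or from \<open>c2\<close>, which turns one of the two triangle inequalities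
  through \<open>c\<close> into an equality.\<close>

lemma cone_max:
  assumes "c1 \<in> T" "c2 \<in> T"
  shows "\<exists>c\<in>T. \<exists>\<rho>::real. \<forall>t\<in>T. e t c + \<rho> = max (e t c1 + \<rho>1) (e t c2 + \<rho>2)"
proof -
  consider "\<rho>2 + e c1 c2 \<le> \<rho>1" | "\<rho>1 + e c1 c2 \<le> \<rho>2" | "\<bar>\<rho>1 - \<rho>2\<bar> < e c1 c2" by linarith
  then show ?thesis
  proof cases
    case 1
    then have "\<forall>t\<in>T. e t c1 + \<rho>1 = max (e t c1 + \<rho>1) (e t c2 + \<rho>2)"
      using tr.triangle[of _ c1 c2] assms by (force simp: max_def)
    then show ?thesis using assms by blast
  next
    case 2
    then have "\<forall>t\<in>T. e t c2 + \<rho>2 = max (e t c1 + \<rho>1) (e t c2 + \<rho>2)"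
      using tr.triangle'[of _ c2 c1] assms by (force simp: max_def tr.commute)
    then show ?thesis using assms by blast
  next
    case 3
    then obtain c where c: "c \<in> T" "e c1 c = (e c1 c2 + \<rho>2 - \<rho>1) / 2"
        "e c c2 = e c1 c2 - (e c1 c2 + \<rho>2 - \<rho>1) / 2"
      using geodesic[of c1 c2 "(e c1 c2 + \<rho>2 - \<rho>1) / 2"] assms by (auto simp: abs_less_iff)
    define \<rho> where "\<rho> = (e c1 c2 + \<rho>1 + \<rho>2) / 2"
    have "e t c + \<rho> = max (e t c1 + \<rho>1) (e t c2 + \<rho>2)" if t: "t \<in> T" for t
    proof -
      have "e c1 c2 = e c1 c + e c c2" using c by (simp add: field_simps)
      then have "\<not> same c c1 c2" using c assms not_same by auto
      then have "\<not> same c t c1 \<or> \<not> same c t c2" using c assms t same_trans same_sym by metis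
      then have "e t c1 = e t c + e c c1 \<or> e t c2 = e t c + e c c2" using not_same c t assms by auto
      moreover have "e t c1 \<le> e t c + e c c1" "e t c2 \<le> e t c + e c c2"
        using tr.triangle[of t c c1] tr.triangle[of t c c2] c(1) t assms by auto
      moreover have "e c c1 + \<rho>1 = \<rho>" "e c c2 + \<rho>2 = \<rho>" unfolding \<rho>_def using c by (auto simp: tr.commute field_simps)
      ultimately show ?thesis by (auto simp: max_def)
    qed
    then show ?thesis using c by blast
  qed
qed

section \<open>Upper envelopes of cones, and centers of sets\<close>

definition below :: "('b \<times> real) set \<Rightarrow> 'b \<Rightarrow> real \<Rightarrow> bool" where
  "below W t r \<longleftrightarrow> (\<forall>(s, w)\<in>W. e t s - w \<le> r)"

lemma limit_of_cauchy_bound: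
  assumes "\<And>n. c n \<in> T" "\<And>m n. e (c m) (c n) \<le> inverse (real (Suc m)) + inverse (real (Suc n))"
  obtains l where "l \<in> T" "(\<lambda>n. e (c n) l) \<longlonglongrightarrow> 0"
proof -
  have "tr.MCauchy c"
    unfolding tr.MCauchy_def
  proof (intro conjI allI impI)
    show "range c \<subseteq> T" using assms by auto
    fix \<epsilon> :: real assume "0 < \<epsilon>"
    then obtain N where N: "inverse (real (Suc N)) < \<epsilon> / 2" using reals_Archimedean[of "\<epsilon>/2"] by auto
    have "e (c n) (c n') < \<epsilon>" if "N \<le> n" "N \<le> n'" for n n'
    proof -
      have "inverse (real (Suc n)) \<le> inverse (real (Suc N))" "inverse (real (Suc n')) \<le> inverse (real (Suc N))"
        using that by (auto simp: field_simps)
      then show ?thesis using assms(2)[of n n'] N by linarith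
    qed
    then show "\<exists>N. \<forall>n n'. N \<le> n \<longrightarrow> N \<le> n' \<longrightarrow> e (c n) (c n') < \<epsilon>" by blast
  qed
  then obtain l where "limitin tr.mtopology c l sequentially"
    using complete tr.mcomplete_def by blast
  then show ?thesis using that tr.limitin_metric_dist_null by blast
qed

text \<open>The cones under the envelope of \<open>W\<close> are closed under maxima by
  \<open>cone_max\<close>. One of maximal height is obtained as a limit; its maximum with a member
  of \<open>W\<close> cannot be higher, so it dominates \<open>W\<close> and is itself the
  envelope.\<close>

lemma weighted_center:
  assumes W: "W \<noteq> {}" "fst ` W \<subseteq> T" and lower: "\<And>s w. (s, w) \<in> W \<Longrightarrow> - w \<le> K"
  shows "\<exists>c\<in>T. \<exists>\<rho>. (\<forall>t\<in>T. below W t (e t c + \<rho>)) \<and> (\<forall>t\<in>T. \<forall>r. below W t r \<longrightarrow> e t c + \<rho> \<le> r)"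
proof -
  obtain D where D: "\<And>x y. x \<in> T \<Longrightarrow> y \<in> T \<Longrightarrow> e x y \<le> D" using bounded by blast
  define Q where "Q = {(c, \<rho>). c \<in> T \<and> (\<forall>t\<in>T. \<forall>r. below W t r \<longrightarrow> e t c + \<rho> \<le> r)}"
  have WQ: "(s, - w) \<in> Q" if "(s, w) \<in> W" for s w
    using that W(2) unfolding Q_def below_def by force
  have bdd: "\<rho> \<le> D + K" if "(c, \<rho>) \<in> Q" for c \<rho>
  proof -
    have c: "c \<in> T" using that unfolding Q_def by auto
    have "below W c (D + K)" unfolding below_def
    proof clarify
      fix s w assume sw: "(s, w) \<in> W"
      then have "s \<in> T" using W(2) by force
      then show "e c s - w \<le> D + K" using lower[OF sw] D[OF c] by fastforce
    qed
    then have "e c c + \<rho> \<le> D + K" using that c unfolding Q_def by auto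
    then show ?thesis using c by simp
  qed
  have join: "\<exists>c \<rho>. (c, \<rho>) \<in> Q \<and> (\<forall>t\<in>T. e t c1 + \<rho>1 \<le> e t c + \<rho> \<and> e t c2 + \<rho>2 \<le> e t c + \<rho>)"
    if q: "(c1, \<rho>1) \<in> Q" "(c2, \<rho>2) \<in> Q" for c1 \<rho>1 c2 \<rho>2
  proof -
    obtain c \<rho> where c: "c \<in> T" "\<And>t. t \<in> T \<Longrightarrow> e t c + \<rho> = max (e t c1 + \<rho>1) (e t c2 + \<rho>2)"
      using cone_max[of c1 c2 \<rho>1 \<rho>2] q unfolding Q_def by auto
    have "(c, \<rho>) \<in> Q" unfolding Q_def
    proof (clarsimp simp: c)
      fix t r assume "t \<in> T" "below W t r"
      then show "e t c1 + \<rho>1 \<le> r \<and> e t c2 + \<rho>2 \<le> r" using q unfolding Q_def by blast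
    qed
    then show ?thesis using c(2) by (metis max.cobounded1 max.cobounded2)
  qed
  define \<rho>' where "\<rho>' = Sup (snd ` Q)"
  obtain s0 w0 where sw0: "(s0, w0) \<in> W" using W(1) by auto
  have Qne: "snd ` Q \<noteq> {}" using WQ[OF sw0] by auto
  have Qbdd: "bdd_above (snd ` Q)" using bdd by (intro bdd_aboveI[of _ "D + K"]) auto
  have le\<rho>: "\<rho> \<le> \<rho>'" if "(c, \<rho>) \<in> Q" for c \<rho>
    unfolding \<rho>'_def using that Qbdd by (intro cSup_upper) force+
  have "\<exists>c \<rho>. (c, \<rho>) \<in> Q \<and> \<rho>' - inverse (real (Suc n)) < \<rho>" for n
  proof -
    have "\<rho>' - inverse (real (Suc n)) < Sup (snd ` Q)" unfolding \<rho>'_def by simp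
    then show ?thesis using less_cSup_iff[OF Qne Qbdd] by force
  qed
  then obtain c r where cr: "\<And>n. (c n, r n) \<in> Q" "\<And>n. \<rho>' - inverse (real (Suc n)) < r n" by metis
  have cT: "c n \<in> T" for n using cr(1) unfolding Q_def by auto
  \<comment> \<open>Evaluate at the apex of the larger cone: shifting the apex by some amount raises
    the height by at least that amount. So cones of almost maximal height have nearby
    apexes.\<close>
  have close: "e (c m) c' \<le> \<rho>' - r m" if "(c', \<rho>'') \<in> Q" "\<forall>t\<in>T. e t (c m) + r m \<le> e t c' + \<rho>''" for m c' \<rho>''
  proof -
    have c': "c' \<in> T" using that(1) unfolding Q_def by auto
    have "e c' (c m) + r m \<le> e c' c' + \<rho>''" using that c' by blast
    then show ?thesis using le\<rho>[OF that(1)] c' by (simp add: tr.commute)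
  qed
  have cl: "e (c m) (c n) \<le> inverse (real (Suc m)) + inverse (real (Suc n))" for m n
  proof -
    obtain c' \<rho>'' where j: "(c', \<rho>'') \<in> Q"
      "\<forall>t\<in>T. e t (c m) + r m \<le> e t c' + \<rho>'' \<and> e t (c n) + r n \<le> e t c' + \<rho>''"
      using join[OF cr(1)[of m] cr(1)[of n]] by blast
    then have "e (c m) c' \<le> \<rho>' - r m" "e (c n) c' \<le> \<rho>' - r n" using close by blast+
    moreover have "c' \<in> T" using j unfolding Q_def by auto
    ultimately show ?thesis using tr.triangle'[of "c m" c' "c n"] cT cr(2)[of m] cr(2)[of n] by fastforce
  qed
  obtain l where l: "l \<in> T" "(\<lambda>n. e (c n) l) \<longlonglongrightarrow> 0" using limit_of_cauchy_bound[of c, OF cT cl] by blast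
  have r_lim: "r \<longlonglongrightarrow> \<rho>'"
  proof (rule tendsto_sandwich[of "\<lambda>n. \<rho>' - inverse (real (Suc n))" r _ "\<lambda>n. \<rho>'"])
    show "(\<lambda>n. \<rho>' - inverse (real (Suc n))) \<longlonglongrightarrow> \<rho>'"
      using tendsto_diff[OF tendsto_const[of \<rho>'] LIMSEQ_inverse_real_of_nat] by simp
    show "\<forall>\<^sub>F n in sequentially. \<rho>' - inverse (real (Suc n)) \<le> r n"
      using cr(2) by (intro always_eventually allI less_imp_le)
    show "\<forall>\<^sub>F n in sequentially. r n \<le> \<rho>'" using cr(1) le\<rho> by (intro always_eventually) blast
  qed auto
  have lQ: "(l, \<rho>') \<in> Q"
    unfolding Q_def
  proof (clarsimp simp: l)
    fix t u assume t: "t \<in> T" "below W t u"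
    have "e t l + r n \<le> u + e (c n) l" for n
    proof -
      have "e t (c n) + r n \<le> u" using t cr(1)[of n] unfolding Q_def by auto
      then show ?thesis using tr.triangle[of t "c n" l] t cT l by auto
    qed
    moreover have "(\<lambda>n. u + e (c n) l) \<longlonglongrightarrow> u + 0" by (intro tendsto_intros l)
    moreover have "(\<lambda>n. e t l + r n) \<longlonglongrightarrow> e t l + \<rho>'" by (intro tendsto_intros r_lim)
    ultimately show "e t l + \<rho>' \<le> u" using LIMSEQ_le by fastforce
  qed
  have "below W t (e t l + \<rho>')" if t: "t \<in> T" for t
    unfolding below_def
  proof clarify
    fix s w assume sw: "(s, w) \<in> W"
    obtain c' \<rho>'' where j: "(c', \<rho>'') \<in> Q"
      "\<forall>t\<in>T. e t l + \<rho>' \<le> e t c' + \<rho>'' \<and> e t s + - w \<le> e t c' + \<rho>''"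
      using join[OF lQ WQ[OF sw]] by blast
    have c': "c' \<in> T" using j unfolding Q_def by auto
    have "e c' l + \<rho>' \<le> \<rho>''" using j c' by force
    then have "e c' l \<le> 0" "\<rho>'' = \<rho>'" using le\<rho>[OF j(1)] tr.nonneg[of c' l] by linarith+
    then have "c' = l" using c' l tr.nonneg[of c' l] by (metis dual_order.antisym tr.zero)
    then show "e t s - w \<le> e t l + \<rho>'" using j(2) t \<open>\<rho>'' = \<rho>'\<close> by force
  qed
  then show ?thesis using lQ l unfolding Q_def by blast
qed

text \<open>The two conditions amount to sup {e t s | s in S} = e t c + \<rho> for all
  \<open>t\<close>. So \<open>c\<close> and \<open>\<rho>\<close> are the Chebyshev center and
  radius, and the farthest-distance function of \<open>S\<close> is a cone.\<close>

definition is_center :: "'b set \<Rightarrow> 'b \<Rightarrow> real \<Rightarrow> bool" where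
  "is_center S c \<rho> \<longleftrightarrow> c \<in> T \<and> (\<forall>s\<in>S. e c s \<le> \<rho>) \<and>
     (\<forall>t\<in>T. \<forall>r. (\<forall>s\<in>S. e t s \<le> r) \<longrightarrow> e t c + \<rho> \<le> r)"

definition cen :: "'b set \<Rightarrow> 'b" where
  "cen S = fst (SOME (c, \<rho>). is_center S c \<rho>)"

definition rad :: "'b set \<Rightarrow> real" where
  "rad S = snd (SOME (c, \<rho>). is_center S c \<rho>)"

lemma is_center_cen:
  assumes "S \<noteq> {}" "S \<subseteq> T"
  shows "is_center S (cen S) (rad S)"
proof -
  have "\<exists>c\<in>T. \<exists>\<rho>. (\<forall>t\<in>T. below ((\<lambda>s. (s, 0)) ` S) t (e t c + \<rho>)) \<and>
      (\<forall>t\<in>T. \<forall>r. below ((\<lambda>s. (s, 0)) ` S) t r \<longrightarrow> e t c + \<rho> \<le> r)"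
    using weighted_center[of "(\<lambda>s. (s, 0)) ` S" 0] assms by (auto simp: image_image)
  then obtain c \<rho> where c: "c \<in> T" "\<And>t s. t \<in> T \<Longrightarrow> s \<in> S \<Longrightarrow> e t s \<le> e t c + \<rho>"
    "\<forall>t\<in>T. \<forall>r. (\<forall>s\<in>S. e t s \<le> r) \<longrightarrow> e t c + \<rho> \<le> r"
    unfolding below_def by auto
  then have "is_center S c \<rho>" unfolding is_center_def using c(2)[OF c(1)] by auto
  then have "case (SOME (c, \<rho>). is_center S c \<rho>) of (c, \<rho>) \<Rightarrow> is_center S c \<rho>"
    by (intro someI[of "\<lambda>(c, \<rho>). is_center S c \<rho>" "(c, \<rho>)"]) simp
  then show ?thesis unfolding cen_def rad_def by (simp add: case_prod_beta)
qed

lemma cen_in [intro]: "S \<noteq> {} \<Longrightarrow> S \<subseteq> T \<Longrightarrow> cen S \<in> T"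
  using is_center_cen unfolding is_center_def by blast

lemma cen_rad: "S \<noteq> {} \<Longrightarrow> S \<subseteq> T \<Longrightarrow> s \<in> S \<Longrightarrow> e (cen S) s \<le> rad S"
  using is_center_cen unfolding is_center_def by blast

lemma cen_least:
  "S \<noteq> {} \<Longrightarrow> S \<subseteq> T \<Longrightarrow> t \<in> T \<Longrightarrow> (\<And>s. s \<in> S \<Longrightarrow> e t s \<le> r) \<Longrightarrow> e t (cen S) + rad S \<le> r"
  using is_center_cen[of S] unfolding is_center_def by simp

lemma rad_nonneg: "S \<noteq> {} \<Longrightarrow> S \<subseteq> T \<Longrightarrow> 0 \<le> rad S"
  using cen_rad tr.nonneg by (metis ex_in_conv order_trans)

lemma cen_ball:
  "S \<noteq> {} \<Longrightarrow> S \<subseteq> T \<Longrightarrow> t \<in> T \<Longrightarrow> (\<And>s. s \<in> S \<Longrightarrow> e t s \<le> r) \<Longrightarrow> e t (cen S) \<le> r"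
  using cen_least[of S t r] rad_nonneg[of S] by force

text \<open>Two uses of \<open>cen_least\<close>: at the points of \<open>S\<close>, to bound their
  distances from the center by \<open>\<delta> - rad S\<close>, and then at the center
  itself.\<close>

lemma rad_le_half_diam:
  assumes "S \<noteq> {}" "S \<subseteq> T" "\<And>s s'. s \<in> S \<Longrightarrow> s' \<in> S \<Longrightarrow> e s s' \<le> \<delta>"
  shows "rad S \<le> \<delta> / 2"
proof -
  have "e (cen S) s \<le> \<delta> - rad S" if "s \<in> S" for s
    using cen_least[of S s \<delta>] assms that by (fastforce simp: tr.commute)
  then have "e (cen S) (cen S) + rad S \<le> \<delta> - rad S" using cen_least[of S "cen S"] assms cen_in by blast
  then show ?thesis using tr.nonneg[of "cen S" "cen S"] by linarith
qed

text \<open>Here \<open>\<eta>\<close> bounds the Hausdorff distance. Testing each farthest-distance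
  function at the other center gives two inequalities in whose sum the radii cancel.\<close>

lemma cen_lipschitz:
  assumes S: "S \<noteq> {}" "S \<subseteq> T" and S': "S' \<noteq> {}" "S' \<subseteq> T"
    and h1: "\<And>s. s \<in> S \<Longrightarrow> \<exists>s'\<in>S'. e s s' \<le> \<eta>" and h2: "\<And>s'. s' \<in> S' \<Longrightarrow> \<exists>s\<in>S. e s' s \<le> \<eta>"
  shows "e (cen S) (cen S') \<le> \<eta>"
proof -
  have *: "e (cen S') (cen S) + rad S \<le> rad S' + \<eta>"
    if S: "S \<noteq> {}" "S \<subseteq> T" and S': "S' \<noteq> {}" "S' \<subseteq> T"
      and h: "\<And>s. s \<in> S \<Longrightarrow> \<exists>s'\<in>S'. e s s' \<le> \<eta>" for S S'
  proof (rule cen_least[OF S])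
    show "cen S' \<in> T" using S' by blast
    fix s assume s: "s \<in> S"
    then obtain s' where s': "s' \<in> S'" "e s s' \<le> \<eta>" using h by blast
    have "e (cen S') s' \<le> rad S'" using cen_rad S' s' by blast
    moreover have "e (cen S') s \<le> e (cen S') s' + e s s'"
      using tr.triangle'[of "cen S'" s' s] S S' s s' cen_in by auto
    ultimately show "e (cen S') s \<le> rad S' + \<eta>" using s' by linarith
  qed
  show ?thesis using *[OF S S' h1] *[OF S' S h2] by (simp add: tr.commute)
qed

text \<open>Let \<open>g x\<close> be the apex of the envelope of the cones e(., f y) - L d(x, y).
  Moving \<open>x\<close> to \<open>x'\<close> changes every cone by at most L d(x, x'), so the apex
  moves by at most that, as in \<open>cen_lipschitz\<close>. For \<open>x\<close> in
  \<open>Y\<close> the Lipschitz condition makes the envelope nonpositive at \<open>f x\<close>,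
  which forces the apex to be there.\<close>

lemma lipschitz_extension:
  assumes "Metric_space M d" "Y \<subseteq> M" "Y \<noteq> {}" "0 \<le> L" and fT: "\<And>y. y \<in> Y \<Longrightarrow> f y \<in> T"
    and lip: "\<And>y y'. y \<in> Y \<Longrightarrow> y' \<in> Y \<Longrightarrow> e (f y) (f y') \<le> L * d y y'"
  shows "\<exists>g. (\<forall>x\<in>M. g x \<in> T) \<and> (\<forall>y\<in>Y. g y = f y) \<and> (\<forall>x\<in>M. \<forall>y\<in>M. e (g x) (g y) \<le> L * d x y)"
proof -
  interpret X: Metric_space M d by fact
  define W where "W x = (\<lambda>y. (f y, L * d x y)) ` Y" for x
  have "\<exists>c\<in>T. \<exists>\<rho>. (\<forall>t\<in>T. below (W x) t (e t c + \<rho>)) \<and> (\<forall>t\<in>T. \<forall>r. below (W x) t r \<longrightarrow> e t c + \<rho> \<le> r)"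
    if "x \<in> M" for x
    using assms by (intro weighted_center[of _ 0]) (auto simp: W_def)
  then obtain g \<rho> where g: "\<And>x. x \<in> M \<Longrightarrow> g x \<in> T"
    "\<And>x t. x \<in> M \<Longrightarrow> t \<in> T \<Longrightarrow> below (W x) t (e t (g x) + \<rho> x)"
    "\<And>x t r. x \<in> M \<Longrightarrow> t \<in> T \<Longrightarrow> below (W x) t r \<Longrightarrow> e t (g x) + \<rho> x \<le> r" by metis
  have bW: "below (W x) t r \<longleftrightarrow> (\<forall>y\<in>Y. e t (f y) - L * d x y \<le> r)" for x t r
    unfolding below_def W_def by auto
  have shift: "below (W x) t (r + L * d x x')" if "below (W x') t r" "x \<in> M" "x' \<in> M" for x x' t r
    unfolding bW
  proof
    fix y assume y: "y \<in> Y"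
    have "L * d x' y \<le> L * (d x x' + d x y)"
      using X.triangle[of x' x y] that y assms by (intro mult_left_mono) (auto simp: X.commute)
    then show "e t (f y) - L * d x y \<le> r + L * d x x'" using that(1) y unfolding bW by (fastforce simp: algebra_simps)
  qed
  have "e (g x) (g x') \<le> L * d x x'" if x: "x \<in> M" "x' \<in> M" for x x'
  proof -
    have *: "e (g x') (g x) + \<rho> x \<le> \<rho> x' + L * d x x'" if x: "x \<in> M" "x' \<in> M" for x x'
      using g(3)[OF x(1) g(1)[OF x(2)] shift[OF g(2)[OF x(2) g(1)[OF x(2)]] x]] g(1)[OF x(2)] by simp
    show ?thesis using *[OF x] *[OF x(2,1)] by (simp add: tr.commute X.commute)
  qed
  moreover have "g y = f y" if y: "y \<in> Y" for y
  proof -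
    have yM: "y \<in> M" using y assms by auto
    have "e (f y) (g y) + \<rho> y \<le> 0"
      using lip[OF y] by (intro g(3)[OF yM fT[OF y]]) (auto simp: bW)
    moreover have "e (g y) (f y) \<le> \<rho> y"
      using g(2)[OF yM g(1)[OF yM]] y yM g(1)[OF yM] unfolding bW by force
    ultimately have "e (g y) (f y) = 0"
      using tr.nonneg[of "g y" "f y"] tr.commute[of "g y" "f y"] by linarith
    then show ?thesis using g(1) yM fT y tr.zero by blast
  qed
  ultimately show ?thesis using g(1) by blast
qed

end

section \<open>Fixed points of nonexpansive maps\<close>

context rtree
begin

text \<open>A minimal nonempty invariant set that is closed under pointwise centers is the hull of its
  image, so the members of small distance to all its elements again form an invariant set.\<close>

lemma nonexpansive_fixpoint:
  fixes M :: "'a set" and K :: "('a \<Rightarrow> 'b) set" and \<Phi> :: "('a \<Rightarrow> 'b) \<Rightarrow> 'a \<Rightarrow> 'b"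
  defines "cm \<equiv> \<lambda>G. \<lambda>x\<in>M. cen ((\<lambda>F. F x) ` G)"
  assumes KT: "\<And>F x. F \<in> K \<Longrightarrow> x \<in> M \<Longrightarrow> F x \<in> T" and ext: "K \<subseteq> extensional M" and "K \<noteq> {}"
    and center: "\<And>G. G \<subseteq> K \<Longrightarrow> G \<noteq> {} \<Longrightarrow> cm G \<in> K"
    and closed: "\<And>F. F \<in> extensional M \<Longrightarrow> (\<And>x. x \<in> M \<Longrightarrow> F x \<in> T) \<Longrightarrow>
      (\<And>J \<eta>. finite J \<Longrightarrow> J \<subseteq> M \<Longrightarrow> 0 < \<eta> \<Longrightarrow> \<exists>G\<in>K. \<forall>x\<in>J. e (F x) (G x) < \<eta>) \<Longrightarrow> F \<in> K"
    and \<Phi>: "\<And>F. F \<in> K \<Longrightarrow> \<Phi> F \<in> K"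
    and nonexp: "\<And>F G r x. F \<in> K \<Longrightarrow> G \<in> K \<Longrightarrow> (\<And>x. x \<in> M \<Longrightarrow> e (F x) (G x) \<le> r) \<Longrightarrow> x \<in> M \<Longrightarrow>
      e (\<Phi> F x) (\<Phi> G x) \<le> r"
  shows "\<exists>F\<in>K. \<Phi> F = F"
proof -
  \<comment> \<open>Membership in the closure for pointwise convergence, tested on finitely many
    coordinates.\<close>
  define appr where "appr C F \<longleftrightarrow> (\<forall>J \<eta>. finite J \<longrightarrow> J \<subseteq> M \<longrightarrow> 0 < \<eta> \<longrightarrow>
     (\<exists>G\<in>C. \<forall>x\<in>J. e (F x) (G x) < \<eta>))" for C F
  \<comment> \<open>Good sets play the part of closed convex sets, with pointwise centers in place
    of convex combinations.\<close>
  define good where "good C \<longleftrightarrow> C \<subseteq> K \<and> (\<forall>G\<subseteq>C. G \<noteq> {} \<longrightarrow> cm G \<in> C) \<and> (\<forall>F\<in>K. appr C F \<longrightarrow> F \<in> C)" for C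
  have appr_mono: "appr C F \<Longrightarrow> C \<subseteq> C' \<Longrightarrow> appr C' F" for C C' F unfolding appr_def by blast
  have apprD: "\<exists>G\<in>C. e (F x) (G x) < \<eta>" if "appr C F" "x \<in> M" "0 < \<eta>" for C F x \<eta>
    using that(1)[unfolded appr_def, rule_format, of "{x}" \<eta>] that by auto
  have goodK: "good K" unfolding good_def using center by auto
  have good_Int: "good (\<Inter>\<C>)" if "\<C> \<noteq> {}" "\<And>C. C \<in> \<C> \<Longrightarrow> good C" for \<C>
    unfolding good_def
  proof (intro conjI allI impI ballI)
    show "\<Inter>\<C> \<subseteq> K" using that unfolding good_def by blast
    show "cm G \<in> \<Inter>\<C>" if "G \<subseteq> \<Inter>\<C>" "G \<noteq> {}" for G
    proof
      fix C assume C: "C \<in> \<C>"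
      then have "good C" "G \<subseteq> C" using that \<open>\<And>C. C \<in> \<C> \<Longrightarrow> good C\<close> by blast+
      then show "cm G \<in> C" using that unfolding good_def by blast
    qed
    show "F \<in> \<Inter>\<C>" if "F \<in> K" "appr (\<Inter>\<C>) F" for F
    proof
      fix C assume C: "C \<in> \<C>"
      then have "good C" "appr C F" using that appr_mono[of "\<Inter>\<C>" F C] \<open>\<And>C. C \<in> \<C> \<Longrightarrow> good C\<close> by blast+
      then show "F \<in> C" using that unfolding good_def by blast
    qed
  qed
  have imT: "(\<lambda>F. F x) ` G \<subseteq> T" if "G \<subseteq> K" "x \<in> M" for G x using that KT by blast
  define \<A> where "\<A> = {C. good C \<and> C \<noteq> {} \<and> \<Phi> ` C \<subseteq> C}"
  \<comment> \<open>This takes the place of compactness: at each point the radii decrease along the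
    chain, and by \<open>mono\<close> the centers move by no more than the radii drop. So the
    centers converge, and their pointwise limit belongs to every member of the chain.\<close>
  have chain_ne: "\<Inter>\<C> \<noteq> {}" if ne: "\<C> \<noteq> {}" and sub: "\<C> \<subseteq> \<A>"
    and ch: "\<And>C C'. C \<in> \<C> \<Longrightarrow> C' \<in> \<C> \<Longrightarrow> C \<subseteq> C' \<or> C' \<subseteq> C" for \<C>
  proof -
    define c where "c C x = cen ((\<lambda>F. F x) ` C)" for C :: "('a \<Rightarrow> 'b) set" and x
    define \<rho> where "\<rho> C x = rad ((\<lambda>F. F x) ` C)" for C :: "('a \<Rightarrow> 'b) set" and x
    have CK: "C \<subseteq> K" "C \<noteq> {}" if "C \<in> \<C>" for C using that sub unfolding \<A>_def good_def by auto
    have cT: "c C x \<in> T" if "C \<in> \<C>" "x \<in> M" for C x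
      unfolding c_def using CK[OF that(1)] imT that by blast
    have \<rho>0: "0 \<le> \<rho> C x" if "C \<in> \<C>" "x \<in> M" for C x
      unfolding \<rho>_def using CK[OF that(1)] imT that by (intro rad_nonneg) auto
    have mono: "e (c C x) (c C' x) + \<rho> C x \<le> \<rho> C' x" if C: "C \<in> \<C>" "C' \<in> \<C>" "C \<subseteq> C'" and x: "x \<in> M" for C C' x
    proof -
      have "e (cen ((\<lambda>F. F x) ` C')) (cen ((\<lambda>F. F x) ` C)) + rad ((\<lambda>F. F x) ` C) \<le> rad ((\<lambda>F. F x) ` C')"
      proof (rule cen_least)
        show "(\<lambda>F. F x) ` C \<noteq> {}" "(\<lambda>F. F x) ` C \<subseteq> T" using CK[OF C(1)] imT x by auto
        show "cen ((\<lambda>F. F x) ` C') \<in> T" using cT[OF C(2) x] unfolding c_def .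
        show "e (cen ((\<lambda>F. F x) ` C')) s \<le> rad ((\<lambda>F. F x) ` C')" if "s \<in> (\<lambda>F. F x) ` C" for s
          using that C(3) CK[OF C(2)] imT[OF _ x] by (intro cen_rad) auto
      qed
      then show ?thesis unfolding c_def \<rho>_def by (simp add: tr.commute)
    qed
    define r where "r x = Inf ((\<lambda>C. \<rho> C x) ` \<C>)" for x
    have r_le: "r x \<le> \<rho> C x" if "C \<in> \<C>" "x \<in> M" for C x
      unfolding r_def using that \<rho>0 by (intro cINF_lower bdd_belowI[of _ 0]) auto
    have r_ap: "\<exists>C\<in>\<C>. \<rho> C x < r x + \<eta>" if "x \<in> M" "0 < \<eta>" for x \<eta>
    proof -
      have "Inf ((\<lambda>C. \<rho> C x) ` \<C>) < r x + \<eta>" unfolding r_def using that by simp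
      moreover have "bdd_below ((\<lambda>C. \<rho> C x) ` \<C>)" using that \<rho>0 by (intro bdd_belowI[of _ 0]) auto
      ultimately show ?thesis using ne cInf_less_iff[of "(\<lambda>C. \<rho> C x) ` \<C>" "r x + \<eta>"] by auto
    qed
    have "\<exists>l. l \<in> T \<and> (\<forall>C\<in>\<C>. e (c C x) l \<le> \<rho> C x - r x)" if x: "x \<in> M" for x
    proof -
      have "\<forall>n. \<exists>C\<in>\<C>. \<rho> C x < r x + inverse (real (Suc n))" using r_ap x by auto
      then obtain S where S: "\<And>n. S n \<in> \<C>" "\<And>n. \<rho> (S n) x < r x + inverse (real (Suc n))" by metis
      have near: "e (c C x) (c (S n) x) \<le> \<rho> C x - r x + inverse (real (Suc n))" if C: "C \<in> \<C>" for C n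
      proof (cases "C \<subseteq> S n")
        case True
        have "e (c C x) (c (S n) x) + \<rho> C x \<le> \<rho> (S n) x" using mono[OF C S(1) True x] .
        then show ?thesis using r_le[OF C x] S(2)[of n] by linarith
      next
        case False
        then have "S n \<subseteq> C" using ch C S by blast
        then have "e (c (S n) x) (c C x) + \<rho> (S n) x \<le> \<rho> C x" using mono[OF S(1) C _ x] by blast
        moreover have "0 \<le> inverse (real (Suc n))" by simp
        ultimately show ?thesis
          using r_le[OF S(1) x, of n] tr.commute[of "c (S n) x" "c C x"] by linarith
      qed
      have "e (c (S m) x) (c (S n) x) \<le> inverse (real (Suc m)) + inverse (real (Suc n))" for m n
        using near[OF S(1), of m n] S(2)[of m] by linarith
      then obtain l where l: "l \<in> T" "(\<lambda>n. e (c (S n) x) l) \<longlonglongrightarrow> 0"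
        using limit_of_cauchy_bound[of "\<lambda>n. c (S n) x", OF cT[OF S(1) x]] by metis
      have "e (c C x) l \<le> \<rho> C x - r x" if C: "C \<in> \<C>" for C
      proof -
        have "e (c C x) l \<le> \<rho> C x - r x + inverse (real (Suc n)) + e (c (S n) x) l" for n
          using near[OF C, of n] tr.triangle[of "c C x" "c (S n) x" l] cT C S x l by fastforce
        moreover have "(\<lambda>n. \<rho> C x - r x + inverse (real (Suc n)) + e (c (S n) x) l) \<longlonglongrightarrow> \<rho> C x - r x + 0 + 0"
          by (intro tendsto_intros l LIMSEQ_inverse_real_of_nat)
        ultimately show ?thesis using LIMSEQ_le_const[of _ "\<rho> C x - r x" "e (c C x) l"] by auto
      qed
      then show ?thesis using l by blast
    qed
    then obtain l where l: "\<And>x. x \<in> M \<Longrightarrow> l x \<in> T"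
      "\<And>x C. x \<in> M \<Longrightarrow> C \<in> \<C> \<Longrightarrow> e (c C x) (l x) \<le> \<rho> C x - r x" by metis
    define F where "F = restrict l M"
    \<comment> \<open>The radii are monotone along the chain, so one member serves finitely many
      coordinates at once.\<close>
    have small: "\<exists>C\<in>\<C>. C \<subseteq> C0 \<and> (\<forall>x\<in>J. \<rho> C x < r x + \<eta>)"
      if "finite J" "J \<subseteq> M" "0 < \<eta>" "C0 \<in> \<C>" for J \<eta> C0
      using that
    proof (induction J rule: finite_induct)
      case empty
      then show ?case by blast
    next
      case (insert x J)
      then obtain C where C: "C \<in> \<C>" "C \<subseteq> C0" "\<forall>x\<in>J. \<rho> C x < r x + \<eta>" by auto
      obtain C' where C': "C' \<in> \<C>" "\<rho> C' x < r x + \<eta>" using r_ap insert by blast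
      have xM: "x \<in> M" and JM: "J \<subseteq> M" using insert by auto
      show ?case
      proof (cases "C \<subseteq> C'")
        case True
        then have "\<rho> C x < r x + \<eta>" using mono[OF C(1) C'(1) True xM] C' tr.nonneg[of "c C x" "c C' x"] by linarith
        then show ?thesis using C by auto
      next
        case False
        then have s: "C' \<subseteq> C" using ch C C' by blast
        have "\<rho> C' y < r y + \<eta>" if "y \<in> J" for y
        proof -
          have "y \<in> M" "\<rho> C y < r y + \<eta>" using that JM C(3) by auto
          then show ?thesis using mono[OF C'(1) C(1) s, of y] tr.nonneg[of "c C' y" "c C y"] by linarith
        qed
        then show ?thesis using C C' s by (intro bexI[of _ C']) auto
      qed
    qed
    have apprF: "appr C0 F" if C0: "C0 \<in> \<C>" for C0
      unfolding appr_def
    proof (intro allI impI)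
      fix J \<eta> assume J: "finite J" "J \<subseteq> M" "(0::real) < \<eta>"
      obtain C where C: "C \<in> \<C>" "C \<subseteq> C0" "\<forall>x\<in>J. \<rho> C x < r x + \<eta>" using small[OF J C0] by blast
      have "cm C \<in> C" using C CK[OF C(1)] sub unfolding \<A>_def good_def by blast
      moreover have "e (F x) (cm C x) < \<eta>" if "x \<in> J" for x
      proof -
        have "x \<in> M" using that J by auto
        then have "e (c C x) (l x) < \<eta>" using l(2)[OF _ C(1)] C(3) that by fastforce
        then show ?thesis unfolding F_def cm_def c_def using \<open>x \<in> M\<close> by (simp add: tr.commute)
      qed
      ultimately show "\<exists>G\<in>C0. \<forall>x\<in>J. e (F x) (G x) < \<eta>" using C(2) by blast
    qed
    obtain C1 where C1: "C1 \<in> \<C>" using ne by blast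
    have "F \<in> K"
    proof (rule closed)
      show "F \<in> extensional M" unfolding F_def by simp
      show "F x \<in> T" if "x \<in> M" for x unfolding F_def using l that by simp
      show "\<exists>G\<in>K. \<forall>x\<in>J. e (F x) (G x) < \<eta>" if "finite J" "J \<subseteq> M" "0 < \<eta>" for J \<eta>
        using appr_mono[OF apprF[OF C1] CK(1)[OF C1]] that unfolding appr_def by blast
    qed
    then have "F \<in> C" if "C \<in> \<C>" for C using apprF[OF that] that sub unfolding \<A>_def good_def by blast
    then show ?thesis by blast
  qed
  \<comment> \<open>Complements turn the maximal element of Zorn's lemma into a minimal invariant
    set.\<close>
  have "\<exists>N\<in>uminus ` \<A>. \<forall>X\<in>uminus ` \<A>. N \<subseteq> X \<longrightarrow> X = N"
  proof (rule subset_Zorn_nonempty)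
    have "K \<in> \<A>" unfolding \<A>_def using goodK \<open>K \<noteq> {}\<close> \<Phi> by auto
    then show "uminus ` \<A> \<noteq> {}" by blast
    fix \<D> assume D: "\<D> \<noteq> {}" "subset.chain (uminus ` \<A>) \<D>"
    define \<C> where "\<C> = uminus ` \<D>"
    have DC: "\<D> = uminus ` \<C>" unfolding \<C>_def by (simp add: image_image)
    have sub: "\<C> \<subseteq> \<A>" using D(2) unfolding \<C>_def subset.chain_def by force
    have ch: "C \<subseteq> C' \<or> C' \<subseteq> C" if "C \<in> \<C>" "C' \<in> \<C>" for C C'
    proof -
      have "- C \<in> \<D>" "- C' \<in> \<D>" using that unfolding DC by auto
      then have "- C \<subset> - C' \<or> - C' \<subset> - C \<or> - C = - C'" using D(2) unfolding subset.chain_def by blast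
      then show ?thesis by blast
    qed
    have ne: "\<C> \<noteq> {}" using D unfolding \<C>_def by blast
    have "\<Inter>\<C> \<in> \<A>"
    proof -
      have "good (\<Inter>\<C>)" using good_Int[OF ne] sub unfolding \<A>_def by blast
      moreover have "\<Phi> ` \<Inter>\<C> \<subseteq> \<Inter>\<C>" using sub unfolding \<A>_def by blast
      ultimately show ?thesis using chain_ne[OF ne sub ch] unfolding \<A>_def by blast
    qed
    moreover have "\<Union>\<D> = - \<Inter>\<C>" unfolding DC by blast
    ultimately show "\<Union>\<D> \<in> uminus ` \<A>" by blast
  qed
  then obtain C where C: "C \<in> \<A>" and min: "\<And>X. X \<in> \<A> \<Longrightarrow> X \<subseteq> C \<Longrightarrow> X = C" by force
  have gC: "good C" "C \<noteq> {}" "\<Phi> ` C \<subseteq> C" "C \<subseteq> K" using C unfolding \<A>_def good_def by auto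
  define H where "H = \<Inter>{C'. good C' \<and> \<Phi> ` C \<subseteq> C'}"
  have HC: "H \<subseteq> C" unfolding H_def using gC by blast
  have Hg: "good H" unfolding H_def using good_Int[of "{C'. good C' \<and> \<Phi> ` C \<subseteq> C'}"] gC by blast
  have "\<Phi> ` C \<subseteq> H" unfolding H_def by blast
  then have "H \<in> \<A>" unfolding \<A>_def using Hg HC gC by blast
  then have HeqC: "H = C" using min HC by blast
  have halve: "\<forall>F\<in>C. \<forall>G\<in>C. \<forall>x\<in>M. e (F x) (G x) \<le> \<delta> / 2"
    if \<delta>: "\<forall>F\<in>C. \<forall>G\<in>C. \<forall>x\<in>M. e (F x) (G x) \<le> \<delta>" for \<delta>
  proof -
    have good_ball: "good {F\<in>C. \<forall>x\<in>M. e (G x) (F x) \<le> \<delta> / 2}" (is "good ?B")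
      if G: "G \<in> K" for G
      unfolding good_def
    proof (intro conjI allI impI ballI)
      show "?B \<subseteq> K" using gC by blast
      show "cm S \<in> ?B" if S: "S \<subseteq> ?B" "S \<noteq> {}" for S
      proof -
        have "e (G x) (cm S x) \<le> \<delta> / 2" if x: "x \<in> M" for x
        proof -
          have "S \<subseteq> K" using S gC by blast
          then have "e (G x) (cen ((\<lambda>F. F x) ` S)) \<le> \<delta> / 2"
            using S imT x KT G by (intro cen_ball) auto
          then show ?thesis unfolding cm_def using x by simp
        qed
        moreover have "cm S \<in> C" using S gC(1) unfolding good_def by blast
        ultimately show ?thesis by blast
      qed
      show "F \<in> ?B" if F: "F \<in> K" "appr ?B F" for F
      proof -
        have "F \<in> C" using F appr_mono[OF F(2), of C] gC(1) unfolding good_def by blast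
        moreover have "e (G x) (F x) \<le> \<delta> / 2" if x: "x \<in> M" for x
        proof (rule field_le_epsilon)
          fix \<eta> :: real assume "0 < \<eta>"
          then obtain F' where F': "F' \<in> ?B" "e (F x) (F' x) < \<eta>" using apprD[OF F(2) x] by blast
          then have "e (G x) (F x) \<le> e (G x) (F' x) + e (F x) (F' x)"
            using tr.triangle'[of "G x" "F' x" "F x"] KT G F gC x by auto
          then show "e (G x) (F x) \<le> \<delta> / 2 + \<eta>" using F' x by fastforce
        qed
        ultimately show ?thesis by blast
      qed
    qed
    define C' where "C' = C \<inter> (\<Inter>G\<in>C. {F\<in>C. \<forall>x\<in>M. e (G x) (F x) \<le> \<delta> / 2})"
    have "good C'"
    proof -
      have "good (\<Inter>(insert C ((\<lambda>G. {F\<in>C. \<forall>x\<in>M. e (G x) (F x) \<le> \<delta> / 2}) ` C)))"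
        using good_ball gC by (intro good_Int) auto
      then show ?thesis unfolding C'_def by simp
    qed
    moreover have "cm C \<in> C'"
    proof -
      have "e (G x) (cm C x) \<le> \<delta> / 2" if G: "G \<in> C" and x: "x \<in> M" for G x
      proof -
        have I: "(\<lambda>F. F x) ` C \<noteq> {}" "(\<lambda>F. F x) ` C \<subseteq> T" using gC imT x by auto
        have "e (cen ((\<lambda>F. F x) ` C)) (G x) \<le> rad ((\<lambda>F. F x) ` C)" using I G by (intro cen_rad) auto
        moreover have "rad ((\<lambda>F. F x) ` C) \<le> \<delta> / 2" using I \<delta> x by (intro rad_le_half_diam) auto
        ultimately show ?thesis unfolding cm_def using x by (simp add: tr.commute)
      qed
      moreover have "cm C \<in> C" using gC unfolding good_def by blast
      ultimately show ?thesis unfolding C'_def by blast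
    qed
    moreover have "\<Phi> F \<in> C'" if F: "F \<in> C'" for F
    proof -
      have FC: "F \<in> C" using F unfolding C'_def by blast
      then have \<Phi>F: "\<Phi> F \<in> C" "\<Phi> F \<in> K" using gC by auto
      \<comment> \<open>A good ball contains \<open>C\<close> as soon as it contains the image of
        \<open>C\<close>, because \<open>C\<close> equals the hull \<open>H\<close> of that
        image.\<close>
      have "\<Phi> ` C \<subseteq> {G\<in>C. \<forall>x\<in>M. e (\<Phi> F x) (G x) \<le> \<delta> / 2}"
      proof clarify
        fix G assume G: "G \<in> C"
        have "e (F x) (G x) \<le> \<delta> / 2" if "x \<in> M" for x
          using F G that unfolding C'_def by (auto simp: tr.commute)
        then have "\<forall>x\<in>M. e (\<Phi> F x) (\<Phi> G x) \<le> \<delta> / 2" using nonexp FC G gC by blast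
        then show "\<Phi> G \<in> C \<and> (\<forall>x\<in>M. e (\<Phi> F x) (\<Phi> G x) \<le> \<delta> / 2)" using G gC by blast
      qed
      then have "H \<subseteq> {G\<in>C. \<forall>x\<in>M. e (\<Phi> F x) (G x) \<le> \<delta> / 2}"
        unfolding H_def using good_ball[OF \<Phi>F(2)] by blast
      then show ?thesis unfolding HeqC C'_def using \<Phi>F by (auto simp: tr.commute)
    qed
    ultimately have "C' \<in> \<A>" unfolding \<A>_def by blast
    then have "C' = C" using min unfolding C'_def by blast
    then show ?thesis unfolding C'_def by blast
  qed
  obtain D where D: "\<And>x y. x \<in> T \<Longrightarrow> y \<in> T \<Longrightarrow> e x y \<le> D" using bounded by blast
  have pow: "\<forall>F\<in>C. \<forall>G\<in>C. \<forall>x\<in>M. e (F x) (G x) \<le> D * (1/2) ^ n" for n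
  proof (induction n)
    case 0
    have "e (F x) (G x) \<le> D" if "F \<in> C" "G \<in> C" "x \<in> M" for F G x
      using that gC(4) by (intro D KT) auto
    then show ?case by simp
  next
    case (Suc n)
    then show ?case using halve[OF Suc.IH] by (simp add: field_simps)
  qed
  obtain F where F: "F \<in> C" using gC by blast
  have "\<Phi> F x = F x" if x: "x \<in> M" for x
  proof -
    have in1: "\<Phi> F \<in> C" "\<Phi> F x \<in> T" "F x \<in> T" using F gC KT x by auto
    have "(\<lambda>n. D * (1/2) ^ n) \<longlonglongrightarrow> D * 0" by (intro tendsto_intros LIMSEQ_power_zero) simp
    moreover have "e (\<Phi> F x) (F x) \<le> D * (1/2) ^ n" for n using pow F in1 x by blast
    ultimately have "e (\<Phi> F x) (F x) \<le> 0"
      using LIMSEQ_le_const[of "\<lambda>n. D * (1/2) ^ n" 0 "e (\<Phi> F x) (F x)"] by auto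
    then show ?thesis using in1 by (metis antisym tr.nonneg tr.zero)
  qed
  moreover have "F \<in> K" "\<Phi> F \<in> K" using F gC by auto
  ultimately show ?thesis using ext extensionalityI[of "\<Phi> F" M F] by blast
qed

end

section \<open>Comparison of tree-valued subharmonic maps\<close>

lemma Sup_add_eq:
  fixes f :: "'a \<Rightarrow> real" and g :: "'b \<Rightarrow> real"
  assumes ne: "A \<noteq> {}" "B \<noteq> {}" and bdd: "bdd_above (f ` A)" "bdd_above (g ` B)"
    and h: "\<And>a b. a \<in> A \<Longrightarrow> b \<in> B \<Longrightarrow> h (a, b) = f a + g b"
  shows "(SUP p\<in>A \<times> B. h p) = (SUP a\<in>A. f a) + (SUP b\<in>B. g b)"
proof (rule antisym)
  have up: "h (a, b) \<le> (SUP a\<in>A. f a) + (SUP b\<in>B. g b)" if "a \<in> A" "b \<in> B" for a b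
    using that bdd by (simp add: h add_mono cSUP_upper)
  then show "(SUP p\<in>A \<times> B. h p) \<le> (SUP a\<in>A. f a) + (SUP b\<in>B. g b)"
    using ne by (intro cSUP_least) auto
  have bh: "bdd_above (h ` (A \<times> B))" using up by (intro bdd_aboveI) auto
  have "(SUP a\<in>A. f a) \<le> (SUP p\<in>A \<times> B. h p) - g b" if b: "b \<in> B" for b
  proof (rule cSUP_least[OF ne(1)])
    fix a assume a: "a \<in> A"
    have "h (a, b) \<le> (SUP p\<in>A \<times> B. h p)" using a b by (intro cSUP_upper bh) auto
    then show "f a \<le> (SUP p\<in>A \<times> B. h p) - g b" using h a b by simp
  qed
  then have "(SUP b\<in>B. g b) \<le> (SUP p\<in>A \<times> B. h p) - (SUP a\<in>A. f a)"
    by (intro cSUP_least[OF ne(2)]) (simp add: algebra_simps)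
  then show "(SUP a\<in>A. f a) + (SUP b\<in>B. g b) \<le> (SUP p\<in>A \<times> B. h p)" by simp
qed

context rtree
begin

section \<open>Distances between set-valued maps\<close>

definition far :: "('a \<Rightarrow> 'b set) \<Rightarrow> 'b \<Rightarrow> 'a \<Rightarrow> real" where
  "far P t x = (SUP a\<in>P x. e t a)"

definition maxdist :: "('a \<Rightarrow> 'b set) \<Rightarrow> ('a \<Rightarrow> 'b set) \<Rightarrow> 'a \<Rightarrow> real" where
  "maxdist P Q x = (SUP p\<in>P x \<times> Q x. case p of (a, b) \<Rightarrow> e a b)"

lemma bdd_above_dist: "A \<subseteq> T \<Longrightarrow> t \<in> T \<Longrightarrow> bdd_above ((\<lambda>a. e t a) ` A)"
  using bounded by (meson bdd_aboveI2 subsetD)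

lemma far_upper: "P x \<subseteq> T \<Longrightarrow> t \<in> T \<Longrightarrow> a \<in> P x \<Longrightarrow> e t a \<le> far P t x"
  unfolding far_def by (intro cSUP_upper bdd_above_dist)

lemma far_least: "P x \<noteq> {} \<Longrightarrow> (\<And>a. a \<in> P x \<Longrightarrow> e t a \<le> r) \<Longrightarrow> far P t x \<le> r"
  unfolding far_def by (intro cSUP_least)

lemma far_approx: "P x \<noteq> {} \<Longrightarrow> r < far P t x \<Longrightarrow> \<exists>a\<in>P x. r < e t a"
  using far_least by (meson linorder_not_less)

lemma maxdist_bdd: "P x \<subseteq> T \<Longrightarrow> Q x \<subseteq> T \<Longrightarrow> bdd_above ((\<lambda>p. case p of (a, b) \<Rightarrow> e a b) ` (P x \<times> Q x))"
proof -
  assume PQ: "P x \<subseteq> T" "Q x \<subseteq> T"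
  obtain D where D: "\<And>x y. x \<in> T \<Longrightarrow> y \<in> T \<Longrightarrow> e x y \<le> D" using bounded by blast
  show ?thesis by (rule bdd_aboveI2[of _ _ D]) (use PQ D in auto)
qed

lemma maxdist_upper:
  assumes "P x \<subseteq> T" "Q x \<subseteq> T" "a \<in> P x" "b \<in> Q x" shows "e a b \<le> maxdist P Q x"
  using cSUP_upper[OF _ maxdist_bdd[of P x Q], of "(a, b)"] assms unfolding maxdist_def by simp

lemma maxdist_least:
  "P x \<noteq> {} \<Longrightarrow> Q x \<noteq> {} \<Longrightarrow> (\<And>a b. a \<in> P x \<Longrightarrow> b \<in> Q x \<Longrightarrow> e a b \<le> r) \<Longrightarrow> maxdist P Q x \<le> r"
  unfolding maxdist_def by (intro cSUP_least) auto

lemma maxdist_sym: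
  assumes "P x \<subseteq> T" "Q x \<subseteq> T" "P x \<noteq> {}" "Q x \<noteq> {}" shows "maxdist P Q x = maxdist Q P x"
  by (intro antisym maxdist_least; metis assms maxdist_upper tr.commute)

lemma maxdist_split:
  assumes "P x \<subseteq> T" "Q x \<subseteq> T" "P x \<noteq> {}" "Q x \<noteq> {}" "t \<in> T"
    "\<And>a b. a \<in> P x \<Longrightarrow> b \<in> Q x \<Longrightarrow> e a b = e a t + e t b"
  shows "maxdist P Q x = far P t x + far Q t x"
  unfolding maxdist_def far_def using assms
  by (intro Sup_add_eq bdd_above_dist) (auto simp: tr.commute)

end

text \<open>\<open>nb\<close> is adjacency at a fixed scale, \<open>\<Omega>\<close> the region
  where subharmonicity is required, \<open>\<sigma>\<close> a bound for the oscillation between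
  neighbours. The maps are set-valued so that the values over a whole ball can count as one value;
  this allows maps of different scales to be compared.\<close>

locale tree_comparison = rtree T e for T :: "'b set" and e +
  fixes M :: "'a set" and nb :: "'a \<Rightarrow> 'a \<Rightarrow> bool" and \<Omega> :: "'a set" and \<sigma> :: real
  assumes nb_refl: "x \<in> M \<Longrightarrow> nb x x" and nb_sym: "nb x y \<Longrightarrow> nb y x"
    and \<sigma>_pos: "0 < \<sigma>" and \<Omega>_sub: "\<Omega> \<subseteq> M"
begin

section \<open>The comparison principle\<close>

definition near :: "('a \<Rightarrow> 'b set) \<Rightarrow> 'a \<Rightarrow> 'b set" where
  "near P x = (\<Union>z\<in>{z\<in>M. nb x z}. P z)"

definition gain :: "('a \<Rightarrow> 'b set) \<Rightarrow> ('a \<Rightarrow> 'b set) \<Rightarrow> 'a \<Rightarrow> real" where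
  "gain P Q x = maxdist (near P) Q x - maxdist P Q x"

text \<open>Rearranged, the last condition says that the best increase of \<open>far P t\<close>
  among the neighbours of \<open>x\<close> is at least any decrease to a neighbour.\<close>

definition subharm :: "('a \<Rightarrow> 'b set) \<Rightarrow> bool" where
  "subharm P \<longleftrightarrow> (\<forall>x\<in>M. P x \<noteq> {} \<and> P x \<subseteq> T) \<and>
     (\<forall>x\<in>M. \<forall>y\<in>M. nb x y \<longrightarrow> (\<forall>a\<in>P x. \<forall>b\<in>P y. e a b \<le> \<sigma>)) \<and>
     (\<forall>x\<in>\<Omega>. \<forall>t\<in>T. \<forall>y\<in>M. nb x y \<longrightarrow> 2 * far P t x \<le> far P t y + far (near P) t x)"

text \<open>Values change by at most \<open>2 * \<sigma>\<close> over two neighbour steps, so the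
  margin \<open>3 * \<sigma>\<close> lets \<open>t\<close> still separate the maps there.\<close>

definition sep :: "('a \<Rightarrow> 'b set) \<Rightarrow> ('a \<Rightarrow> 'b set) \<Rightarrow> 'b \<Rightarrow> 'a \<Rightarrow> bool" where
  "sep P Q t x \<longleftrightarrow> t \<in> T \<and> (\<exists>a\<in>P x. \<exists>b\<in>Q x. e a b = e a t + e t b \<and> 3 * \<sigma> < e a t \<and> 3 * \<sigma> < e b t)"

lemma subharmD:
  assumes "subharm P"
  shows "x \<in> M \<Longrightarrow> P x \<noteq> {}" "x \<in> M \<Longrightarrow> P x \<subseteq> T"
    "x \<in> M \<Longrightarrow> y \<in> M \<Longrightarrow> nb x y \<Longrightarrow> a \<in> P x \<Longrightarrow> b \<in> P y \<Longrightarrow> e a b \<le> \<sigma>"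
    "x \<in> \<Omega> \<Longrightarrow> t \<in> T \<Longrightarrow> y \<in> M \<Longrightarrow> nb x y \<Longrightarrow> 2 * far P t x \<le> far P t y + far (near P) t x"
  using assms unfolding subharm_def by blast+

lemma far_up: "subharm P \<Longrightarrow> x \<in> M \<Longrightarrow> t \<in> T \<Longrightarrow> a \<in> P x \<Longrightarrow> e t a \<le> far P t x"
  using far_upper[of P x t a] subharmD(2)[of P x] by simp

lemma maxdist_comm: "subharm P \<Longrightarrow> subharm Q \<Longrightarrow> x \<in> M \<Longrightarrow> maxdist Q P x = maxdist P Q x"
  using maxdist_sym[of P x Q] subharmD(1,2)[of P x] subharmD(1,2)[of Q x] by simp

lemma near_ne: "subharm P \<Longrightarrow> x \<in> M \<Longrightarrow> near P x \<noteq> {}"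
  unfolding near_def using nb_refl subharmD(1) by blast

lemma near_T: "subharm P \<Longrightarrow> near P x \<subseteq> T"
  unfolding near_def using subharmD(2) by blast

lemma far_near_approx:
  assumes P: "subharm P" and t: "t \<in> T" and x: "x \<in> M" and r: "r < far (near P) t x"
  shows "\<exists>z\<in>M. nb x z \<and> r < far P t z"
proof -
  obtain a where "a \<in> near P x" "r < e t a" using far_approx[OF near_ne[OF P x] r] by blast
  then obtain z where z: "z \<in> M" "nb x z" "a \<in> P z" unfolding near_def by blast
  then have "e t a \<le> far P t z" using far_up[OF P z(1) t] by blast
  then show ?thesis using z \<open>r < e t a\<close> by auto
qed

lemma sep_sym: "sep P Q t x \<Longrightarrow> sep Q P t x"
  unfolding sep_def by (metis add.commute tr.commute)

lemma osc2:
  assumes P: "subharm P" and x: "x \<in> M" "y \<in> M" "z \<in> M" "nb x y" "nb y z" "a \<in> P x" "b \<in> P z"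
  shows "e b a \<le> 2 * \<sigma>"
proof -
  obtain c where c: "c \<in> P y" using subharmD(1)[OF P] x by blast
  have "e a c \<le> \<sigma>" "e c b \<le> \<sigma>" using subharmD(3)[OF P] x c by blast+
  moreover have "a \<in> T" "b \<in> T" "c \<in> T" using subharmD(2)[OF P] x c by blast+
  ultimately show ?thesis using tr.triangle[of a c b] by (simp add: tr.commute)
qed

lemma sep_between:
  assumes P: "subharm P" and Q: "subharm Q" and s: "sep P Q t x" and x: "x \<in> M"
    and z: "y \<in> M" "z \<in> M" "nb x y" "nb y z" "y' \<in> M" "z' \<in> M" "nb x y'" "nb y' z'"
    and ab: "a \<in> P z" "b \<in> Q z'"
  shows "e a b = e a t + e t b"
proof -
  obtain a0 b0 where a0: "t \<in> T" "a0 \<in> P x" "b0 \<in> Q x" "e a0 b0 = e a0 t + e t b0" "3 * \<sigma> < e a0 t" "3 * \<sigma> < e b0 t"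
    using s unfolding sep_def by blast
  have "e a a0 < e a0 t" using osc2[OF P x z(1-4) a0(2) ab(1)] a0(5) \<sigma>_pos by linarith
  moreover have "e b b0 < e b0 t" using osc2[OF Q x z(5-8) a0(3) ab(2)] a0(6) \<sigma>_pos by linarith
  moreover have "a0 \<in> T" "b0 \<in> T" "a \<in> T" "b \<in> T" using subharmD(2) P Q x z ab a0 by blast+
  ultimately show ?thesis using a0 between_stable by blast
qed

text \<open>A separating point splits the distance of the two maps into a sum of one-map functions,
  to which subharmonicity applies; the gain of \<open>P\<close> then no longer involves
  \<open>Q\<close>.\<close>

lemma sep_maxdist:
  assumes P: "subharm P" and Q: "subharm Q" and s: "sep P Q t x" and x: "x \<in> M" and z: "z \<in> M" "nb x z"
  shows "maxdist P Q z = far P t z + far Q t z"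
    and "gain P Q z = far (near P) t z - far P t z"
proof -
  have t: "t \<in> T" using s unfolding sep_def by blast
  note PQ = subharmD(1,2)[OF P] subharmD(1,2)[OF Q] near_ne[OF P] near_T[OF P]
  show m: "maxdist P Q z = far P t z + far Q t z"
    using sep_between[OF P Q s x] z nb_refl t PQ by (intro maxdist_split) auto
  have "maxdist (near P) Q z = far (near P) t z + far Q t z"
  proof (intro maxdist_split PQ z t)
    fix a b assume "a \<in> near P z" "b \<in> Q z"
    then show "e a b = e a t + e t b"
      using sep_between[OF P Q s x z(1) _ z(2) _ z(1) z(1) z(2)] nb_refl z unfolding near_def by blast
  qed
  then show "gain P Q z = far (near P) t z - far P t z" unfolding gain_def m by simp
qed

text \<open>Of the \<open>9 * \<sigma>\<close>, one \<open>\<sigma>\<close> pays for replacing the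
  extremal point by the prescribed \<open>a\<close>; the remaining \<open>8 * \<sigma>\<close> leave
  more than \<open>4 * \<sigma>\<close> beyond \<open>t\<close>.\<close>

lemma sep_exists:
  assumes P: "subharm P" and Q: "subharm Q" and x: "x \<in> M" and D: "9 * \<sigma> < maxdist P Q x" and a: "a \<in> P x"
  shows "\<exists>t b. t \<in> T \<and> b \<in> Q x \<and> e a b = e a t + e t b \<and> e a t = 4 * \<sigma> \<and> sep P Q t x"
proof -
  obtain a' b where b: "a' \<in> P x" "b \<in> Q x" "9 * \<sigma> < e a' b"
    using maxdist_least[of P x Q "9 * \<sigma>"] subharmD(1) P Q x D by force
  have T: "a \<in> T" "a' \<in> T" "b \<in> T" using subharmD(2) P Q x a b by blast+
  have "e a a' \<le> \<sigma>" using subharmD(3)[OF P x x nb_refl[OF x] a b(1)] .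
  then have ab: "8 * \<sigma> < e a b" using tr.triangle''[of a' a b] T b by auto
  then obtain t where t: "t \<in> T" "e a t = 4 * \<sigma>" "e t b = e a b - 4 * \<sigma>"
    using geodesic[of a b "4 * \<sigma>"] T \<sigma>_pos by auto
  then have "sep P Q t x" unfolding sep_def using a b ab \<sigma>_pos
    by (intro conjI bexI[of _ a] bexI[of _ b]) (auto simp: tr.commute)
  moreover have "e a b = e a t + e t b" using t by simp
  ultimately show ?thesis using t b by blast
qed

text \<open>Choose \<open>y\<close> almost realising the gain of \<open>P\<close>. Subharmonicity of
  \<open>Q\<close> at \<open>x\<close> bounds the loss of \<open>Q\<close> by its own gain, and
  subharmonicity of \<open>P\<close> at \<open>y\<close>, tested against the neighbour
  \<open>x\<close>, shows that the gain of \<open>P\<close> persists.\<close>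

lemma move:
  assumes P: "subharm P" and Q: "subharm Q" and s: "sep P Q t x" and x: "x \<in> \<Omega>" and \<delta>: "0 < \<delta>"
  shows "\<exists>y\<in>M. nb x y \<and> far P t x + gain P Q x - \<delta> < far P t y \<and>
    maxdist P Q x + gain P Q x - gain Q P x - \<delta> \<le> maxdist P Q y \<and>
    (y \<in> \<Omega> \<longrightarrow> gain P Q x - \<delta> \<le> gain P Q y)"
proof -
  have t: "t \<in> T" using s unfolding sep_def by blast
  have xM: "x \<in> M" using x \<Omega>_sub by blast
  have "far (near P) t x - \<delta> < far (near P) t x" using \<delta> by simp
  then obtain y where y: "y \<in> M" "nb x y" "far (near P) t x - \<delta> < far P t y"
    using far_near_approx[OF P t xM] by blast
  have gx: "gain P Q x = far (near P) t x - far P t x" "maxdist P Q x = far P t x + far Q t x"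
    "gain Q P x = far (near Q) t x - far Q t x"
    using sep_maxdist[OF P Q s xM xM nb_refl[OF xM]] sep_maxdist(2)[OF Q P sep_sym[OF s] xM xM nb_refl[OF xM]] by auto
  have gy: "maxdist P Q y = far P t y + far Q t y" "gain P Q y = far (near P) t y - far P t y"
    using sep_maxdist[OF P Q s xM y(1,2)] by auto
  have "2 * far Q t x \<le> far Q t y + far (near Q) t x" using subharmD(4)[OF Q x t y(1,2)] .
  then have "maxdist P Q x + gain P Q x - gain Q P x - \<delta> \<le> maxdist P Q y" using gx gy y by linarith
  moreover have "gain P Q x - \<delta> \<le> gain P Q y" if "y \<in> \<Omega>"
  proof -
    have "2 * far P t y \<le> far P t x + far (near P) t y"
      using subharmD(4)[OF P that t xM nb_sym[OF y(2)]] .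
    then show ?thesis using gx gy y by linarith
  qed
  ultimately show ?thesis using y gx by (intro bexI[of _ y]) auto
qed

text \<open>Among the points where \<open>maxdist\<close> exceeds \<open>\<beta>\<close> and one of the gains exceeds \<open>s\<close>, start near
  the supremum of \<open>maxdist\<close> and keep moving the map whose gain exceeds \<open>s\<close> away from the other:
  the loss in \<open>maxdist\<close> at most triples in each step, while the moving value recedes from
  the initial value of the other map by more than \<open>s\<close> per step.\<close>

lemma no_large_gain_aux:
  assumes P: "subharm P" and Q: "subharm Q" and out: "\<And>x. x \<in> M \<Longrightarrow> \<beta> < maxdist P Q x \<Longrightarrow> x \<in> \<Omega>"
    and \<beta>: "9 * \<sigma> \<le> \<beta>" and s: "0 < s"
    and Ms: "\<And>y. y \<in> M \<Longrightarrow> \<beta> < maxdist P Q y \<Longrightarrow> s < gain P Q y \<or> s < gain Q P y \<Longrightarrow> maxdist P Q y \<le> m"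
    and bound: "\<And>a b. a \<in> T \<Longrightarrow> b \<in> T \<Longrightarrow> e a b \<le> D" "D < real K * s" and \<delta>: "0 < \<delta>" "3 ^ K * \<delta> < m - \<beta>"
    and x0: "x0 \<in> M" "s < gain P Q x0" "m - \<delta> \<le> maxdist P Q x0"
  shows False
proof -
  note PT = subharmD(2)[OF P] and QT = subharmD(2)[OF Q]
  have sym: "maxdist Q P x = maxdist P Q x" if "x \<in> M" for x
    using maxdist_comm[OF P Q that] .
  have large: "\<beta> < maxdist P Q x" if "m - 3 ^ k * \<delta> \<le> maxdist P Q x" "k \<le> K" for x k
  proof -
    have "3 ^ k * \<delta> \<le> 3 ^ K * \<delta>" using that \<delta> by (intro mult_right_mono power_increasing) auto
    then show ?thesis using that \<delta> by linarith
  qed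
  have D0: "\<beta> < maxdist P Q x0" using large[of 0 x0] x0 by simp
  obtain a0 where a0: "a0 \<in> P x0" using subharmD(1)[OF P] x0 by blast
  obtain t0 b0 where t0: "t0 \<in> T" "b0 \<in> Q x0" "e a0 b0 = e a0 t0 + e t0 b0" "e a0 t0 = 4 * \<sigma>" "sep P Q t0 x0"
    using sep_exists[OF P Q x0(1) _ a0] D0 \<beta> by force
  have b0T: "b0 \<in> T" using t0 QT x0 by blast
  \<comment> \<open>\<open>b0\<close> stays fixed, while \<open>t\<close> is renewed in each step,
    because separation by the old point is guaranteed only near the old position. Each
    \<open>t\<close> lies between the moving values and \<open>b0\<close>, so the distance to
    \<open>b0\<close> measures the total progress.\<close>
  have "\<exists>x\<in>M. s < gain P Q x \<and> m - 3 ^ k * \<delta> \<le> maxdist P Q x \<and> real k * s \<le> far P b0 x \<and>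
      (\<exists>t. sep P Q t x \<and> (\<forall>a\<in>P x. e a b0 = e a t + e t b0) \<and> 4 * \<sigma> \<le> far P t x)" if "k \<le> K" for k
    using that
  proof (induction k)
    case 0
    have "e a b0 = e a t0 + e t0 b0" if "a \<in> P x0" for a
    proof (rule between_stable1[OF _ _ _ _ t0(3)])
      have "e a a0 \<le> \<sigma>" using subharmD(3)[OF P x0(1) x0(1) nb_refl[OF x0(1)] that a0] .
      then show "e a a0 < e a0 t0" using t0 \<sigma>_pos by linarith
    qed (use t0 b0T a0 that PT x0 in auto)
    moreover have "4 * \<sigma> \<le> far P t0 x0" using far_up[OF P x0(1) t0(1) a0] t0(4) by (simp add: tr.commute)
    moreover have "0 \<le> far P b0 x0"
      using far_up[OF P x0(1) b0T a0] tr.nonneg[of b0 a0] by linarith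
    ultimately show ?case using x0 t0 by (intro bexI[of _ x0]) auto
  next
    case (Suc k)
    then obtain x t where x: "x \<in> M" "s < gain P Q x" "m - 3 ^ k * \<delta> \<le> maxdist P Q x" "real k * s \<le> far P b0 x"
      and t: "sep P Q t x" "\<And>a. a \<in> P x \<Longrightarrow> e a b0 = e a t + e t b0" "4 * \<sigma> \<le> far P t x"
      using Suc_leD by blast
    have tT: "t \<in> T" using t unfolding sep_def by blast
    have D: "\<beta> < maxdist P Q x" using large[OF x(3)] Suc by auto
    have x\<Omega>: "x \<in> \<Omega>" using out x D by blast
    have Dm: "maxdist P Q x \<le> m" using Ms x D by blast
    \<comment> \<open>Otherwise moving \<open>Q\<close> instead would lead to a point with
      \<open>maxdist\<close> above \<open>m\<close> at which the gain of \<open>Q\<close> still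
      exceeds \<open>s\<close>, against \<open>Ms\<close>.\<close>
    have diff: "gain Q P x - gain P Q x \<le> m - maxdist P Q x"
    proof (rule ccontr)
      assume c: "\<not> ?thesis"
      define \<delta>' where "\<delta>' = (gain Q P x - gain P Q x - (m - maxdist P Q x)) / 2"
      have \<delta>': "0 < \<delta>'" using c unfolding \<delta>'_def by simp
      obtain y where y: "y \<in> M" "nb x y" "maxdist Q P x + gain Q P x - gain P Q x - \<delta>' \<le> maxdist Q P y"
          "y \<in> \<Omega> \<longrightarrow> gain Q P x - \<delta>' \<le> gain Q P y"
        using move[OF Q P sep_sym[OF t(1)] x\<Omega> \<delta>'] by blast
      have d2: "2 * \<delta>' = gain Q P x - gain P Q x - (m - maxdist P Q x)" unfolding \<delta>'_def by simp
      have m': "m < maxdist P Q y" using y(3) sym[OF x(1)] sym[OF y(1)] \<delta>' d2 by linarith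
      then have "\<beta> < maxdist P Q y" using D Dm by linarith
      moreover have "gain Q P x - \<delta>' \<le> gain Q P y" using y out calculation by blast
      then have "s < gain Q P y" using x(2) Dm \<delta>' d2 by linarith
      ultimately show False using Ms[OF y(1)] m' by auto
    qed
    define \<delta>1 where "\<delta>1 = min \<delta> ((gain P Q x - s) / 2)"
    have \<delta>1: "0 < \<delta>1" "\<delta>1 \<le> \<delta>" "\<delta>1 < gain P Q x - s" using x \<delta> unfolding \<delta>1_def by (auto simp: min_def field_simps)
    obtain y where y: "y \<in> M" "nb x y" "far P t x + gain P Q x - \<delta>1 < far P t y"
        "maxdist P Q x + gain P Q x - gain Q P x - \<delta>1 \<le> maxdist P Q y"
        "y \<in> \<Omega> \<longrightarrow> gain P Q x - \<delta>1 \<le> gain P Q y"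
      using move[OF P Q t(1) x\<Omega> \<delta>1(1)] by blast
    \<comment> \<open>By \<open>diff\<close> the deficit \<open>m - maxdist P Q\<close> at most
      doubles, up to an error \<open>\<delta>\<close>, and 2 * 3^k + 1 is at most 3^(k+1).\<close>
    have Dy: "m - 3 ^ Suc k * \<delta> \<le> maxdist P Q y"
    proof -
      have "\<delta> \<le> 3 ^ k * \<delta>" using \<delta> by simp
      moreover have "3 ^ Suc k * \<delta> = 3 * (3 ^ k * \<delta>)" by simp
      ultimately show ?thesis using y(4) diff x(3) \<delta>1(2) by linarith
    qed
    have y\<beta>: "\<beta> < maxdist P Q y" using large[OF Dy] Suc by auto
    have y\<Omega>: "y \<in> \<Omega>" using out y\<beta> y(1) by blast
    have gy: "s < gain P Q y" using y(5) y\<Omega> \<delta>1 by auto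
    have ft: "far P t x + s < far P t y" using y(3) \<delta>1 by linarith
    obtain a1 where a1: "a1 \<in> P x" "3 * \<sigma> < e t a1"
      using far_approx[of P x "3 * \<sigma>" t] subharmD(1)[OF P x(1)] t(3) \<sigma>_pos by auto
    have bt: "e a b0 = e a t + e t b0" if "a \<in> P y" for a
    proof (rule between_stable1[OF _ _ _ _ t(2)[OF a1(1)]])
      have "e a a1 \<le> \<sigma>" using subharmD(3)[OF P y(1) x(1) nb_sym[OF y(2)] that a1(1)] .
      then show "e a a1 < e a1 t" using a1 \<sigma>_pos by (simp add: tr.commute)
    qed (use tT b0T a1 that PT x y in auto)
    have far_b0: "far P b0 z = e t b0 + far P t z" if z: "z \<in> M" and "\<And>a. a \<in> P z \<Longrightarrow> e a b0 = e a t + e t b0" for z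
    proof (rule antisym)
      show "far P b0 z \<le> e t b0 + far P t z"
        using that far_up[OF P z tT] subharmD(1)[OF P z]
        by (intro far_least) (auto simp: tr.commute algebra_simps)
      have "far P t z \<le> far P b0 z - e t b0"
        using that far_up[OF P z b0T] subharmD(1)[OF P z]
        by (intro far_least) (fastforce simp: tr.commute algebra_simps)+
      then show "e t b0 + far P t z \<le> far P b0 z" by simp
    qed
    have far_y: "real (Suc k) * s \<le> far P b0 y"
      using far_b0[OF x(1) t(2)] far_b0[OF y(1) bt] ft x(4) by (simp add: algebra_simps)
    obtain a where a: "a \<in> P y" "4 * \<sigma> < e t a"
      using far_approx[of P y "4 * \<sigma>" t] subharmD(1)[OF P y(1)] ft t(3) s by auto
    obtain t' b where t': "t' \<in> T" "b \<in> Q y" "e a b = e a t' + e t' b" "e a t' = 4 * \<sigma>" "sep P Q t' y"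
      using sep_exists[OF P Q y(1) _ a(1)] y\<beta> \<beta> by force
    have aT: "a \<in> T" and bT: "b \<in> T" using a t' PT QT y by blast+
    \<comment> \<open>Both \<open>t\<close> and \<open>t'\<close> lie on the segment from
      \<open>a\<close> to \<open>b\<close>, and \<open>t'\<close> is closer to \<open>a\<close>.
      Hence \<open>t'\<close> lies between \<open>a\<close> and \<open>t\<close>, and therefore
      between \<open>a\<close> and \<open>b0\<close>.\<close>
    have "e a b = e a t + e t b"
      using sep_between[OF P Q t(1) x(1) y(1) y(1) y(2) nb_refl[OF y(1)] y(1) y(1) y(2) nb_refl[OF y(1)] a(1) t'(2)] .
    then have "same t' t b"
      using a t'(3,4) tr.nonneg[of t t'] tr.commute[of t a] unfolding same_def by linarith
    moreover have "\<not> same t' a b" using not_same t' aT bT by auto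
    ultimately have "\<not> same t' a t" using same_trans t' aT bT tT by blast
    then have "e a t = e a t' + e t' t" using not_same t' aT tT by blast
    moreover have "e t' b0 \<le> e t' t + e t b0" "e a b0 \<le> e a t' + e t' b0"
      using tr.triangle[of t' t b0] tr.triangle[of a t' b0] t'(1) tT b0T aT by auto
    ultimately have abt: "e a b0 = e a t' + e t' b0" using bt[OF a(1)] by linarith
    have "e a' b0 = e a' t' + e t' b0" if "a' \<in> P y" for a'
    proof (rule between_stable1[OF _ _ _ _ abt])
      have "e a' a \<le> \<sigma>" using subharmD(3)[OF P y(1) y(1) nb_refl[OF y(1)] that a(1)] .
      then show "e a' a < e a t'" using t' \<sigma>_pos by linarith
    qed (use t' b0T a that PT y in auto)
    moreover have "4 * \<sigma> \<le> far P t' y" using far_up[OF P y(1) t'(1) a(1)] t'(4) by (simp add: tr.commute)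
    ultimately show ?case using y(1) gy Dy far_y t'(5) by blast
  qed
  then obtain x where x: "x \<in> M" "real K * s \<le> far P b0 x" by blast
  have "far P b0 x \<le> D" using bound(1) b0T PT[OF x(1)] subharmD(1)[OF P x(1)] by (intro far_least) auto
  then show False using x bound(2) by linarith
qed

text \<open>The bound on the tree fixes the number \<open>K\<close> of steps of size
  \<open>s\<close> that is impossible. Only then is \<open>\<delta>\<close> chosen, so small that
  after \<open>K\<close> triplings the walk is still above \<open>\<beta>\<close>.\<close>

lemma no_large_gain:
  assumes P: "subharm P" and Q: "subharm Q" and out: "\<And>x. x \<in> M \<Longrightarrow> \<beta> < maxdist P Q x \<Longrightarrow> x \<in> \<Omega>"
    and \<beta>: "9 * \<sigma> \<le> \<beta>" and s: "0 < s" and x: "x \<in> M" "\<beta> < maxdist P Q x"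
  shows "gain P Q x \<le> s \<and> gain Q P x \<le> s"
proof (rule ccontr)
  assume c: "\<not> ?thesis"
  define W where "W = {y\<in>M. \<beta> < maxdist P Q y \<and> (s < gain P Q y \<or> s < gain Q P y)}"
  obtain D where D: "\<And>a b. a \<in> T \<Longrightarrow> b \<in> T \<Longrightarrow> e a b \<le> D" using bounded by blast
  obtain K where K: "D < real K * s" using ex_less_of_nat_mult[OF s] by blast
  have sym: "maxdist Q P y = maxdist P Q y" if "y \<in> M" for y
    using maxdist_comm[OF P Q that] .
  have bdd: "bdd_above (maxdist P Q ` W)"
  proof (rule bdd_aboveI2)
    fix y assume "y \<in> W"
    then have y: "y \<in> M" unfolding W_def by blast
    show "maxdist P Q y \<le> D" using subharmD(1,2)[OF P y] subharmD(1,2)[OF Q y] D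
      by (intro maxdist_least) auto
  qed
  have xW: "x \<in> W" using x c unfolding W_def by auto
  define m where "m = (SUP y\<in>W. maxdist P Q y)"
  have Ms: "maxdist P Q y \<le> m" if "y \<in> W" for y unfolding m_def using that bdd by (rule cSUP_upper)
  have m: "\<beta> < m" using Ms[OF xW] x by linarith
  define \<delta> where "\<delta> = (m - \<beta>) / (2 * 3 ^ K)"
  have \<delta>: "0 < \<delta>" "3 ^ K * \<delta> < m - \<beta>" using m unfolding \<delta>_def by (auto simp: field_simps)
  have "m - \<delta> < (SUP y\<in>W. maxdist P Q y)" using \<delta> unfolding m_def by simp
  then obtain x0 where x0: "x0 \<in> W" "m - \<delta> < maxdist P Q x0"
    using less_cSUP_iff[OF _ bdd, of "m - \<delta>"] xW by blast
  then have x0M: "x0 \<in> M" unfolding W_def by blast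
  have "s < gain P Q x0 \<or> s < gain Q P x0" using x0 unfolding W_def by blast
  then show False
  proof
    assume g: "s < gain P Q x0"
    show False
      by (rule no_large_gain_aux[OF P Q out \<beta> s _ D K \<delta> x0M g]) (use Ms x0 in \<open>auto simp: W_def\<close>)
  next
    assume g: "s < gain Q P x0"
    show False
      by (rule no_large_gain_aux[OF Q P _ \<beta> s _ D K \<delta> x0M g]) (use Ms x0 out x0M sym in \<open>auto simp: W_def\<close>)
  qed
qed

text \<open>Above \<open>\<beta>\<close> the gains are not positive, so subharmonicity keeps both
  one-map distances to a separating point from dropping at any neighbour. The excess over
  \<open>\<beta>\<close> then spreads along neighbours to a point outside \<open>\<Omega>\<close>,
  where it is excluded.\<close>

theorem tree_comparison:
  assumes P: "subharm P" and Q: "subharm Q" and out: "\<And>x. x \<in> M - \<Omega> \<Longrightarrow> maxdist P Q x \<le> \<beta>"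
    and \<beta>: "9 * \<sigma> \<le> \<beta>"
    and reach: "\<And>x. x \<in> M \<Longrightarrow> \<exists>y\<in>M - \<Omega>. (x, y) \<in> {(a, b). a \<in> M \<and> b \<in> M \<and> nb a b}\<^sup>*"
    and x: "x \<in> M"
  shows "maxdist P Q x \<le> \<beta>"
proof (rule ccontr)
  assume c: "\<not> ?thesis"
  have out': "y \<in> \<Omega>" if "y \<in> M" "\<beta> < maxdist P Q y" for y using out that by force
  have step: "\<beta> < maxdist P Q z" if y: "y \<in> M" "\<beta> < maxdist P Q y" and z: "z \<in> M" "nb y z" for y z
  proof -
    have g: "gain P Q y \<le> 0" "gain Q P y \<le> 0"
      using no_large_gain[OF P Q out' \<beta> _ y] by (auto intro: field_le_epsilon)
    obtain a where a: "a \<in> P y" using subharmD(1)[OF P y(1)] by blast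
    have "9 * \<sigma> < maxdist P Q y" using y \<beta> by linarith
    then obtain t where t: "sep P Q t y" "t \<in> T" using sep_exists[OF P Q y(1) _ a] by blast
    note gy = sep_maxdist[OF P Q t(1) y(1) y(1) nb_refl[OF y(1)]]
      sep_maxdist(2)[OF Q P sep_sym[OF t(1)] y(1) y(1) nb_refl[OF y(1)]]
      sep_maxdist(1)[OF P Q t(1) y(1) z]
    have "2 * far P t y \<le> far P t z + far (near P) t y" "2 * far Q t y \<le> far Q t z + far (near Q) t y"
      using subharmD(4)[OF P out'[OF y] t(2) z] subharmD(4)[OF Q out'[OF y] t(2) z] by auto
    then show ?thesis using gy g y by linarith
  qed
  obtain y where y: "y \<in> M - \<Omega>" "(x, y) \<in> {(a, b). a \<in> M \<and> b \<in> M \<and> nb a b}\<^sup>*" using reach[OF x] by blast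
  have "\<beta> < maxdist P Q y"
    using y(2) by (induction rule: rtrancl_induct) (use c step in auto)
  then show False using out[OF y(1)] by linarith
qed

end

section \<open>Length spaces and subharmonic functions\<close>

text \<open>Geodesics need not exist in a length space; their substitute is a path all of whose
  polygonal lengths exceed the distance of its ends by at most \<open>\<iota>\<close>.\<close>

locale len_metric = Metric_space M d for M :: "'a set" and d :: "'a \<Rightarrow> 'a \<Rightarrow> real" +
  assumes almost_geodesic: "a \<in> M \<Longrightarrow> b \<in> M \<Longrightarrow> 0 < \<iota> \<Longrightarrow>
    \<exists>g. pathin mtopology g \<and> g 0 = a \<and> g 1 = b \<and>
      (\<forall>ts. sorted ts \<and> set ts \<subseteq> {0..1} \<longrightarrow> (\<Sum>i<length ts - 1. d (g (ts ! i)) (g (ts ! Suc i))) \<le> d a b + \<iota>)"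
begin

lemma path_in_M: "pathin mtopology g \<Longrightarrow> 0 \<le> t \<Longrightarrow> t \<le> 1 \<Longrightarrow> g t \<in> M"
  unfolding pathin_def continuous_map_def by auto

lemma path_uniform:
  assumes g: "pathin mtopology g" and \<rho>: "0 < \<rho>"
  shows "\<exists>\<delta>>0. \<forall>s\<in>{0..1}. \<forall>t\<in>{0..1}. \<bar>s - t\<bar> < \<delta> \<longrightarrow> d (g s) (g t) < \<rho>"
proof -
  have "continuous_map (mtopology_of (submetric euclidean_metric {0..1})) (mtopology_of Self) g"
    using g unfolding pathin_def by (simp add: mtopology_of_submetric Self_def)
  moreover have "compact_space (mtopology_of (submetric euclidean_metric {0..1::real}))"
    by (simp add: mtopology_of_submetric compact_space_subtopology)
  ultimately have "uniformly_continuous_map (submetric euclidean_metric {0..1}) Self g"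
    using continuous_imp_uniformly_continuous_map by blast
  then obtain \<delta> where "\<delta> > 0" "\<And>s t. s \<in> {0..1} \<Longrightarrow> t \<in> {0..1} \<Longrightarrow> dist t s < \<delta> \<Longrightarrow> d (g t) (g s) < \<rho>"
    unfolding uniformly_continuous_map_def using \<rho> by auto
  then show ?thesis by (intro exI[of _ \<delta>]) (auto simp: dist_real_def)
qed

lemma chain:
  assumes ab: "a \<in> M" "b \<in> M" and \<iota>: "0 < \<iota>" and \<rho>: "0 < \<rho>"
  obtains n z where "z 0 = a" "z n = b" "\<And>i. i \<le> n \<Longrightarrow> z i \<in> M"
    "\<And>i. i < n \<Longrightarrow> d (z i) (z (Suc i)) < \<rho>" "(\<Sum>i<n. d (z i) (z (Suc i))) \<le> d a b + \<iota>"
proof -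
  obtain g where g: "pathin mtopology g" "g 0 = a" "g 1 = b"
    and len: "\<And>ts. sorted ts \<Longrightarrow> set ts \<subseteq> {0..1} \<Longrightarrow>
      (\<Sum>i<length ts - 1. d (g (ts ! i)) (g (ts ! Suc i))) \<le> d a b + \<iota>"
    using almost_geodesic[OF ab \<iota>] by blast
  obtain \<delta> where \<delta>: "0 < \<delta>" "\<And>s t. s \<in> {0..1} \<Longrightarrow> t \<in> {0..1} \<Longrightarrow> \<bar>s - t\<bar> < \<delta> \<Longrightarrow> d (g s) (g t) < \<rho>"
    using path_uniform[OF g(1) \<rho>] by blast
  obtain n0 where n0: "inverse (real (Suc n0)) < \<delta>" using reals_Archimedean \<delta> by blast
  define n where "n = Suc n0"
  define \<tau> where "\<tau> i = real i / real n" for i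
  have n: "0 < n" "1 / real n < \<delta>" using n0 unfolding n_def by (auto simp: field_simps)
  have \<tau>01: "\<tau> i \<in> {0..1}" if "i \<le> n" for i using that n unfolding \<tau>_def by (auto simp: field_simps)
  define ts where "ts = map \<tau> [0..<Suc n]"
  have "sorted ts" unfolding ts_def sorted_map \<tau>_def
    by (rule sorted_wrt_mono_rel[of _ "(\<le>)"]) (auto simp: divide_right_mono simp del: upt_Suc)
  moreover have "set ts \<subseteq> {0..1}" unfolding ts_def using \<tau>01 by (auto simp del: upt_Suc)
  ultimately have "(\<Sum>i<length ts - 1. d (g (ts ! i)) (g (ts ! Suc i))) \<le> d a b + \<iota>" by (rule len)
  moreover have "(\<Sum>i<length ts - 1. d (g (ts ! i)) (g (ts ! Suc i))) = (\<Sum>i<n. d (g (\<tau> i)) (g (\<tau> (Suc i))))"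
    unfolding ts_def by (intro sum.cong) (auto simp del: upt_Suc)
  ultimately have "(\<Sum>i<n. d (g (\<tau> i)) (g (\<tau> (Suc i)))) \<le> d a b + \<iota>" by simp
  moreover have "d (g (\<tau> i)) (g (\<tau> (Suc i))) < \<rho>" if "i < n" for i
  proof -
    have "\<tau> (Suc i) - \<tau> i = 1 / real n" unfolding \<tau>_def by (simp add: diff_divide_distrib[symmetric])
    moreover have "0 < 1 / real n" using n by simp
    ultimately have "\<bar>\<tau> i - \<tau> (Suc i)\<bar> < \<delta>" using n by linarith
    then show ?thesis using that \<tau>01[of i] \<tau>01[of "Suc i"] by (intro \<delta>(2)) auto
  qed
  moreover have "g (\<tau> i) \<in> M" if "i \<le> n" for i using path_in_M[OF g(1)] \<tau>01[OF that] by auto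
  moreover have "g (\<tau> 0) = a" "g (\<tau> n) = b" using g n unfolding \<tau>_def by auto
  ultimately show ?thesis using that[of "\<lambda>i. g (\<tau> i)" n] by blast
qed

text \<open>Take the first exit from \<open>U\<close> of an almost geodesic path; the exit times
  form a closed set. The estimate is the length bound for the partition 0, \<open>\<tau>\<close>,
  1.\<close>

lemma crossing:
  assumes U: "openin mtopology U" and a: "a \<in> U" and b: "b \<in> M - U" and \<iota>: "0 < \<iota>"
  obtains w where "w \<in> M" "w \<notin> U" "\<And>r. 0 < r \<Longrightarrow> \<exists>u\<in>U. d w u < r" "d a w + d w b \<le> d a b + \<iota>"
proof -
  have aM: "a \<in> M" using U a openin_subset by fastforce
  obtain g where g: "pathin mtopology g" "g 0 = a" "g 1 = b"
    and len: "\<And>ts. sorted ts \<Longrightarrow> set ts \<subseteq> {0..1} \<Longrightarrow>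
      (\<Sum>i<length ts - 1. d (g (ts ! i)) (g (ts ! Suc i))) \<le> d a b + \<iota>"
    using almost_geodesic[OF aM _ \<iota>] b by blast
  define S where "S = {t\<in>{0..1}. g t \<in> M - U}"
  have cl: "closedin (subtopology euclideanreal {0..1}) {t\<in>topspace (subtopology euclideanreal {0..1}). g t \<in> M - U}"
    using g(1) U unfolding pathin_def by (intro closedin_continuous_map_preimage[of _ mtopology]) (auto intro: closedin_diff)
  then have "closed S" unfolding S_def by (simp add: closedin_closed_eq)
  moreover have S: "S \<noteq> {}" "bdd_below S" unfolding S_def using g b by (auto intro: bdd_belowI[of _ 0] exI[of _ 1])
  ultimately have \<tau>: "Inf S \<in> S" by (rule closed_contains_Inf[rotated 2])
  define \<tau> where "\<tau> = Inf S"
  have \<tau>01: "0 \<le> \<tau>" "\<tau> \<le> 1" "g \<tau> \<in> M" "g \<tau> \<notin> U" using \<tau> unfolding \<tau>_def S_def by auto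
  have "\<tau> \<noteq> 0" using g a \<tau>01 by auto
  have before: "g t \<in> U" if "0 \<le> t" "t < \<tau>" for t
  proof (rule ccontr)
    assume "g t \<notin> U"
    then have "t \<in> S" unfolding S_def using path_in_M[OF g(1), of t] that \<tau>01 by auto
    then have "\<tau> \<le> t" unfolding \<tau>_def using S by (intro cInf_lower)
    then show False using that by simp
  qed
  show ?thesis
  proof
    show "g \<tau> \<in> M" "g \<tau> \<notin> U" by fact+
    fix r :: real assume "0 < r"
    then obtain \<delta> where \<delta>: "0 < \<delta>" "\<And>s t. s \<in> {0..1} \<Longrightarrow> t \<in> {0..1} \<Longrightarrow> \<bar>s - t\<bar> < \<delta> \<Longrightarrow> d (g s) (g t) < r"
      using path_uniform[OF g(1)] by blast
    define t where "t = max 0 (\<tau> - \<delta> / 2)"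
    have t: "0 \<le> t" "t < \<tau>" "\<bar>\<tau> - t\<bar> < \<delta>" using \<delta> \<tau>01 \<open>\<tau> \<noteq> 0\<close> unfolding t_def by (auto simp: max_def)
    then show "\<exists>u\<in>U. d (g \<tau>) u < r" using before[of t] \<delta>(2)[of \<tau> t] \<tau>01 by (intro bexI[of _ "g t"]) auto
  next
    have "(\<Sum>i<length [0, \<tau>, 1] - 1. d (g ([0, \<tau>, 1] ! i)) (g ([0, \<tau>, 1] ! Suc i))) \<le> d a b + \<iota>"
      using \<tau>01 by (intro len) auto
    then show "d a (g \<tau>) + d (g \<tau>) b \<le> d a b + \<iota>" using g by (simp add: numeral_2_eq_2)
  qed
qed

text \<open>A substitute for points on a geodesic: the strict inequality leaves room to exit a ball
  of radius \<open>\<rho>\<close> about \<open>a\<close>, slightly below \<open>r1\<close>, along an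
  almost geodesic path.\<close>

lemma between:
  assumes "a \<in> M" "b \<in> M" "0 < r1" "0 < r2" "d a b < r1 + r2"
  obtains m where "m \<in> M" "d a m < r1" "d m b < r2"
proof (cases "d a b < r1")
  case True
  then show ?thesis using that[of b] assms by simp
next
  case False
  define \<rho> where "\<rho> = (max 0 (d a b - r2) + r1) / 2"
  have \<rho>: "0 < \<rho>" "\<rho> < r1" "d a b - r2 < \<rho>" unfolding \<rho>_def using assms by (auto simp: max_def field_simps)
  have "b \<in> M - mball a \<rho>" using False \<rho> assms by auto
  moreover have "a \<in> mball a \<rho>" using \<rho> assms by simp
  moreover have "0 < (\<rho> - (d a b - r2)) / 2" using \<rho> by simp
  ultimately obtain w where w: "w \<in> M" "w \<notin> mball a \<rho>" "\<And>r. 0 < r \<Longrightarrow> \<exists>u\<in>mball a \<rho>. d w u < r"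
      "d a w + d w b \<le> d a b + (\<rho> - (d a b - r2)) / 2"
    using crossing[OF openin_mball] by metis
  obtain u where u: "u \<in> mball a \<rho>" "d w u < r1 - \<rho>" using w(3)[of "r1 - \<rho>"] \<rho> by auto
  have "d a w < r1" using triangle'[of a u w] u w assms by auto
  moreover have "d w b < r2"
  proof -
    have "\<rho> \<le> d a w" using w assms by auto
    then show ?thesis using w(4) \<rho> by (simp add: field_simps)
  qed
  ultimately show ?thesis using that w by blast
qed

section \<open>Suprema over balls and the climbing argument\<close>

definition spr :: "('a \<Rightarrow> real) \<Rightarrow> 'a \<Rightarrow> real \<Rightarrow> real" where
  "spr u x R = (SUP y\<in>mball x R. u y)"

text \<open>Midpoint convexity of the supremum of \<open>u\<close> over balls about
  \<open>x\<close>, at the radii 0, \<open>R\<close> and \<open>2 * R\<close>. Asking for the ball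
  of radius \<open>3 * R\<close> leaves room for approximation at small scales.\<close>

definition subh :: "'a set \<Rightarrow> ('a \<Rightarrow> real) \<Rightarrow> bool" where
  "subh U u \<longleftrightarrow> (\<forall>x\<in>M. \<forall>R>0. mball x (3 * R) \<subseteq> U \<longrightarrow> (\<forall>y\<in>mball x R. 2 * u y \<le> u x + spr u x (2 * R)))"

lemma subh_mono: "subh U u \<Longrightarrow> V \<subseteq> U \<Longrightarrow> subh V u"
  unfolding subh_def by blast

lemma spr_upper:
  assumes "\<And>x. x \<in> M \<Longrightarrow> u x \<le> C" "x \<in> M" "y \<in> M" "d x y < R" shows "u y \<le> spr u x R"
  unfolding spr_def using assms by (intro cSUP_upper) (auto intro!: bdd_aboveI2[of _ _ C])

lemma spr_least: "x \<in> M \<Longrightarrow> 0 < R \<Longrightarrow> (\<And>y. y \<in> M \<Longrightarrow> d x y < R \<Longrightarrow> u y \<le> r) \<Longrightarrow> spr u x R \<le> r"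
  unfolding spr_def by (intro cSUP_least) (auto simp: mball_eq_empty)

lemma spr_approx:
  assumes "x \<in> M" "0 < R" "r < spr u x R" shows "\<exists>y\<in>M. d x y < R \<and> r < u y"
  using spr_least[of x R u r] assms by force

text \<open>The climbing argument: descending from \<open>x\<close> at a rate above \<open>s\<close> forces \<open>u\<close> to ascend by at
  least as much in each of arbitrarily many consecutive steps. Since the cone \<open>c\<close> grows no faster,
  the walk stays where \<open>u > c\<close>, hence inside \<open>U\<close>, and \<open>u\<close> is unbounded.\<close>

lemma no_descent:
  assumes C: "\<And>x. x \<in> M \<Longrightarrow> u x \<le> C" and sub: "subh U u" and U: "U \<subseteq> M"
    and c: "\<And>x y. x \<in> M \<Longrightarrow> y \<in> M \<Longrightarrow> c x - c y \<le> s * d x y" and s: "0 \<le> s" and L: "0 \<le> L"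
    and margin: "\<And>x z. x \<in> U \<Longrightarrow> 0 < u x \<Longrightarrow> z \<in> M - U \<Longrightarrow> u x - c x \<le> L * d x z"
    and x: "x \<in> U" "0 < u x" and y: "y \<in> M" and desc: "u y < u x - s * d x y"
    and small: "(4 * L + 2 * s) * d x y < u x - c x"
  shows False
proof -
  have xM: "x \<in> M" using x U by blast
  \<comment> \<open>Strictness permits a radius slightly above \<open>d x y\<close>, so that
    \<open>x\<close> lies in the open ball about \<open>y\<close>.\<close>
  have "\<exists>R>d x y. s * R < u x - u y \<and> (4 * L + 2 * s) * R < u x - c x"
  proof -
    define A where "A = s + 1"
    define B where "B = 4 * L + 2 * s + 1"
    have AB: "0 < A" "0 < B" "s \<le> A" "4 * L + 2 * s \<le> B" unfolding A_def B_def using s L by auto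
    define t where "t = min ((u x - u y - s * d x y) / (2 * A)) ((u x - c x - (4 * L + 2 * s) * d x y) / (2 * B))"
    have t: "0 < t" unfolding t_def using desc small AB by simp
    have "s * t \<le> A * t" "(4 * L + 2 * s) * t \<le> B * t" using AB t by auto
    moreover have "2 * (A * t) \<le> u x - u y - s * d x y" "2 * (B * t) \<le> u x - c x - (4 * L + 2 * s) * d x y"
    proof -
      have "t \<le> (u x - u y - s * d x y) / (2 * A)" "t \<le> (u x - c x - (4 * L + 2 * s) * d x y) / (2 * B)"
        unfolding t_def by auto
      then show "2 * (A * t) \<le> u x - u y - s * d x y" "2 * (B * t) \<le> u x - c x - (4 * L + 2 * s) * d x y"
        using AB by (auto simp: field_simps)
    qed
    moreover have "s * (d x y + t) = s * d x y + s * t"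
      "(4 * L + 2 * s) * (d x y + t) = (4 * L + 2 * s) * d x y + (4 * L + 2 * s) * t"
      by (auto simp: algebra_simps)
    moreover have "0 < A * t" "0 < B * t" using AB t by auto
    ultimately have "s * (d x y + t) < u x - u y" "(4 * L + 2 * s) * (d x y + t) < u x - c x"
      using desc small by linarith+
    then show ?thesis using t(1) by (intro exI[of _ "d x y + t"]) simp
  qed
  then obtain R where R: "d x y < R" "s * R < u x - u y" "(4 * L + 2 * s) * R < u x - c x" by blast
  have R0: "0 < R" using R(1) nonneg[of x y] by linarith
  define \<gamma> where "\<gamma> = u x - u y"
  define E where "E = u x - c x - s * R"
  have sR: "0 \<le> s * R" using s R0 by simp
  have \<gamma>: "0 < \<gamma>" "s * R < \<gamma>" using R sR unfolding \<gamma>_def by auto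
  define \<eta>0 where "\<eta>0 = min (u x / 4) ((u x - c x - (4 * L + 2 * s) * R) / 4)"
  have \<eta>0: "0 < \<eta>0" "4 * \<eta>0 \<le> u x" "4 * \<eta>0 \<le> E - s * R - 4 * (L * R)"
    using x R unfolding \<eta>0_def E_def by (auto simp: min_def field_simps)
  have up: "\<lbrakk>a \<in> M; b \<in> M; d a b < R\<rbrakk> \<Longrightarrow> u b \<le> spr u a R" for a b R
    using spr_upper[of u C] C by blast
  \<comment> \<open>The walk is followed through suprema over balls of radius \<open>R\<close>.
    Passing from \<open>\<eta> / 4\<close> to \<open>\<eta>\<close> in each step absorbs the
    approximation errors.\<close>
  have claim: "\<exists>z\<in>M. mball z R \<subseteq> U \<and> \<gamma> - \<eta> \<le> spr u z R - u z \<and> u x + real k * \<gamma> - \<eta> \<le> spr u z R \<and>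
      E - \<eta> \<le> spr u z R - c z" if "0 < \<eta>" "\<eta> \<le> \<eta>0" for k \<eta>
    using that
  proof (induction k arbitrary: \<eta>)
    case 0
    have "w \<in> U" if w: "w \<in> mball y R" for w
    proof (rule ccontr)
      assume "w \<notin> U"
      then have "u x - c x \<le> L * d x w" using margin x w by auto
      moreover have "d x w \<le> 2 * R" using triangle[of x y w] xM y w R by auto
      then have "L * d x w \<le> L * (2 * R)" using L by (rule mult_left_mono)
      ultimately show False using R(3) mult_nonneg_nonneg[OF L less_imp_le[OF R0]] sR by (simp add: algebra_simps)
    qed
    moreover have "u x \<le> spr u y R" using up[OF y xM] R by (simp add: commute)
    moreover have "c y - c x \<le> s * R"
      using c[OF y xM] mult_left_mono[OF less_imp_le[OF R(1)] s] by (simp add: commute)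
    ultimately show ?case using 0 y unfolding \<gamma>_def E_def by (intro bexI[of _ y]) auto
  next
    case (Suc k)
    have "0 < \<eta> / 4" "\<eta> / 4 \<le> \<eta>0" using Suc.prems by auto
    then obtain z where z: "z \<in> M" "mball z R \<subseteq> U" "\<gamma> - \<eta> / 4 \<le> spr u z R - u z"
      "u x + real k * \<gamma> - \<eta> / 4 \<le> spr u z R" "E - \<eta> / 4 \<le> spr u z R - c z"
      using Suc.IH[of "\<eta> / 4"] by blast
    have k\<gamma>: "0 \<le> real k * \<gamma>" using \<gamma> by simp
    \<comment> \<open>The constant \<open>4 * L + 2 * s\<close> comes from here: \<open>z'\<close>
      is within \<open>4 * R\<close> of a point outside \<open>U\<close>, one \<open>s * R\<close>
      is already deducted in \<open>E\<close>, and the other is the change of the cone from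
      \<open>z\<close> to \<open>z'\<close>.\<close>
    have ball3: "mball z (3 * R) \<subseteq> U"
    proof (rule ccontr)
      assume "\<not> ?thesis"
      then obtain w where w: "w \<in> M" "d z w < 3 * R" "w \<notin> U" using in_mball by blast
      have "spr u z R - \<eta> / 4 < spr u z R" using Suc.prems by simp
      then obtain z' where z': "z' \<in> M" "d z z' < R" "spr u z R - \<eta> / 4 < u z'"
        using spr_approx[OF z(1) R0] by blast
      have "z' \<in> U" using z z' by auto
      moreover have "0 < u z'" using z'(3) z(4) k\<gamma> \<eta>0 Suc.prems by linarith
      ultimately have "u z' - c z' \<le> L * d z' w" using margin w by auto
      moreover have "d z' w \<le> 4 * R" using triangle''[of z' z w] z z' w by auto
      then have "L * d z' w \<le> L * (4 * R)" using L by (rule mult_left_mono)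
      moreover have "c z' - c z \<le> s * R"
        using c[OF z'(1) z(1)] mult_left_mono[OF less_imp_le[OF z'(2)] s] by (simp add: commute)
      ultimately show False using z'(3) z(5) \<eta>0 Suc.prems by (simp add: algebra_simps)
    qed
    have "spr u z R \<le> (u z + spr u z (2 * R)) / 2"
      using sub z(1) R0 ball3 unfolding subh_def by (intro spr_least) (auto simp: field_simps)
    then have conv: "2 * spr u z R \<le> u z + spr u z (2 * R)" by simp
    have "spr u z (2 * R) - \<eta> / 4 < spr u z (2 * R)" "0 < 2 * R" using Suc.prems R0 by auto
    then obtain z2 where z2: "z2 \<in> M" "d z z2 < 2 * R" "spr u z (2 * R) - \<eta> / 4 < u z2"
      using spr_approx[OF z(1)] by blast
    \<comment> \<open>About half way to \<open>z2\<close>, convexity lets the supremum over the new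
      ball exceed the old one by almost \<open>spr u z R - u z\<close>, so the rise is
      inherited.\<close>
    obtain z1 where z1: "z1 \<in> M" "d z z1 < R" "d z1 z2 < R" using between[OF z(1) z2(1) R0 R0] z2 by auto
    have "u z2 \<le> spr u z1 R" using up z1 z2 by blast
    moreover have "u z1 \<le> spr u z R" using up z z1 by blast
    moreover have "c z1 - c z \<le> s * R"
      using c[OF z1(1) z(1)] mult_left_mono[OF less_imp_le[OF z1(2)] s] by (simp add: commute)
    moreover have "mball z1 R \<subseteq> U"
    proof
      fix w assume w: "w \<in> mball z1 R"
      then have "d z w < 3 * R" using triangle[of z z1 w] z z1 R0 by auto
      then show "w \<in> U" using ball3 z w by auto
    qed
    ultimately show ?case using conv z z2(3) z1 Suc.prems \<gamma>
      by (intro bexI[of _ z1]) (auto simp: algebra_simps)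
  qed
  obtain k where k: "C - u x + \<eta>0 < real k * \<gamma>" using ex_less_of_nat_mult[OF \<gamma>(1)] by blast
  obtain z where z: "z \<in> M" "u x + real k * \<gamma> - \<eta>0 \<le> spr u z R" using claim[of \<eta>0 k] \<eta>0 by blast
  have "spr u z R \<le> C" using z R0 C by (intro spr_least)
  then show False using z k by linarith
qed

end

text \<open>Compare \<open>v\<close> with the line of slope \<open>- s\<close> through its initial
  value: the step that first takes \<open>v\<close> below the line is steeper than
  \<open>s\<close>.\<close>

lemma chain_drop:
  fixes v l :: "nat \<Rightarrow> real"
  assumes "v n < v 0 - s * (\<Sum>i<n. l i)"
  shows "\<exists>i<n. v 0 - s * (\<Sum>j<i. l j) \<le> v i \<and> v (Suc i) < v i - s * l i"
  using assms
proof (induction n)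
  case 0
  then show ?case by simp
next
  case (Suc n)
  show ?case
  proof (cases "v n < v 0 - s * (\<Sum>i<n. l i)")
    case True
    then show ?thesis using Suc.IH less_SucI by blast
  next
    case False
    then show ?thesis using Suc.prems by (intro exI[of _ n]) (auto simp: algebra_simps)
  qed
qed

lemma (in Metric_space) chain_dist:
  assumes "\<And>i. i \<le> n \<Longrightarrow> z i \<in> M" "i \<le> j" "j \<le> n"
  shows "d (z i) (z j) \<le> (\<Sum>k\<in>{i..<j}. d (z k) (z (Suc k)))"
  using assms(2,3)
proof (induction j rule: dec_induct)
  case base
  then show ?case using assms(1) by simp
next
  case (step j)
  have "d (z i) (z (Suc j)) \<le> d (z i) (z j) + d (z j) (z (Suc j))"
    using step assms(1) by (intro triangle) auto
  then show ?case using step by simp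
qed

lemma (in Metric_space) chain_ends:
  assumes "\<And>i. i \<le> n \<Longrightarrow> z i \<in> M" "i \<le> n"
  shows "d (z 0) (z i) \<le> (\<Sum>k<i. d (z k) (z (Suc k)))"
    and "(\<Sum>k<i. d (z k) (z (Suc k))) + d (z i) (z n) \<le> (\<Sum>k<n. d (z k) (z (Suc k)))"
proof -
  show "d (z 0) (z i) \<le> (\<Sum>k<i. d (z k) (z (Suc k)))"
    using chain_dist[of n z 0 i, OF assms(1)] assms(2) by (simp add: atLeast0LessThan)
  have "(\<Sum>k<n. d (z k) (z (Suc k))) = (\<Sum>k<i. d (z k) (z (Suc k))) + (\<Sum>k\<in>{i..<n}. d (z k) (z (Suc k)))"
    using sum.atLeastLessThan_concat[of 0 i n "\<lambda>k. d (z k) (z (Suc k))"] assms(2)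
    by (simp add: atLeast0LessThan)
  then show "(\<Sum>k<i. d (z k) (z (Suc k))) + d (z i) (z n) \<le> (\<Sum>k<n. d (z k) (z (Suc k)))"
    using chain_dist[of n z i n, OF assms(1)] assms(2) by simp
qed

section \<open>Existence of subharmonic extensions\<close>

text \<open>Convexity makes the increments nondecreasing, so the last \<open>k\<close> of them
  outweigh the first \<open>k\<close>.\<close>

lemma convex_seq_double:
  fixes a :: "nat \<Rightarrow> real"
  assumes "\<And>j. 0 < j \<Longrightarrow> j < 2 * k \<Longrightarrow> 2 * a j \<le> a (j - 1) + a (j + 1)"
  shows "2 * a k \<le> a 0 + a (2 * k)"
proof -
  have mono: "a (Suc i) - a i \<le> a (Suc j) - a j" if "i \<le> j" "j < 2 * k" for i j
    using that
  proof (induction j rule: dec_induct)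
    case base
    then show ?case by simp
  next
    case (step j)
    then show ?case using assms[of "Suc j"] by simp
  qed
  have "a k - a 0 = (\<Sum>j<k. a (Suc j) - a j)" by (simp add: sum_lessThan_telescope)
  also have "\<dots> \<le> (\<Sum>j<k. a (Suc (j + k)) - a (j + k))" by (intro sum_mono mono) auto
  also have "\<dots> = a (2 * k) - a k"
    using sum_lessThan_telescope[of "\<lambda>j. a (j + k)" k] by (simp add: mult_2)
  finally show ?thesis by simp
qed

lemma (in rtree) cen_singleton: "t \<in> T \<Longrightarrow> cen {t} = t"
proof -
  assume t: "t \<in> T"
  have "e t (cen {t}) \<le> 0" using t by (intro cen_ball) auto
  then show ?thesis using t cen_in[of "{t}"] tr.nonneg[of t "cen {t}"]
    by (metis antisym empty_subsetI insert_not_empty insert_subset tr.zero)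
qed

context len_metric
begin

lemma reach_boundary:
  assumes x: "x \<in> M" and \<epsilon>: "0 < \<epsilon>" and y: "y \<in> M"
  shows "(x, y) \<in> {(a, b). a \<in> M \<and> b \<in> M \<and> d a b < \<epsilon>}\<^sup>*"
proof -
  obtain n z where z: "z 0 = x" "z n = y" "\<And>i. i \<le> n \<Longrightarrow> z i \<in> M"
    "\<And>i. i < n \<Longrightarrow> d (z i) (z (Suc i)) < \<epsilon>"
    using chain[OF x y zero_less_one \<epsilon>] by metis
  have "(x, z i) \<in> {(a, b). a \<in> M \<and> b \<in> M \<and> d a b < \<epsilon>}\<^sup>*" if "i \<le> n" for i
    using that
  proof (induction i)
    case 0
    then show ?case using z by simp
  next
    case (Suc i)
    then show ?case using z(3)[of i] z(3)[of "Suc i"] z(4)[of i]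
      by (auto intro: rtrancl.rtrancl_into_rtrancl)
  qed
  then show ?thesis using z(2) by blast
qed

end

locale boundary_data = len_metric M d + rtree T e
  for M :: "'a set" and d :: "'a \<Rightarrow> 'a \<Rightarrow> real" and T :: "'b set" and e :: "'b \<Rightarrow> 'b \<Rightarrow> real" +
  fixes Y :: "'a set" and f :: "'a \<Rightarrow> 'b" and L :: real
  assumes YM: "Y \<subseteq> M" and Yne: "Y \<noteq> {}" and fT: "y \<in> Y \<Longrightarrow> f y \<in> T" and L: "0 < L"
    and f_lip: "y \<in> Y \<Longrightarrow> y' \<in> Y \<Longrightarrow> e (f y) (f y') \<le> L * d y y'"
begin

text \<open>The Lipschitz bound is imposed at scale \<open>h\<close> only; in this form it is
  preserved by passing to the centers of images of \<open>h\<close>-balls.\<close>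

definition discrete :: "real \<Rightarrow> ('a \<Rightarrow> 'b) \<Rightarrow> bool" where
  "discrete h F \<longleftrightarrow> (\<forall>x\<in>M. F x \<in> T) \<and> (\<forall>y\<in>Y. F y = f y) \<and>
     (\<forall>x\<in>M. \<forall>y\<in>M. d x y < h \<longrightarrow> e (F x) (F y) \<le> L * h) \<and> (\<forall>x\<in>M - Y. F x = cen (F ` mball x h))"

text \<open>The point is that centers preserve the bound at scale \<open>h\<close>. Between a point
  of \<open>Y\<close> and one outside, the image of an \<open>h\<close>-ball has diameter at most 2
  L h, hence radius at most L h. Between two points outside \<open>Y\<close>, the images of the
  balls have Hausdorff distance at most L h.\<close>

lemma discrete_exists:
  assumes h: "0 < h"
  shows "\<exists>F. discrete h F"
proof -
  define K where "K = {F\<in>extensional M. (\<forall>x\<in>M. F x \<in> T) \<and> (\<forall>y\<in>Y. F y = f y) \<and>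
     (\<forall>x\<in>M. \<forall>y\<in>M. d x y < h \<longrightarrow> e (F x) (F y) \<le> L * h)}"
  define \<Phi> where "\<Phi> F = (\<lambda>x\<in>M. if x \<in> Y then f x else cen (F ` mball x h))" for F
  have KD: "F x \<in> T" "y \<in> Y \<Longrightarrow> F y = f y" "z \<in> M \<Longrightarrow> d x z < h \<Longrightarrow> e (F x) (F z) \<le> L * h"
    if "F \<in> K" "x \<in> M" for F x y z using that unfolding K_def by auto
  have im: "F ` mball x h \<noteq> {}" "F ` mball x h \<subseteq> T" if "F \<in> K" "x \<in> M" for F x
    using that h KD(1) by (auto simp: mball_eq_empty)
  have "\<exists>F\<in>K. \<Phi> F = F"
  proof (rule nonexpansive_fixpoint)
    show "F x \<in> T" if "F \<in> K" "x \<in> M" for F x using that KD by blast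
    show "K \<subseteq> extensional M" unfolding K_def by blast
    obtain g where g: "\<forall>x\<in>M. g x \<in> T" "\<forall>y\<in>Y. g y = f y" "\<forall>x\<in>M. \<forall>y\<in>M. e (g x) (g y) \<le> L * d x y"
      using lipschitz_extension[OF Metric_space_axioms YM Yne, of L f] L fT f_lip by auto
    have "e (g x) (g y) \<le> L * h" if "x \<in> M" "y \<in> M" "d x y < h" for x y
      using that g(3) L by (meson less_imp_le mult_le_cancel_left_pos order_trans)
    then have "restrict g M \<in> K" unfolding K_def using g YM by auto
    then show "K \<noteq> {}" by blast
  next
    fix G assume G: "G \<subseteq> K" "G \<noteq> {}"
    have im': "(\<lambda>F. F x) ` G \<noteq> {}" "(\<lambda>F. F x) ` G \<subseteq> T" if "x \<in> M" for x using that G KD(1) by auto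
    show "(\<lambda>x\<in>M. cen ((\<lambda>F. F x) ` G)) \<in> K"
      unfolding K_def
    proof (intro CollectI conjI ballI impI)
      show "(\<lambda>x\<in>M. cen ((\<lambda>F. F x) ` G)) \<in> extensional M" by simp
      show "(\<lambda>x\<in>M. cen ((\<lambda>F. F x) ` G)) x \<in> T" if "x \<in> M" for x using that cen_in[OF im'[OF that]] by simp
      show "(\<lambda>x\<in>M. cen ((\<lambda>F. F x) ` G)) y = f y" if y: "y \<in> Y" for y
      proof -
        have yM: "y \<in> M" using y YM by blast
        have "(\<lambda>F. F y) ` G = {f y}" using G KD(2)[OF _ yM y] by auto
        then show ?thesis using yM cen_singleton[OF fT[OF y]] by simp
      qed
      show "e ((\<lambda>x\<in>M. cen ((\<lambda>F. F x) ` G)) x) ((\<lambda>x\<in>M. cen ((\<lambda>F. F x) ` G)) y) \<le> L * h"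
        if xy: "x \<in> M" "y \<in> M" "d x y < h" for x y
      proof -
        have *: "e (F x) (F y) \<le> L * h" "e (F y) (F x) \<le> L * h" if "F \<in> G" for F
          using KD(3)[of F x y] KD(3)[of F y x] that xy G by (auto simp: commute)
        have "e (cen ((\<lambda>F. F x) ` G)) (cen ((\<lambda>F. F y) ` G)) \<le> L * h"
          using * by (intro cen_lipschitz im' xy) auto
        then show ?thesis using xy by simp
      qed
    qed
  next
    fix F assume F: "F \<in> extensional M" "\<And>x. x \<in> M \<Longrightarrow> F x \<in> T"
      and app: "\<And>J \<eta>. finite J \<Longrightarrow> J \<subseteq> M \<Longrightarrow> 0 < \<eta> \<Longrightarrow> \<exists>G\<in>K. \<forall>x\<in>J. e (F x) (G x) < \<eta>"
    show "F \<in> K"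
      unfolding K_def
    proof (intro CollectI conjI ballI impI F)
      fix y assume y: "y \<in> Y"
      have yM: "y \<in> M" using y YM by blast
      have "e (F y) (f y) \<le> 0 + \<eta>" if \<eta>: "0 < \<eta>" for \<eta>
        using app[of "{y}" \<eta>] yM \<eta> KD(2)[OF _ yM y] by force
      then have "e (F y) (f y) \<le> 0" by (rule field_le_epsilon)
      then show "F y = f y" using F(2)[OF yM] fT[OF y] by (metis antisym tr.nonneg tr.zero)
    next
      fix x y assume xy: "x \<in> M" "y \<in> M" "d x y < h"
      show "e (F x) (F y) \<le> L * h"
      proof (rule field_le_epsilon)
        fix \<eta> :: real assume "0 < \<eta>"
        then obtain G where G: "G \<in> K" "e (F x) (G x) < \<eta> / 2" "e (F y) (G y) < \<eta> / 2"
          using app[of "{x, y}" "\<eta> / 2"] xy by auto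
        have "e (F x) (F y) \<le> e (F x) (G x) + e (G x) (F y)" "e (G x) (F y) \<le> e (G x) (G y) + e (F y) (G y)"
          using tr.triangle[of "F x" "G x" "F y"] tr.triangle'[of "G x" "G y" "F y"] F(2) KD(1)[OF G(1)] xy by auto
        then show "e (F x) (F y) \<le> L * h + \<eta>" using G KD(3)[OF G(1) xy] by linarith
      qed
    qed
  next
    fix F assume F: "F \<in> K"
    have diam: "e (F z) (F z') \<le> 2 * (L * h)" if x: "x \<in> M" and z: "z \<in> mball x h" "z' \<in> mball x h" for x z z'
    proof -
      have zM: "z \<in> M" "z' \<in> M" using z by auto
      have "d z z' < h + h" using triangle''[of z x z'] z by auto
      then obtain m where m: "m \<in> M" "d z m < h" "d m z' < h" using between[OF zM h h] by blast
      then show ?thesis using KD(3)[OF F zM(1) m(1,2)] KD(3)[OF F m(1) zM(2) m(3)]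
          tr.triangle[of "F z" "F m" "F z'"] KD(1)[OF F] zM by fastforce
    qed
    have rad: "rad (F ` mball x h) \<le> L * h" if x: "x \<in> M" for x
    proof -
      have "e s s' \<le> 2 * (L * h)" if "s \<in> F ` mball x h" "s' \<in> F ` mball x h" for s s'
        using that diam[OF x] by blast
      then show ?thesis using rad_le_half_diam[OF im[OF F x], of "2 * (L * h)"] by simp
    qed
    have mixed: "e (\<Phi> F x) (\<Phi> F y) \<le> L * h" if xy: "x \<in> M - Y" "y \<in> Y" "d x y < h" for x y
    proof -
      have xM: "x \<in> M" and yM: "y \<in> M" using xy YM by auto
      have "e (cen (F ` mball x h)) (F y) \<le> rad (F ` mball x h)"
        using im[OF F xM] xy xM yM by (intro cen_rad) auto
      then show ?thesis unfolding \<Phi>_def using rad[OF xM] xy xM yM KD(2)[OF F yM] by auto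
    qed
    show "\<Phi> F \<in> K"
      unfolding K_def
    proof (intro CollectI conjI ballI impI)
      show "\<Phi> F \<in> extensional M" unfolding \<Phi>_def by simp
      show "\<Phi> F x \<in> T" if "x \<in> M" for x unfolding \<Phi>_def using that fT cen_in[OF im[OF F that]] by simp
      show "\<Phi> F y = f y" if "y \<in> Y" for y unfolding \<Phi>_def using that YM by auto
      fix x y assume xy: "x \<in> M" "y \<in> M" "d x y < h"
      consider "x \<in> Y" "y \<in> Y" | "x \<in> Y" "y \<notin> Y" | "x \<notin> Y" "y \<in> Y" | "x \<notin> Y" "y \<notin> Y" by blast
      then show "e (\<Phi> F x) (\<Phi> F y) \<le> L * h"
      proof cases
        case 1
        then have "\<Phi> F x = F x" "\<Phi> F y = F y" using KD(2)[OF F] xy unfolding \<Phi>_def by auto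
        then show ?thesis using KD(3)[OF F xy] by simp
      next
        case 2
        then show ?thesis using mixed[of y x] xy by (simp add: commute tr.commute)
      next
        case 3
        then show ?thesis using mixed[of x y] xy by simp
      next
        case 4
        have half: "\<exists>s'\<in>F ` mball y h. e s s' \<le> L * h"
          if x: "x \<in> M" "y \<in> M" "d x y < h" and s: "s \<in> F ` mball x h" for x y s
        proof -
          obtain z where z: "z \<in> M" "d x z < h" "s = F z" using s by auto
          have "d z y < h + h" using triangle''[of z x y] x z by auto
          then obtain m where m: "m \<in> M" "d z m < h" "d m y < h" using between[OF z(1) x(2) h h] by blast
          then show ?thesis using KD(3)[OF F z(1) m(1,2)] x z by (intro bexI[of _ "F m"]) (auto simp: commute)
        qed
        have "e (cen (F ` mball x h)) (cen (F ` mball y h)) \<le> L * h"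
          using half[OF xy] half[of y x] xy by (intro cen_lipschitz im F xy) (auto simp: commute)
        then show ?thesis using 4 xy unfolding \<Phi>_def by simp
      qed
    qed
  next
    fix F G r x assume F: "F \<in> K" and G: "G \<in> K" and r: "\<And>x. x \<in> M \<Longrightarrow> e (F x) (G x) \<le> r" and x: "x \<in> M"
    have "e (cen (F ` mball x h)) (cen (G ` mball x h)) \<le> r"
    proof (intro cen_lipschitz im F G x)
      show "\<exists>s'\<in>G ` mball x h. e s s' \<le> r" if "s \<in> F ` mball x h" for s using that r by fastforce
      show "\<exists>s\<in>F ` mball x h. e s' s \<le> r" if s': "s' \<in> G ` mball x h" for s'
      proof -
        obtain z where z: "z \<in> mball x h" "s' = G z" using s' by blast
        then have "e s' (F z) \<le> r" using r[of z] by (simp add: tr.commute)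
        then show ?thesis using z by blast
      qed
    qed
    moreover have "0 \<le> r" using r[OF x] tr.nonneg order_trans by blast
    ultimately show "e (\<Phi> F x) (\<Phi> G x) \<le> r" unfolding \<Phi>_def using x fT by simp
  qed
  then obtain F where F: "F \<in> K" "\<Phi> F = F" by blast
  have "F x = cen (F ` mball x h)" if "x \<in> M - Y" for x
    using that fun_cong[OF F(2), of x] unfolding \<Phi>_def by simp
  then have "discrete h F" using F(1) unfolding discrete_def K_def by blast
  then show ?thesis by blast
qed

section \<open>Mean value inequalities for discrete maps and comparison of two scales\<close>

lemma discreteD:
  assumes "discrete h F"
  shows "x \<in> M \<Longrightarrow> F x \<in> T" "y \<in> Y \<Longrightarrow> F y = f y"
    "x \<in> M \<Longrightarrow> y \<in> M \<Longrightarrow> d x y < h \<Longrightarrow> e (F x) (F y) \<le> L * h"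
    "x \<in> M \<Longrightarrow> x \<notin> Y \<Longrightarrow> F x = cen (F ` mball x h)"
  using assms unfolding discrete_def by blast+

lemma dist_bdd:
  assumes "\<And>x. x \<in> M \<Longrightarrow> F x \<in> T" "t \<in> T"
  obtains C where "\<And>x. x \<in> M \<Longrightarrow> e t (F x) \<le> C"
  using assms bounded by meson

lemma discrete_lip:
  assumes F: "discrete h F" and h: "0 < h" and xy: "x \<in> M" "y \<in> M" "d x y < real k * h"
  shows "e (F x) (F y) \<le> real k * (L * h)"
  using xy
proof (induction k arbitrary: y)
  case 0
  then show ?case using nonneg[of x y] by simp
next
  case (Suc k)
  show ?case
  proof (cases "k = 0")
    case True
    then show ?thesis using Suc.prems discreteD(3)[OF F] by simp
  next
    case False
    then have "0 < real k * h" using h by simp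
    moreover have "d x y < real k * h + h" using Suc.prems by (simp add: algebra_simps)
    ultimately obtain m where m: "m \<in> M" "d x m < real k * h" "d m y < h"
      using between[OF Suc.prems(1,2) _ h] by blast
    have "e (F x) (F y) \<le> e (F x) (F m) + e (F m) (F y)"
      using tr.triangle discreteD(1)[OF F] Suc.prems m by blast
    then show ?thesis using Suc.IH[OF Suc.prems(1) m(1,2)] discreteD(3)[OF F m(1) Suc.prems(2) m(3)]
      by (simp add: algebra_simps)
  qed
qed

text \<open>The farthest distance from \<open>t\<close> to the image of the ball is distance to the
  center plus radius, and that radius also bounds the distance from the center to
  \<open>F y\<close>.\<close>

lemma discrete_sub:
  assumes F: "discrete h F" and h: "0 < h" and x: "x \<in> M" "x \<notin> Y" and t: "t \<in> T" and y: "y \<in> M" "d x y < h"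
  shows "2 * e t (F x) \<le> e t (F y) + spr (\<lambda>z. e t (F z)) x h"
proof -
  have S: "F ` mball x h \<noteq> {}" "F ` mball x h \<subseteq> T" using x h discreteD(1)[OF F] by (auto simp: mball_eq_empty)
  obtain C where C: "\<And>x. x \<in> M \<Longrightarrow> e t (F x) \<le> C" using dist_bdd discreteD(1)[OF F] t by blast
  have "e t (cen (F ` mball x h)) + rad (F ` mball x h) \<le> spr (\<lambda>z. e t (F z)) x h"
    using C x spr_upper[of "\<lambda>z. e t (F z)" C] by (intro cen_least S t) auto
  moreover have "e (cen (F ` mball x h)) (F y) \<le> rad (F ` mball x h)" using x y by (intro cen_rad S) auto
  moreover have "e t (F x) \<le> e t (F y) + e (F x) (F y)" using tr.triangle' t discreteD(1)[OF F] x y by blast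
  moreover have "F x = cen (F ` mball x h)" using discreteD(4)[OF F x] .
  ultimately show ?thesis by simp
qed

text \<open>By \<open>discrete_sub\<close> the suprema over the balls of radius j h form a convex
  sequence. The inequality is used only at points closer to \<open>x\<close> than (2 k - 1) h, which
  explains \<open>away\<close>.\<close>

lemma discrete_double:
  assumes F: "discrete h F" and h: "0 < h" and x: "x \<in> M" and t: "t \<in> T" and k: "0 < k"
    and away: "\<And>y. y \<in> Y \<Longrightarrow> (2 * real k - 1) * h \<le> d x y"
  shows "2 * spr (\<lambda>z. e t (F z)) x (real k * h) \<le> e t (F x) + spr (\<lambda>z. e t (F z)) x (2 * real k * h)"
proof -
  let ?u = "\<lambda>z. e t (F z)"
  \<comment> \<open>The open ball of radius 0 is empty, hence the separate value at index 0.\<close>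
  define a where "a j = (if j = 0 then ?u x else spr ?u x (real j * h))" for j
  obtain C where C: "\<And>x. x \<in> M \<Longrightarrow> ?u x \<le> C" using dist_bdd discreteD(1)[OF F] t by blast
  have "2 * a k \<le> a 0 + a (2 * k)"
  proof (rule convex_seq_double)
    fix j assume j: "0 < j" "j < 2 * k"
    have jh: "0 < real j * h" using j h by simp
    have "spr ?u x (real j * h) \<le> (a (j - 1) + a (j + 1)) / 2"
    proof (rule spr_least[OF x jh])
      fix y assume y: "y \<in> M" "d x y < real j * h"
      have "real j \<le> 2 * real k - 1" using j by linarith
      then have "real j * h \<le> (2 * real k - 1) * h" using h by (intro mult_right_mono) auto
      then have yY: "y \<notin> Y" using away[of y] y by auto
      obtain y' where y': "y' \<in> M" "d y y' < h" "?u y' \<le> a (j - 1)"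
      proof (cases "j = 1")
        case True
        then show ?thesis using that[of x] x y unfolding a_def by (simp add: commute)
      next
        case False
        define j' where "j' = j - 1"
        have j': "0 < j'" "real j = real j' + 1" using False j unfolding j'_def by auto
        then have "0 < real j' * h" "d x y < real j' * h + h" using h y by (auto simp: algebra_simps)
        then obtain m where m: "m \<in> M" "d x m < real j' * h" "d m y < h" using between[OF x y(1) _ h] by blast
        have "?u m \<le> a j'" unfolding a_def using j' spr_upper[of ?u C, OF C x m(1,2)] by simp
        then show ?thesis using that[of m] m unfolding j'_def by (simp add: commute)
      qed
      have "spr ?u y h \<le> a (j + 1)"
      proof (rule spr_least[OF y(1) h])
        fix z assume z: "z \<in> M" "d y z < h"
        have "d x z < real (j + 1) * h" using triangle[of x y z] x y z by (simp add: algebra_simps)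
        then show "?u z \<le> a (j + 1)" unfolding a_def using spr_upper[of ?u C, OF C x z(1)] by simp
      qed
      then show "?u y \<le> (a (j - 1) + a (j + 1)) / 2"
        using discrete_sub[OF F h y(1) yY t y'(1,2)] y'(3) by simp
    qed
    then show "2 * a j \<le> a (j - 1) + a (j + 1)" using j unfolding a_def by simp
  qed
  then show ?thesis using k unfolding a_def by (simp add: mult.assoc)
qed

text \<open>At scale \<open>2 * h\<close> the map \<open>F\<close> satisfies the mean value
  inequality directly, but \<open>G\<close> only through its suprema over balls of radius
  \<open>2 * h\<close>, by \<open>discrete_double\<close> with k = 2. Hence \<open>P\<close> is
  single-valued and \<open>Q\<close> is not. Two such balls at neighbours span less than
  \<open>6 * h\<close>, so \<open>\<sigma>\<close> is 6 L h and the threshold 9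
  \<open>\<sigma>\<close> is 54 L h.\<close>

lemma discrete_close:
  assumes F: "discrete (2 * h) F" and G: "discrete h G" and h: "0 < h" and x: "x \<in> M"
  shows "e (F x) (G x) \<le> 54 * (L * h)"
proof -
  define nb where "nb a b \<longleftrightarrow> d a b < 2 * h" for a b
  \<comment> \<open>The distance \<open>4 * h\<close> from \<open>Y\<close> covers the
    \<open>3 * h\<close> that \<open>discrete_double\<close> needs for k = 2.\<close>
  define \<Omega> where "\<Omega> = {x\<in>M. \<forall>y\<in>Y. 4 * h \<le> d x y}"
  define P where "P a = {F a}" for a
  define Q where "Q a = G ` mball a (2 * h)" for a
  have Lh: "0 < L * h" using L h by simp
  interpret tc: tree_comparison T e M nb \<Omega> "6 * (L * h)"
    using h Lh unfolding nb_def \<Omega>_def by unfold_locales (auto simp: commute)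
  note FT = discreteD(1)[OF F] and GT = discreteD(1)[OF G]
  have nearP: "tc.near P a = F ` mball a (2 * h)" if "a \<in> M" for a
    using that unfolding tc.near_def P_def nb_def by auto
  have nearQ: "tc.near Q a = G ` mball a (4 * h)" if a: "a \<in> M" for a
  proof
    show "tc.near Q a \<subseteq> G ` mball a (4 * h)"
    proof
      fix b assume "b \<in> tc.near Q a"
      then obtain z w where z: "z \<in> M" "d a z < 2 * h" "w \<in> M" "d z w < 2 * h" "b = G w"
        unfolding tc.near_def Q_def nb_def by auto
      then have "d a w < 4 * h" using triangle[of a z w] a by auto
      then show "b \<in> G ` mball a (4 * h)" using z a by auto
    qed
    show "G ` mball a (4 * h) \<subseteq> tc.near Q a"
    proof
      fix b assume "b \<in> G ` mball a (4 * h)"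
      then obtain w where w: "w \<in> M" "d a w < 4 * h" "b = G w" by auto
      obtain m where m: "m \<in> M" "d a m < 2 * h" "d m w < 2 * h"
        using between[OF a w(1), of "2 * h" "2 * h"] w h by auto
      then show "b \<in> tc.near Q a" unfolding tc.near_def Q_def nb_def using w by auto
    qed
  qed
  have farG: "(SUP b\<in>G ` mball a r. e t b) = spr (\<lambda>z. e t (G z)) a r" for t a r
    unfolding spr_def by (simp add: image_image)
  have farF: "(SUP b\<in>F ` mball a r. e t b) = spr (\<lambda>z. e t (F z)) a r" for t a r
    unfolding spr_def by (simp add: image_image)
  have P: "tc.subharm P"
    unfolding tc.subharm_def
  proof (intro conjI ballI impI)
    show "P a \<noteq> {}" "P a \<subseteq> T" if "a \<in> M" for a using that FT unfolding P_def by auto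
    show "e p q \<le> 6 * (L * h)" if "a \<in> M" "b \<in> M" "nb a b" "p \<in> P a" "q \<in> P b" for a b p q
      using discreteD(3)[OF F that(1,2)] that Lh unfolding P_def nb_def by auto
    fix a t b assume a: "a \<in> \<Omega>" "t \<in> T" "b \<in> M" "nb a b"
    have aM: "a \<in> M" "a \<notin> Y" using a h unfolding \<Omega>_def by fastforce+
    have "2 * e t (F a) \<le> e t (F b) + spr (\<lambda>z. e t (F z)) a (2 * h)"
      using discrete_sub[OF F _ aM a(2,3)] h a(4) unfolding nb_def by simp
    then show "2 * far P t a \<le> far P t b + far (tc.near P) t a"
      unfolding far_def nearP[OF aM(1)] farF unfolding P_def by simp
  qed
  have Q: "tc.subharm Q"
    unfolding tc.subharm_def
  proof (intro conjI ballI impI)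
    show "Q a \<noteq> {}" "Q a \<subseteq> T" if "a \<in> M" for a
      using that GT h unfolding Q_def by (auto simp: mball_eq_empty)
    show "e p q \<le> 6 * (L * h)" if ab: "a \<in> M" "b \<in> M" "nb a b" "p \<in> Q a" "q \<in> Q b" for a b p q
    proof -
      obtain z w where z: "z \<in> M" "d a z < 2 * h" "p = G z" "w \<in> M" "d b w < 2 * h" "q = G w"
        using ab unfolding Q_def by auto
      have "d z w < real 6 * h"
        using triangle''[of z a w] triangle[of a b w] ab z unfolding nb_def by simp
      then show ?thesis using discrete_lip[OF G h z(1,4), of 6] z by simp
    qed
    fix a t b assume a: "a \<in> \<Omega>" "t \<in> T" "b \<in> M" "nb a b"
    have aM: "a \<in> M" using a unfolding \<Omega>_def by auto
    obtain C where C: "\<And>x. x \<in> M \<Longrightarrow> e t (G x) \<le> C" using dist_bdd GT a by blast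
    have "(2 * real 2 - 1) * h \<le> d a y" if "y \<in> Y" for y using a that h unfolding \<Omega>_def by fastforce
    then have "2 * spr (\<lambda>z. e t (G z)) a (2 * h) \<le> e t (G a) + spr (\<lambda>z. e t (G z)) a (4 * h)"
      using discrete_double[OF G h aM a(2), of 2] by (simp add: mult.assoc)
    moreover have "e t (G a) \<le> spr (\<lambda>z. e t (G z)) b (2 * h)"
      using spr_upper[of "\<lambda>z. e t (G z)" C, OF C a(3) aM] a(4) unfolding nb_def by (simp add: commute)
    ultimately show "2 * far Q t a \<le> far Q t b + far (tc.near Q) t a"
      unfolding far_def nearQ[OF aM] Q_def farG by simp
  qed
  have out: "maxdist P Q a \<le> 54 * (L * h)" if a: "a \<in> M - \<Omega>" for a
  proof (rule maxdist_least)
    show "P a \<noteq> {}" "Q a \<noteq> {}" using a h unfolding P_def Q_def by (auto simp: mball_eq_empty)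
    fix p q assume pq: "p \<in> P a" "q \<in> Q a"
    obtain y where y: "y \<in> Y" "d a y < 4 * h" using a unfolding \<Omega>_def by auto
    have yM: "y \<in> M" using y YM by blast
    obtain z where z: "z \<in> M" "d a z < 2 * h" "q = G z" using pq unfolding Q_def by auto
    have "e (F a) (F y) \<le> real 2 * (L * (2 * h))"
      using discrete_lip[OF F _ _ yM, of a 2] a y h by auto
    moreover have "e (G z) (G y) \<le> real 6 * (L * h)"
      using discrete_lip[OF G h z(1) yM, of 6] triangle''[of z a y] z y yM a by auto
    moreover have "F y = G y" using discreteD(2)[OF F y(1)] discreteD(2)[OF G y(1)] by simp
    moreover have "e (F a) (G z) \<le> e (F a) (F y) + e (G z) (F y)"
      using tr.triangle'[of "F a" "F y" "G z"] FT GT a yM z by (auto simp: tr.commute)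
    ultimately show "e p q \<le> 54 * (L * h)" using pq z Lh unfolding P_def by auto
  qed
  have "maxdist P Q x \<le> 54 * (L * h)"
  proof (rule tc.tree_comparison[OF P Q out _ _ x])
    show "9 * (6 * (L * h)) \<le> 54 * (L * h)" by simp
    fix a assume a: "a \<in> M"
    obtain y where y: "y \<in> Y" using Yne by blast
    have yM: "y \<in> M" using y YM by blast
    have "y \<notin> \<Omega>" using y yM h unfolding \<Omega>_def by force
    then show "\<exists>y\<in>M - \<Omega>. (a, y) \<in> {(a, b). a \<in> M \<and> b \<in> M \<and> nb a b}\<^sup>*"
      using reach_boundary[OF a _ yM, of "2 * h"] h yM unfolding nb_def by auto
  qed
  moreover have "e (F x) (G x) \<le> maxdist P Q x"
    using x h FT GT by (intro maxdist_upper) (auto simp: P_def Q_def)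
  ultimately show ?thesis by linarith
qed

theorem subharmonic_extension:
  "\<exists>F. (\<forall>x\<in>M. F x \<in> T) \<and> (\<forall>y\<in>Y. F y = f y) \<and> (\<forall>x\<in>M. \<forall>y\<in>M. e (F x) (F y) \<le> L * d x y) \<and>
     (\<forall>t\<in>T. subh (M - Y) (\<lambda>x. e t (F x)))"
proof -
  define h :: "nat \<Rightarrow> real" where "h n = (1/2) ^ n" for n
  have h: "0 < h n" "h n = 2 * h (Suc n)" for n unfolding h_def by auto
  have h0: "h \<longlonglongrightarrow> 0" unfolding h_def by (rule LIMSEQ_power_zero) simp
  obtain G where G: "\<And>n. discrete (h n) (G n)" using discrete_exists[OF h(1)] by metis
  note GT = discreteD(1)[OF G]
  have step: "e (G n x) (G (Suc n) x) \<le> 54 * L * h (Suc n)" if "x \<in> M" for n x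
    using discrete_close[OF _ G[of "Suc n"] h(1) that, of "G n"] G[of n] h(2)[of n] by simp
  \<comment> \<open>As \<open>h n - h (Suc n) = h (Suc n)\<close>, the bounds for consecutive scales
    telescope.\<close>
  have far: "e (G n x) (G m x) \<le> 54 * L * (h n - h m)" if x: "x \<in> M" and "n \<le> m" for n m x
    using \<open>n \<le> m\<close>
  proof (induction m rule: dec_induct)
    case base
    then show ?case using GT[OF x] by simp
  next
    case (step m)
    have "e (G n x) (G (Suc m) x) \<le> e (G n x) (G m x) + e (G m x) (G (Suc m) x)"
      using GT[OF x] by (intro tr.triangle)
    also have "\<dots> \<le> 54 * L * (h n - h m) + 54 * L * h (Suc m)"
      using step.IH \<open>\<And>x n. x \<in> M \<Longrightarrow> e (G n x) (G (Suc n) x) \<le> 54 * L * h (Suc n)\<close>[OF x, of m] by linarith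
    also have "\<dots> = 54 * L * (h n - h (Suc m))" using h(2)[of m] by (simp add: algebra_simps)
    finally show ?case .
  qed
  have far': "e (G n x) (G m x) \<le> 54 * L * h n" if x: "x \<in> M" and "n \<le> m" for n m x
  proof -
    have "54 * L * (h n - h m) \<le> 54 * L * h n" using L h(1)[of m] by (intro mult_left_mono) auto
    then show ?thesis using far[OF that] by linarith
  qed
  have small: "\<exists>n. K * h n < \<eta>" if "0 < \<eta>" for K \<eta>
  proof -
    have "(\<lambda>n. K * h n) \<longlonglongrightarrow> K * 0" by (intro tendsto_intros h0)
    then have "\<forall>\<^sub>F n in sequentially. K * h n < \<eta>" using that by (intro order_tendstoD) auto
    then show ?thesis using eventually_happens trivial_limit_sequentially by blast
  qed
  have "\<exists>l\<in>T. \<forall>n. e (G n x) l \<le> 54 * L * h n" if x: "x \<in> M" for x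
  proof -
    have "tr.MCauchy (\<lambda>n. G n x)"
      unfolding tr.MCauchy_def
    proof (intro conjI allI impI)
      show "range (\<lambda>n. G n x) \<subseteq> T" using GT[OF x] by auto
      fix \<eta> :: real assume "0 < \<eta>"
      then obtain N where N: "(54 * L) * h N < \<eta> / 2" using small[of "\<eta> / 2" "54 * L"] by auto
      have "e (G n x) (G m x) < \<eta>" if "N \<le> n" "N \<le> m" for n m
        using far'[OF x that(1)] far'[OF x that(2)] N tr.triangle''[of "G n x" "G N x" "G m x"] GT[OF x] by fastforce
      then show "\<exists>N. \<forall>n n'. N \<le> n \<longrightarrow> N \<le> n' \<longrightarrow> e (G n x) (G n' x) < \<eta>" by blast
    qed
    then obtain l where "limitin tr.mtopology (\<lambda>n. G n x) l sequentially"
      using complete tr.mcomplete_def by blast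
    then have l: "l \<in> T" "(\<lambda>n. e (G n x) l) \<longlonglongrightarrow> 0" by (auto simp: tr.limitin_metric_dist_null)
    have "e (G n x) l \<le> 54 * L * h n" for n
    proof (rule LIMSEQ_le_const)
      have "(\<lambda>m. 54 * L * h n + e (G m x) l) \<longlonglongrightarrow> 54 * L * h n + 0" by (intro tendsto_intros l)
      then show "(\<lambda>m. 54 * L * h n + e (G m x) l) \<longlonglongrightarrow> 54 * L * h n" by simp
      have "e (G n x) l \<le> 54 * L * h n + e (G m x) l" if "n \<le> m" for m
        using far'[OF x that] tr.triangle[of "G n x" "G m x" l] GT[OF x] l by fastforce
      then show "\<exists>N. \<forall>m\<ge>N. e (G n x) l \<le> 54 * L * h n + e (G m x) l" by blast
    qed
    then show ?thesis using l by blast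
  qed
  then obtain F where FT: "\<And>x. x \<in> M \<Longrightarrow> F x \<in> T"
    and FG: "\<And>x n. x \<in> M \<Longrightarrow> e (G n x) (F x) \<le> 54 * L * h n" by metis
  have "F y = f y" if y: "y \<in> Y" for y
  proof -
    have yM: "y \<in> M" using y YM by blast
    have "e (f y) (F y) \<le> 0 + \<eta>" if \<eta>: "0 < \<eta>" for \<eta>
    proof -
      obtain n where "(54 * L) * h n < \<eta>" using small[OF \<eta>, of "54 * L"] by blast
      then show ?thesis using FG[OF yM, of n] discreteD(2)[OF G y, of n] by simp
    qed
    then have "e (f y) (F y) \<le> 0" by (rule field_le_epsilon)
    then show ?thesis using FT[OF yM] fT[OF y] by (metis antisym tr.nonneg tr.zero)
  qed
  moreover have "e (F x) (F y) \<le> L * d x y" if xy: "x \<in> M" "y \<in> M" for x y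
  proof (rule field_le_epsilon)
    fix \<eta> :: real assume "0 < \<eta>"
    \<comment> \<open>Two passages from \<open>G n\<close> to the limit cost 54 L h each, and
      rounding \<open>d x y\<close> up to a multiple of \<open>h n\<close> costs L h: 109 in
      all.\<close>
    then obtain n where n: "(110 * L) * h n < \<eta>" using small[of \<eta> "110 * L"] by blast
    define k where "k = Suc (nat \<lfloor>d x y / h n\<rfloor>)"
    have kk: "d x y / h n < real k" "real k \<le> d x y / h n + 1" unfolding k_def using h(1)[of n] nonneg[of x y] by (auto simp: le_floor_iff; linarith)+
    then have "d x y < real k * h n" "real k * h n \<le> d x y + h n" using h(1)[of n] by (auto simp: field_simps)
    then have "e (G n x) (G n y) \<le> real k * (L * h n)" using discrete_lip[OF G h(1) xy] by blast
    also have "\<dots> \<le> L * (d x y + h n)"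
      using \<open>real k * h n \<le> d x y + h n\<close> L by (simp add: mult.left_commute)
    finally have "e (G n x) (G n y) \<le> L * d x y + L * h n" by (simp add: algebra_simps)
    moreover have "e (F x) (F y) \<le> e (G n x) (F x) + e (G n x) (F y)" "e (G n x) (F y) \<le> e (G n x) (G n y) + e (G n y) (F y)"
      using tr.triangle''[of "F x" "G n x" "F y"] tr.triangle[of "G n x" "G n y" "F y"] GT FT xy by auto
    moreover have "0 < L * h n" using L h(1) by simp
    ultimately show "e (F x) (F y) \<le> L * d x y + \<eta>" using FG[OF xy(1), of n] FG[OF xy(2), of n] n by linarith
  qed
  moreover have "subh (M - Y) (\<lambda>x. e t (F x))" if t: "t \<in> T" for t
    unfolding subh_def
  proof (intro ballI allI impI)
    fix x R y assume x: "x \<in> M" and R: "0 < R" and ball: "mball x (3 * R) \<subseteq> M - Y" and y: "y \<in> mball x R"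
    let ?u = "\<lambda>x. e t (F x)"
    have yM: "y \<in> M" "d x y < R" using y by auto
    obtain C where C: "\<And>x. x \<in> M \<Longrightarrow> ?u x \<le> C" using dist_bdd FT t by blast
    show "2 * ?u y \<le> ?u x + spr ?u x (2 * R)"
    proof (rule field_le_epsilon)
      fix \<eta> :: real assume "0 < \<eta>"
      \<comment> \<open>219 = 108 + 54 + 57: replacing \<open>F\<close> by \<open>G n\<close> costs
        54 L h, twice at \<open>y\<close> and once at \<open>x\<close>; the supremum costs 54 + 3,
        as its ball for \<open>G n\<close> reaches up to \<open>3 * h n\<close> further. The term
        \<open>1 / R\<close> gives \<open>h n < R\<close>, so that \<open>k\<close> steps, doubled,
        stay within \<open>3 * R\<close>.\<close>
      obtain n where n: "(219 * L / \<eta> + 1 / R) * h n < 1"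
        using small[of 1 "219 * L / \<eta> + 1 / R"] by auto
      have "0 \<le> 219 * L / \<eta> * h n" "0 \<le> 1 / R * h n" using L h(1)[of n] R \<open>0 < \<eta>\<close> by auto
      then have "1 / R * h n < 1" "219 * L / \<eta> * h n < 1"
        using n unfolding distrib_right by linarith+
      then have hn: "h n < R" "219 * (L * h n) < \<eta>" using R \<open>0 < \<eta>\<close> by (simp_all add: divide_simps mult.assoc)
      let ?v = "\<lambda>x. e t (G n x)"
      define k where "k = Suc (nat \<lfloor>R / h n\<rfloor>)"
      have kk: "R / h n < real k" "real k \<le> R / h n + 1" unfolding k_def using h(1)[of n] R by (auto simp: le_floor_iff; linarith)+
      then have k: "R < real k * h n" "real k * h n \<le> R + h n" "0 < k" using h(1)[of n] by (auto simp: field_simps k_def)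
      have "(2 * real k - 1) * h n \<le> d x w" if w: "w \<in> Y" for w
      proof (rule ccontr)
        assume "\<not> ?thesis"
        then have "d x w < 3 * R" using k hn by (simp add: algebra_simps)
        then have "w \<in> mball x (3 * R)" using w YM x by auto
        then show False using ball w by blast
      qed
      then have dbl: "2 * spr ?v x (real k * h n) \<le> ?v x + spr ?v x (2 * real k * h n)"
        using discrete_double[OF G h(1) x t k(3)] by blast
      obtain C' where C': "\<And>x. x \<in> M \<Longrightarrow> ?v x \<le> C'" using dist_bdd[of "G n"] GT t by blast
      have vy: "?v y \<le> spr ?v x (real k * h n)" using spr_upper[of ?v C', OF C' x yM(1)] yM k by auto
      have uv: "?u z \<le> ?v z + 54 * (L * h n)" "?v z \<le> ?u z + 54 * (L * h n)" if "z \<in> M" for z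
        using tr.triangle[of t "G n z" "F z"] tr.triangle'[of t "F z" "G n z"] FG[OF that, of n] t FT GT that by auto
      have "spr ?v x (2 * real k * h n) \<le> spr ?u x (2 * R) + 57 * (L * h n)"
      proof (rule spr_least[OF x])
        show "0 < 2 * real k * h n" using k h(1)[of n] by simp
        fix z assume z: "z \<in> M" "d x z < 2 * real k * h n"
        then have "d x z < 2 * R + 3 * h n" using k h(1)[of n] by simp
        then obtain m where m: "m \<in> M" "d x m < 2 * R" "d m z < 3 * h n"
          using between[OF x z(1), of "2 * R" "3 * h n"] R h(1)[of n] by auto
        have "e (G n m) (G n z) \<le> real 3 * (L * h n)"
          using discrete_lip[OF G h(1) m(1) z(1), of 3 n] m(3) by simp
        moreover have "?v z \<le> ?v m + e (G n m) (G n z)" using tr.triangle t GT m z by blast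
        moreover have "?u m \<le> spr ?u x (2 * R)" using spr_upper[of ?u C, OF C x m(1,2)] .
        ultimately show "?v z \<le> spr ?u x (2 * R) + 57 * (L * h n)" using uv(2)[OF m(1)] by simp
      qed
      then show "2 * ?u y \<le> ?u x + spr ?u x (2 * R) + \<eta>"
        using dbl vy uv(1)[OF yM(1)] uv(2)[OF x] hn(2) by linarith
    qed
  qed
  ultimately show ?thesis using FT by blast
qed

end

section \<open>Absolute minimality and uniqueness\<close>

locale tree_valued = len_metric M d + rtree T e
  for M :: "'a set" and d :: "'a \<Rightarrow> 'a \<Rightarrow> real" and T :: "'b set" and e :: "'b \<Rightarrow> 'b \<Rightarrow> real" +
  fixes Y :: "'a set"
  assumes Y_closed: "closedin mtopology Y" and Yne: "Y \<noteq> {}"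
begin

section \<open>Absolute minimality through real Lipschitz bounds\<close>

definition lips :: "real \<Rightarrow> 'a set \<Rightarrow> ('a \<Rightarrow> 'b) \<Rightarrow> bool" where
  "lips K S F \<longleftrightarrow> (\<forall>x\<in>S. F x \<in> T) \<and> (\<forall>x\<in>S. \<forall>y\<in>S. e (F x) (F y) \<le> K * d x y)"

text \<open>Instead of comparing two extended Lipschitz constants, every real bound for the
  competitor is required to be a bound for \<open>F\<close>.\<close>

definition abs_minimal :: "('a \<Rightarrow> 'b) \<Rightarrow> bool" where
  "abs_minimal F \<longleftrightarrow> (\<exists>K. lips K M F) \<and>
    (\<forall>U h K. openin mtopology U \<longrightarrow> U \<subseteq> M - Y \<longrightarrow> (\<exists>K. lips K M h) \<longrightarrow> (\<forall>x\<in>M - U. h x = F x) \<longrightarrow>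
       0 \<le> K \<longrightarrow> lips K U h \<longrightarrow> lips K U F)"

definition subharmonic :: "('a \<Rightarrow> 'b) \<Rightarrow> bool" where
  "subharmonic F \<longleftrightarrow> (\<forall>t\<in>T. subh (M - Y) (\<lambda>x. e t (F x)))"

text \<open>For open \<open>U\<close> this is the frontier of \<open>U\<close> in
  \<open>M\<close>.\<close>

definition bd :: "'a set \<Rightarrow> 'a set" where
  "bd U = {w\<in>M. w \<notin> U \<and> (\<forall>r>0. \<exists>u\<in>U. d w u < r)}"

lemma YM: "Y \<subseteq> M"
  using Y_closed closedin_subset by fastforce

lemma lipsD: "lips K S F \<Longrightarrow> x \<in> S \<Longrightarrow> F x \<in> T" "lips K S F \<Longrightarrow> x \<in> S \<Longrightarrow> y \<in> S \<Longrightarrow> e (F x) (F y) \<le> K * d x y"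
  unfolding lips_def by blast+

lemma lips_pos:
  assumes "lips K M F" obtains K' where "0 < K'" "lips K' M F"
proof -
  have "K * d x y \<le> max K 1 * d x y" for x y by (intro mult_right_mono) auto
  then have "lips (max K 1) M F" using assms unfolding lips_def by (meson order_trans)
  then show ?thesis using that[of "max K 1"] by simp
qed

lemma bd_crossing:
  assumes "openin mtopology U" "a \<in> U" "b \<in> M - U" "0 < \<iota>"
  obtains w where "w \<in> bd U" "d a w + d w b \<le> d a b + \<iota>"
proof -
  obtain w where w: "w \<in> M" "w \<notin> U" "\<And>r. 0 < r \<Longrightarrow> \<exists>u\<in>U. d w u < r" "d a w + d w b \<le> d a b + \<iota>"
    using crossing[OF assms] by blast
  then have "w \<in> bd U" unfolding bd_def by blast
  then show ?thesis using that w(4) by blast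
qed

lemma lips_closure:
  assumes h: "lips K' M h" "lips K U h" and U: "U \<subseteq> M" and x: "x \<in> U \<union> bd U" and y: "y \<in> U \<union> bd U" and K: "0 \<le> K"
  shows "e (h x) (h y) \<le> K * d x y"
proof (rule field_le_epsilon)
  fix \<eta> :: real assume \<eta>: "0 < \<eta>"
  obtain C where C: "0 < C" "lips C M h" using lips_pos[OF h(1)] by blast
  have xy: "x \<in> M" "y \<in> M" using x y U unfolding bd_def by auto
  define r where "r = \<eta> / (2 * (C + K))"
  have r: "0 < r" "2 * (C + K) * r = \<eta>" unfolding r_def using \<eta> C K by (auto simp: add_pos_nonneg)
  have ap: "\<exists>u\<in>U. d z u < r" if "z \<in> U \<union> bd U" for z
    using that r U unfolding bd_def by force
  obtain u v where u: "u \<in> U" "d x u < r" and v: "v \<in> U" "d y v < r" using ap x y by meson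
  have uv: "u \<in> M" "v \<in> M" using u v U by auto
  have hT: "h x \<in> T" "h y \<in> T" "h u \<in> T" "h v \<in> T" using lipsD(1)[OF C(2)] xy uv by auto
  have "e (h x) (h y) \<le> e (h x) (h u) + e (h u) (h v) + e (h y) (h v)"
    using tr.triangle[of "h x" "h u" "h y"] tr.triangle'[of "h u" "h v" "h y"] hT by auto
  moreover have "e (h x) (h u) \<le> C * r" "e (h y) (h v) \<le> C * r"
    using lipsD(2)[OF C(2) xy(1) uv(1)] lipsD(2)[OF C(2) xy(2) uv(2)] u v C
      mult_left_mono[of "d x u" r C] mult_left_mono[of "d y v" r C] by linarith+
  moreover have "e (h u) (h v) \<le> K * d u v" using lipsD(2)[OF h(2) u(1) v(1)] .
  moreover have "d u v \<le> d x y + 2 * r"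
    using triangle''[of u x v] triangle[of x y v] xy uv u v by (simp add: commute)
  then have "K * d u v \<le> K * (d x y + 2 * r)" using K by (rule mult_left_mono)
  ultimately show "e (h x) (h y) \<le> K * d x y + \<eta>" using r(2) by (simp add: algebra_simps)
qed

text \<open>On an almost geodesic chain from \<open>y\<close> to \<open>w\<close> the cone falls to
  0 at rate \<open>K\<close>. If the distance to \<open>F w\<close> exceeded the cone at
  \<open>y\<close>, it would have to fall faster at some step inside \<open>U\<close>: before the
  chain leaves \<open>U\<close>, as the excess is small near the boundary, or before
  \<open>w\<close>, where it is 0. \<open>no_descent\<close> forbids this. The apex \<open>w\<close>
  may lie inside \<open>U\<close>.\<close>

lemma comparison_with_cone:
  assumes F: "lips C M F" "0 < C" "subharmonic F" and U: "openin mtopology U" "U \<subseteq> M - Y" and K: "0 \<le> K"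
    and w: "w \<in> M" and bdle: "\<And>v. v \<in> bd U \<Longrightarrow> e (F w) (F v) \<le> K * d w v" and y: "y \<in> U"
  shows "e (F w) (F y) \<le> K * d w y"
proof (rule ccontr)
  assume neg: "\<not> ?thesis"
  let ?u = "\<lambda>z. e (F w) (F z)"
  define c where "c z = K * d w z" for z
  define e0 where "e0 = ?u y - c y"
  have e0: "0 < e0" using neg unfolding e0_def c_def by simp
  have uy: "?u y = e0 + c y" unfolding e0_def by simp
  have UM: "U \<subseteq> M" using U by blast
  have yM: "y \<in> M" using y UM by blast
  note FT = lipsD(1)[OF F(1)]
  have margin: "?u x - c x \<le> (C + K) * d x z" if x: "x \<in> U" and z: "z \<in> M - U" for x z
  proof (rule field_le_epsilon)
    fix \<eta> :: real assume \<eta>: "0 < \<eta>"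
    have CK: "0 < C + K" using F(2) K by simp
    obtain v where v: "v \<in> bd U" "d x v + d v z \<le> d x z + \<eta> / (C + K)"
      using bd_crossing[OF U(1) x z, of "\<eta> / (C + K)"] \<eta> CK by auto
    have xv: "x \<in> M" "v \<in> M" using x v UM unfolding bd_def by auto
    have "?u x \<le> ?u v + e (F x) (F v)" using tr.triangle'[of "F w" "F v" "F x"] FT w xv by auto
    also have "\<dots> \<le> K * d w v + C * d x v" using bdle[OF v(1)] lipsD(2)[OF F(1) xv] by simp
    also have "K * d w v \<le> K * (d w x + d x v)" using triangle[OF w xv] K by (intro mult_left_mono)
    finally have "?u x - c x \<le> (C + K) * d x v" unfolding c_def by (simp add: algebra_simps)
    also have "\<dots> \<le> (C + K) * (d x z + \<eta> / (C + K))"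
    proof (rule mult_left_mono)
      show "d x v \<le> d x z + \<eta> / (C + K)" using v(2) nonneg[of v z] by linarith
    qed (use CK in simp)
    also have "\<dots> = (C + K) * d x z + \<eta>" using CK by (simp add: field_simps)
    finally show "?u x - c x \<le> (C + K) * d x z + \<eta>" .
  qed
  \<comment> \<open>\<open>4 * (C + K) + 2 * K\<close> is the constant of \<open>no_descent\<close>
    for the margin \<open>C + K\<close> and the slope \<open>K\<close>.\<close>
  define B where "B = 4 * (C + K) + 2 * K + 1"
  have B: "0 < B" "C + K \<le> B" "4 * (C + K) + 2 * K \<le> B" "K \<le> B" unfolding B_def using F(2) K by auto
  define \<rho> where "\<rho> = e0 / (4 * B)"
  have \<rho>: "0 < \<rho>" "B * \<rho> = e0 / 4" unfolding \<rho>_def using e0 B by auto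
  have K\<rho>: "K * \<rho> \<le> e0 / 4" "(C + K) * \<rho> \<le> e0 / 4" "(4 * (C + K) + 2 * K) * \<rho> \<le> e0 / 4"
    using \<rho> B mult_right_mono[of _ B \<rho>] by auto
  obtain n z where z: "z 0 = y" "z n = w" "\<And>i. i \<le> n \<Longrightarrow> z i \<in> M"
    "\<And>i. i < n \<Longrightarrow> d (z i) (z (Suc i)) < \<rho>" "(\<Sum>i<n. d (z i) (z (Suc i))) \<le> d y w + \<rho>"
    using chain[OF yM w \<rho>(1) \<rho>(1)] by metis
  let ?l = "\<lambda>i. d (z i) (z (Suc i))"
  have cz: "c (z i) + K * (\<Sum>k<i. ?l k) \<le> c y + e0 / 4" if i: "i \<le> n" for i
  proof -
    have "(\<Sum>k<i. ?l k) + d (z i) w \<le> d y w + \<rho>" using chain_ends(2)[of n z i, OF z(3) i] z(2,5) by simp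
    then have "K * ((\<Sum>k<i. ?l k) + d (z i) w) \<le> K * (d y w + \<rho>)" using K by (rule mult_left_mono)
    then show ?thesis unfolding c_def using K\<rho> by (simp add: algebra_simps commute)
  qed
  have "\<exists>j\<le>n. (\<forall>i\<le>j. i < n \<longrightarrow> z i \<in> U) \<and> ?u (z j) < ?u (z 0) - K * (\<Sum>k<j. ?l k)"
  proof (cases "\<forall>i<n. z i \<in> U")
    case True
    have "?u (z n) = 0" using z(2) FT w by simp
    moreover have "K * (\<Sum>k<n. ?l k) < ?u y"
    proof -
      have "c (z n) = 0" unfolding c_def z(2) using w by simp
      then show ?thesis using cz[of n] e0 uy by linarith
    qed
    ultimately show ?thesis using True z(1) by (intro exI[of _ n]) auto
  next
    case False
    define j where "j = (LEAST i. i < n \<and> z i \<notin> U)"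
    have j: "j < n" "z j \<notin> U" using False LeastI_ex[of "\<lambda>i. i < n \<and> z i \<notin> U"] unfolding j_def by auto
    have before: "z i \<in> U" if "i < j" for i
      using not_less_Least[of i "\<lambda>i. i < n \<and> z i \<notin> U"] that j unfolding j_def by auto
    obtain j' where j': "j = Suc j'" using j y z(1) by (cases j) auto
    have "?u (z j') - c (z j') \<le> (C + K) * ?l j'" using margin[OF before, of j' "z j"] j j' z(3)[of j] by auto
    also have "\<dots> \<le> (C + K) * \<rho>" using z(4)[of j'] j j' F(2) K by (intro mult_left_mono) auto
    finally have "?u (z j') \<le> c (z j') + e0 / 4" using K\<rho> by simp
    moreover have "c (z j') + K * (\<Sum>k<j'. ?l k) \<le> c y + e0 / 4" using cz[of j'] j j' by simp
    ultimately have "?u (z j') < ?u y - K * (\<Sum>k<j'. ?l k)" using e0 uy by linarith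
    then show ?thesis using before j j' z(1) by (intro exI[of _ j']) auto
  qed
  then obtain j where j: "j \<le> n" "\<And>i. i \<le> j \<Longrightarrow> i < n \<Longrightarrow> z i \<in> U" "?u (z j) < ?u (z 0) - K * (\<Sum>k<j. ?l k)"
    by blast
  obtain i where i: "i < j" "?u (z 0) - K * (\<Sum>k<i. ?l k) \<le> ?u (z i)" "?u (z (Suc i)) < ?u (z i) - K * ?l i"
    using chain_drop[of "\<lambda>i. ?u (z i)" j K ?l] j(3) by blast
  have iM: "z i \<in> U" "z (Suc i) \<in> M" "i < n" using i j z(3) by auto
  obtain D where D: "\<And>x. x \<in> M \<Longrightarrow> ?u x \<le> D" using bounded FT w by meson
  show False
  proof (rule no_descent[of ?u D U c K "C + K" "z i" "z (Suc i)"])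
    show "subh U ?u" using F(3) FT[OF w] subh_mono U(2) unfolding subharmonic_def by blast
    show "c a - c b \<le> K * d a b" if "a \<in> M" "b \<in> M" for a b
    proof -
      have "K * d w a \<le> K * (d w b + d a b)" using triangle'[OF w that(2,1)] K by (intro mult_left_mono)
      then show ?thesis unfolding c_def by (simp add: algebra_simps)
    qed
    have "0 \<le> K * ?l i" using K by simp
    then show "0 < ?u (z i)" using i(3) tr.nonneg[of "F w" "F (z (Suc i))"] by linarith
    have "c (z i) + K * (\<Sum>k<i. ?l k) \<le> c y + e0 / 4" using cz[of i] iM by simp
    then have "e0 - e0 / 4 \<le> ?u (z i) - c (z i)" using i(2) uy unfolding z(1) by linarith
    moreover have "(4 * (C + K) + 2 * K) * ?l i \<le> (4 * (C + K) + 2 * K) * \<rho>"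
      using z(4)[of i] iM F(2) K by (intro mult_left_mono) auto
    ultimately show "(4 * (C + K) + 2 * K) * ?l i < ?u (z i) - c (z i)" using K\<rho>(3) e0 by linarith
  qed (use D UM K F(2) margin iM i in auto)
qed

text \<open>Comparison with cones is used twice: with apex on the boundary of \<open>U\<close>,
  where \<open>F\<close> agrees with the competitor, and then, with the result as boundary data,
  with apex in \<open>U\<close>.\<close>

theorem subharmonic_imp_abs_minimal:
  assumes F: "lips C M F" "subharmonic F"
  shows "abs_minimal F"
  unfolding abs_minimal_def
proof (intro conjI allI impI)
  show "\<exists>K. lips K M F" using F by blast
  fix U h K assume U: "openin mtopology U" "U \<subseteq> M - Y" and h: "\<exists>K. lips K M h" "\<forall>x\<in>M - U. h x = F x"
    and K: "0 \<le> K" "lips K U h"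
  obtain C' where C': "0 < C'" "lips C' M F" using lips_pos[OF F(1)] by blast
  have UM: "U \<subseteq> M" using U by blast
  have bdM: "bd U \<subseteq> M - U" unfolding bd_def by blast
  have bb: "e (F v) (F w) \<le> K * d v w" if "v \<in> bd U" "w \<in> bd U" for v w
  proof -
    obtain K' where "lips K' M h" using h(1) by blast
    then have "e (h v) (h w) \<le> K * d v w" using lips_closure[OF _ K(2) UM _ _ K(1)] that by blast
    moreover have "h v = F v" "h w = F w" using h(2) that bdM by blast+
    ultimately show ?thesis by simp
  qed
  have b1: "e (F v) (F x) \<le> K * d v x" if v: "v \<in> bd U" and x: "x \<in> U" for v x
    using bdM v bb[OF v] by (intro comparison_with_cone[OF C'(2,1) F(2) U K(1) _ _ x]) auto
  have "e (F x) (F y) \<le> K * d x y" if x: "x \<in> U" and y: "y \<in> U" for x y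
    using b1[OF _ x] UM x by (intro comparison_with_cone[OF C'(2,1) F(2) U K(1) _ _ y]) (auto simp: commute tr.commute)
  then show "lips K U F" unfolding lips_def using lipsD(1)[OF F(1)] UM by blast
qed

text \<open>For images of \<open>\<epsilon>\<close>-balls, \<open>subh\<close> at the radii
  \<open>\<epsilon>\<close> and \<open>2 * \<epsilon>\<close> becomes the discrete inequality. Two
  such balls at neighbours span \<open>3 * \<epsilon>\<close>, so \<open>\<sigma>\<close> is 3 C
  \<open>\<epsilon>\<close>, and the bound 9 \<open>\<sigma>\<close> tends to 0.\<close>

theorem subharmonic_unique:
  assumes F: "lips C1 M F" "subharmonic F" and G: "lips C2 M G" "subharmonic G"
    and eq: "\<And>y. y \<in> Y \<Longrightarrow> F y = G y" and x: "x \<in> M"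
  shows "F x = G x"
proof -
  define C where "C = max 1 (max C1 C2)"
  have C: "0 < C" "lips C M F" "lips C M G"
  proof -
    have "C1 * d x y \<le> C * d x y" "C2 * d x y \<le> C * d x y" for x y
      unfolding C_def by (auto intro!: mult_right_mono)
    then show "lips C M F" "lips C M G" using F(1) G(1) unfolding lips_def by (meson order_trans)+
  qed (simp add: C_def)
  have close: "e (F x) (G x) \<le> 27 * (C * \<epsilon>)" if \<epsilon>: "0 < \<epsilon>" for \<epsilon>
  proof -
    define nb where "nb a b \<longleftrightarrow> d a b < \<epsilon>" for a b
    define \<Omega> where "\<Omega> = {x\<in>M. \<forall>y\<in>Y. 3 * \<epsilon> \<le> d x y}"
    define P where "P F a = F ` mball a \<epsilon>" for F :: "'a \<Rightarrow> 'b" and a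
    have C\<epsilon>: "0 < C * \<epsilon>" using C \<epsilon> by simp
    interpret tc: tree_comparison T e M nb \<Omega> "3 * (C * \<epsilon>)"
      using \<epsilon> C\<epsilon> unfolding nb_def \<Omega>_def by unfold_locales (auto simp: commute)
    have lip: "e (H a) (H b) \<le> C * r" if "lips C M H" "a \<in> M" "b \<in> M" "d a b \<le> r" for H a b r
      using lipsD(2)[OF that(1-3)] mult_left_mono[OF that(4), of C] C(1) by linarith
    have sub: "tc.subharm (P H)" if H: "lips C M H" "subharmonic H" for H
      unfolding tc.subharm_def
    proof (intro conjI ballI impI)
      note HT = lipsD(1)[OF H(1)]
      have far_spr: "far (P H) t a = spr (\<lambda>z. e t (H z)) a \<epsilon>" for t a
        unfolding far_def P_def spr_def by (simp add: image_image)
      have near: "far (tc.near (P H)) t a = spr (\<lambda>z. e t (H z)) a (2 * \<epsilon>)" if a: "a \<in> M" for t a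
      proof -
        have "tc.near (P H) a = H ` mball a (2 * \<epsilon>)"
        proof
          show "tc.near (P H) a \<subseteq> H ` mball a (2 * \<epsilon>)"
          proof
            fix b assume "b \<in> tc.near (P H) a"
            then obtain z w where z: "z \<in> M" "d a z < \<epsilon>" "w \<in> M" "d z w < \<epsilon>" "b = H w"
              unfolding tc.near_def P_def nb_def by auto
            then have "d a w < 2 * \<epsilon>" using triangle[of a z w] a by auto
            then show "b \<in> H ` mball a (2 * \<epsilon>)" using z a by auto
          qed
          show "H ` mball a (2 * \<epsilon>) \<subseteq> tc.near (P H) a"
          proof
            fix b assume "b \<in> H ` mball a (2 * \<epsilon>)"
            then obtain w where w: "w \<in> M" "d a w < 2 * \<epsilon>" "b = H w" by auto
            obtain m where m: "m \<in> M" "d a m < \<epsilon>" "d m w < \<epsilon>"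
              using between[OF a w(1) \<epsilon> \<epsilon>] w by auto
            then show "b \<in> tc.near (P H) a" unfolding tc.near_def P_def nb_def using w by auto
          qed
        qed
        then show ?thesis unfolding far_def spr_def by (simp add: image_image)
      qed
      show "P H a \<noteq> {}" "P H a \<subseteq> T" if "a \<in> M" for a
        using that HT \<epsilon> unfolding P_def by (auto simp: mball_eq_empty)
      show "e p q \<le> 3 * (C * \<epsilon>)" if ab: "a \<in> M" "b \<in> M" "nb a b" "p \<in> P H a" "q \<in> P H b" for a b p q
      proof -
        obtain z w where z: "z \<in> M" "d a z < \<epsilon>" "p = H z" "w \<in> M" "d b w < \<epsilon>" "q = H w"
          using ab unfolding P_def by auto
        have "d z w \<le> 3 * \<epsilon>"
          using triangle''[of z a w] triangle[of a b w] ab z unfolding nb_def by simp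
        then show ?thesis using lip[OF H(1) z(1,4)] z by fastforce
      qed
      fix a t b assume a: "a \<in> \<Omega>" "t \<in> T" "b \<in> M" "nb a b"
      have aM: "a \<in> M" using a unfolding \<Omega>_def by auto
      obtain D where D: "\<And>x. x \<in> M \<Longrightarrow> e t (H x) \<le> D" using bounded HT a by meson
      have "mball a (3 * \<epsilon>) \<subseteq> M - Y" using a(1) unfolding \<Omega>_def by force
      then have "spr (\<lambda>z. e t (H z)) a \<epsilon> \<le> (e t (H a) + spr (\<lambda>z. e t (H z)) a (2 * \<epsilon>)) / 2"
        using H(2) a(2) aM \<epsilon> unfolding subharmonic_def subh_def by (intro spr_least) (auto simp: field_simps)
      moreover have "e t (H a) \<le> spr (\<lambda>z. e t (H z)) b \<epsilon>"
        using spr_upper[of "\<lambda>z. e t (H z)" D, OF D a(3) aM] a(4) unfolding nb_def by (simp add: commute)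
      ultimately show "2 * far (P H) t a \<le> far (P H) t b + far (tc.near (P H)) t a"
        unfolding near[OF aM] far_spr by simp
    qed
    have out: "maxdist (P F) (P G) a \<le> 27 * (C * \<epsilon>)" if a: "a \<in> M - \<Omega>" for a
    proof (rule maxdist_least)
      show "P F a \<noteq> {}" "P G a \<noteq> {}" using a \<epsilon> unfolding P_def by (auto simp: mball_eq_empty)
      fix p q assume pq: "p \<in> P F a" "q \<in> P G a"
      obtain y where y: "y \<in> Y" "d a y < 3 * \<epsilon>" using a unfolding \<Omega>_def by auto
      have yM: "y \<in> M" using y YM by blast
      obtain z w where z: "z \<in> M" "d a z < \<epsilon>" "p = F z" and w: "w \<in> M" "d a w < \<epsilon>" "q = G w"
        using pq unfolding P_def by auto
      have "d z y \<le> 4 * \<epsilon>" "d w y \<le> 4 * \<epsilon>"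
        using triangle''[of z a y] triangle''[of w a y] z w y yM a by auto
      then have "e (F z) (F y) \<le> C * (4 * \<epsilon>)" "e (G w) (G y) \<le> C * (4 * \<epsilon>)"
        using lip[OF C(2) z(1) yM] lip[OF C(3) w(1) yM] by auto
      moreover have "e (F z) (G w) \<le> e (F z) (F y) + e (G w) (F y)"
        using tr.triangle'[of "F z" "F y" "G w"] lipsD(1)[OF C(2)] lipsD(1)[OF C(3)] z w yM by auto
      ultimately show "e p q \<le> 27 * (C * \<epsilon>)" using z w eq[OF y(1)] C\<epsilon> by simp
    qed
    have "maxdist (P F) (P G) x \<le> 27 * (C * \<epsilon>)"
    proof (rule tc.tree_comparison[OF sub[OF C(2) F(2)] sub[OF C(3) G(2)] out _ _ x])
      show "9 * (3 * (C * \<epsilon>)) \<le> 27 * (C * \<epsilon>)" by simp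
      fix a assume a: "a \<in> M"
      obtain y where y: "y \<in> Y" using Yne by blast
      have yM: "y \<in> M" using y YM by blast
      have "y \<notin> \<Omega>" using y yM \<epsilon> unfolding \<Omega>_def by force
      then show "\<exists>y\<in>M - \<Omega>. (a, y) \<in> {(a, b). a \<in> M \<and> b \<in> M \<and> nb a b}\<^sup>*"
        using reach_boundary[OF a \<epsilon> yM] yM unfolding nb_def by auto
    qed
    moreover have "e (F x) (G x) \<le> maxdist (P F) (P G) x"
      using x \<epsilon> lipsD(1)[OF C(2)] lipsD(1)[OF C(3)] by (intro maxdist_upper) (auto simp: P_def)
    ultimately show ?thesis by linarith
  qed
  have "e (F x) (G x) \<le> 0 + \<eta>" if "0 < \<eta>" for \<eta>
    using close[of "\<eta> / (27 * C)"] that C(1) by simp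
  then have "e (F x) (G x) \<le> 0" by (rule field_le_epsilon)
  then show ?thesis using lipsD(1)[OF C(2) x] lipsD(1)[OF C(3) x] by (metis antisym tr.nonneg tr.zero)
qed

end

section \<open>Absolutely minimal maps are subharmonic\<close>

context rtree
begin

section \<open>Distances measured in one component\<close>

definition vfun :: "'b \<Rightarrow> 'b \<Rightarrow> 'b \<Rightarrow> real" where
  "vfun p a z = (if same p a z then e p z else 0)"

lemma vfun_nonneg: "0 \<le> vfun p a z"
  unfolding vfun_def by simp

text \<open>If only \<open>z\<close> lies in the component of \<open>a\<close>, the segment from
  \<open>z\<close> to \<open>w\<close> passes through \<open>p\<close>.\<close>

lemma vfun_lip:
  assumes "p \<in> T" "a \<in> T" "z \<in> T" "w \<in> T"
  shows "vfun p a z - vfun p a w \<le> e z w"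
proof (cases "same p a z")
  case True
  show ?thesis
  proof (cases "same p a w")
    case True
    then show ?thesis using \<open>same p a z\<close> tr.triangle[of p w z] assms unfolding vfun_def by (simp add: tr.commute)
  next
    case False
    then have "\<not> same p z w" using True same_trans assms by blast
    then have "e z w = e z p + e p w" using not_same assms by blast
    then show ?thesis using tr.nonneg[of p w] tr.commute[of z p] unfolding vfun_def by simp
  qed
next
  case False
  then have "vfun p a z = 0" unfolding vfun_def by simp
  then show ?thesis using vfun_nonneg[of p a w] tr.nonneg[of z w] by linarith
qed

lemma vfun_self: "p \<in> T \<Longrightarrow> a \<in> T \<Longrightarrow> vfun p a a = e p a"
  unfolding vfun_def same_def by (auto simp: tr.commute less_eq_real_def)

text \<open>Put \<open>q\<close> on the segment from \<open>p\<close> to \<open>x\<close>, at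
  distance from \<open>p\<close> equal to the Gromov product of \<open>x\<close> and
  \<open>y\<close>; the four-point condition places it on the other two segments.\<close>

lemma median:
  assumes "p \<in> T" "x \<in> T" "y \<in> T"
  obtains q where "q \<in> T" "e p x = e p q + e q x" "e p y = e p q + e q y" "e x y = e x q + e q y"
proof -
  define g where "g = (e p x + e p y - e x y) / 2"
  have "0 \<le> g" "g \<le> e p x" unfolding g_def
    using tr.triangle''[of x p y] tr.triangle[of p x y] assms by auto
  then obtain q where q: "q \<in> T" "e p q = g" "e q x = e p x - g" using geodesic[of p x g] assms by blast
  have g2: "2 * g = e p x + e p y - e x y" unfolding g_def by simp
  have "e q y + e p x \<le> max (e q p + e y x) (e q x + e y p)" using four_point[of q y p x] q assms by auto
  moreover have "e q p + e y x = g + e x y" "e q x + e y p = e p x - g + e p y"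
    using q tr.commute[of q p] tr.commute[of y x] tr.commute[of y p] by auto
  ultimately have "e q y \<le> e p y - g" using g2 by linarith
  moreover have "e p y \<le> e p q + e q y" using tr.triangle q assms by blast
  ultimately have "e q y = e p y - g" using q by linarith
  then show ?thesis using that[OF q(1)] q g2 tr.commute[of q x] by simp
qed

text \<open>\<open>q\<close> separates \<open>p\<close> from \<open>b\<close>, hence from the whole
  component of \<open>b\<close>. So components shrink on passing from \<open>p\<close> to
  \<open>q\<close>, as the induction on branch points requires.\<close>

lemma branch_extends:
  assumes T: "p \<in> T" "a \<in> T" "q \<in> T" "b \<in> T" "w \<in> T" and pab: "same p a b" and q: "e p b = e p q + e q b" "q \<noteq> p"
    and w: "same q b w"
  shows "e p w = e p q + e q w" "same p a w"
proof -
  have "\<not> same q p b" using not_same T q by blast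
  then have "\<not> same q p w" using same_trans same_sym T w by metis
  then show pw: "e p w = e p q + e q w" using not_same T by blast
  have pq: "0 < e p q" using q T by auto
  have "same p q w" using pw pq tr.commute[of q p] tr.nonneg[of q w] unfolding same_def by linarith
  moreover have "same p b q" using q pq tr.commute[of b q] tr.commute[of b p] unfolding same_def by linarith
  ultimately show "same p a w" using same_trans pab T by metis
qed

end

text \<open>A ball on which comparison with cones fails for \<open>u = vfun p a \<circ> F\<close>: the cone of slope \<open>s\<close>
  through the center and the bound \<open>C\<close> at radius \<open>r\<close> is exceeded by at most \<open>m > 0\<close>.\<close>

locale failing_ball = tree_valued M d T e Y
  for M :: "'a set" and d :: "'a \<Rightarrow> 'a \<Rightarrow> real" and T :: "'b set" and e :: "'b \<Rightarrow> 'b \<Rightarrow> real" and Y +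
  fixes F :: "'a \<Rightarrow> 'b" and C0 :: real and p a :: 'b and x0 :: 'a and r C s m :: real
  assumes F: "lips C0 M F" and C0: "0 < C0" and pa: "p \<in> T" "a \<in> T" and x0: "x0 \<in> M" and r: "0 < r"
    and ball: "mball x0 r \<subseteq> M - Y" and uC: "\<And>x. x \<in> mball x0 r \<Longrightarrow> vfun p a (F x) \<le> C"
    and s: "0 < s" and u0: "vfun p a (F x0) = C - s * r" and m: "0 < m" "m \<le> s * r"
    and um: "\<And>x. x \<in> mball x0 r \<Longrightarrow> vfun p a (F x) - (C - s * (r - d x0 x)) \<le> m"
begin

abbreviation "\<Omega> \<equiv> mball x0 r"

definition u :: "'a \<Rightarrow> real" where "u x = vfun p a (F x)"

definition cone :: "real \<Rightarrow> 'a \<Rightarrow> real" where "cone \<sigma> z = C - \<sigma> * (r - d x0 z)"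

text \<open>The value of \<open>\<theta>\<close> makes \<open>s * \<theta> = (m / (4 * r)) * (m / 16)\<close>, as needed in \<open>far_bound\<close>.\<close>

definition \<theta> :: real where "\<theta> = m * m / (64 * r * s)"

text \<open>Where the function of the branch is positive, it differs from that of the component at
  \<open>p\<close> by the constant \<open>e p q\<close>; so cones for the latter can be tested with
  the former, whose subharmonicity is known by induction.\<close>

definition branch :: "'b \<Rightarrow> 'b \<Rightarrow> bool" where
  "branch q b \<longleftrightarrow> q \<in> T \<and> b \<in> T \<and> subh (M - Y) (\<lambda>x. vfun q b (F x)) \<and>
    (\<forall>w\<in>T. 0 < vfun q b w \<longrightarrow> vfun p a w = e p q + vfun q b w)"

lemma FT: "x \<in> M \<Longrightarrow> F x \<in> T"
  using lipsD(1)[OF F] .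

lemma F_lip: "x \<in> M \<Longrightarrow> y \<in> M \<Longrightarrow> e (F x) (F y) \<le> C0 * d x y"
  using lipsD(2)[OF F] .

lemma \<theta>: "0 < \<theta>" "\<theta> \<le> m / 64"
proof -
  show "0 < \<theta>" unfolding \<theta>_def using m s r by simp
  have "m * m \<le> m * (s * r)" using m by (intro mult_left_mono) auto
  then have "m * m / (64 * r * s) \<le> m * (s * r) / (64 * r * s)" using r s by (intro divide_right_mono) auto
  then show "\<theta> \<le> m / 64" unfolding \<theta>_def using r s by (simp add: field_simps)
qed

lemma cone_lip:
  assumes "0 \<le> \<sigma>" "x \<in> M" "y \<in> M" shows "cone \<sigma> x - cone \<sigma> y \<le> \<sigma> * d x y"
proof -
  have "\<sigma> * d x0 x \<le> \<sigma> * (d x0 y + d x y)" using triangle'[OF x0 assms(3,2)] assms by (intro mult_left_mono)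
  then show ?thesis unfolding cone_def by (simp add: algebra_simps)
qed

text \<open>This is \<open>no_descent\<close> with margin constant and slope both
  \<open>\<sigma>\<close>, whence 6 = 4 + 2. The margin condition holds since \<open>u\<close> is at
  most \<open>C\<close> in the ball and the cone of slope \<open>\<sigma>\<close> attains
  \<open>C\<close> at radius \<open>r\<close>.\<close>

lemma branch_no_descent:
  assumes br: "branch q b" and \<sigma>: "0 \<le> \<sigma>" and x: "x \<in> \<Omega>" and y: "y \<in> M"
    and desc: "vfun q b (F y) < vfun q b (F x) - \<sigma> * d x y" and small: "6 * \<sigma> * d x y < u x - cone \<sigma> x"
  shows False
proof -
  let ?v = "\<lambda>x. vfun q b (F x)"
  have qb: "q \<in> T" "b \<in> T" using br unfolding branch_def by auto
  have vu: "u x = e p q + ?v x" if "x \<in> M" "0 < ?v x" for x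
    using br that FT unfolding branch_def u_def by blast
  obtain D where D: "\<And>x y. x \<in> T \<Longrightarrow> y \<in> T \<Longrightarrow> e x y \<le> D" using bounded by blast
  have xM: "x \<in> M" using x by simp
  have v0: "0 < ?v x"
    using desc vfun_nonneg[of q b "F y"] mult_nonneg_nonneg[OF \<sigma> nonneg[of x y]] by linarith
  show False
  proof (rule no_descent[of ?v D \<Omega> "\<lambda>z. cone \<sigma> z - e p q" \<sigma> \<sigma> x y])
    show "?v x \<le> D" if "x \<in> M" for x
    proof -
      have "0 \<le> D" using D[OF qb(1) qb(1)] tr.nonneg[of q q] by linarith
      then show ?thesis using D[OF qb(1) FT[OF that]] unfolding vfun_def by auto
    qed
    show "subh \<Omega> ?v" using br ball subh_mono unfolding branch_def by blast
    show "(cone \<sigma> x - e p q) - (cone \<sigma> y - e p q) \<le> \<sigma> * d x y" if "x \<in> M" "y \<in> M" for x y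
      using cone_lip[OF \<sigma> that] by simp
    show "?v x - (cone \<sigma> x - e p q) \<le> \<sigma> * d x z" if xz: "x \<in> \<Omega>" "0 < ?v x" "z \<in> M - \<Omega>" for x z
    proof -
      have xM: "x \<in> M" "z \<in> M" "r \<le> d x0 z" using xz x0 by auto
      have "?v x + e p q \<le> C" using vu[OF xM(1) xz(2)] uC[OF xz(1)] unfolding u_def by simp
      moreover have "r - d x0 x \<le> d x z" using triangle[OF x0 xM(1,2)] xM by simp
      then have "\<sigma> * (r - d x0 x) \<le> \<sigma> * d x z" using \<sigma> by (rule mult_left_mono)
      ultimately show ?thesis unfolding cone_def by simp
    qed
    show "(4 * \<sigma> + 2 * \<sigma>) * d x y < ?v x - (cone \<sigma> x - e p q)"
      using small vu[OF xM v0] by (simp add: algebra_simps)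
  qed (use \<sigma> x v0 y desc in auto)
qed

lemma branch_no_chain:
  assumes br: "branch q b" and \<sigma>: "0 \<le> \<sigma>" and z: "\<And>i. i \<le> n \<Longrightarrow> z i \<in> \<Omega>"
    "\<And>i. i < n \<Longrightarrow> d (z i) (z (Suc i)) < \<rho>" and \<rho>: "0 < \<rho>"
    and drop: "vfun q b (F (z n)) < vfun q b (F (z 0)) - \<sigma> * (\<Sum>i<n. d (z i) (z (Suc i)))"
    and exc: "\<And>i. i < n \<Longrightarrow>
      6 * \<sigma> * \<rho> < e p q + vfun q b (F (z 0)) - \<sigma> * (\<Sum>k<i. d (z k) (z (Suc k))) - cone \<sigma> (z i)"
  shows False
proof -
  let ?v = "\<lambda>x. vfun q b (F x)"
  obtain i where i: "i < n" "?v (z 0) - \<sigma> * (\<Sum>j<i. d (z j) (z (Suc j))) \<le> ?v (z i)"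
    "?v (z (Suc i)) < ?v (z i) - \<sigma> * d (z i) (z (Suc i))"
    using chain_drop[OF drop] by blast
  have "0 \<le> \<sigma> * d (z i) (z (Suc i))" using \<sigma> by simp
  then have v0: "0 < ?v (z i)" using i(3) vfun_nonneg[of q b "F (z (Suc i))"] by linarith
  have zM: "z i \<in> \<Omega>" "z (Suc i) \<in> M" using z(1)[of i] z(1)[of "Suc i"] i by auto
  then have "u (z i) = e p q + ?v (z i)" using br v0 FT[of "z i"] unfolding branch_def u_def by auto
  moreover have "6 * \<sigma> * d (z i) (z (Suc i)) \<le> 6 * \<sigma> * \<rho>"
    using z(2)[OF i(1)] \<sigma> by (intro mult_left_mono) auto
  ultimately have "6 * \<sigma> * d (z i) (z (Suc i)) < u (z i) - cone \<sigma> (z i)" using i(2) exc[OF i(1)] by linarith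
  then show False using branch_no_descent[OF br \<sigma> zM i(3)] by blast
qed

text \<open>Along a chain of length at most m / (4 s) the cone and the line of slope
  \<open>- s\<close> each change by at most m / 4. So m / 4 of the excess 3 m / 4 remains, while
  steps of length \<open>m / (48 * s)\<close> need only m / 8.\<close>

lemma near_descent:
  assumes br: "branch q b" and z: "z \<in> \<Omega>" "0 < vfun q b (F z)" "3 * m / 4 \<le> u z - cone s z"
    and w: "w \<in> M" "d z w < m / (4 * s)" and drop: "vfun q b (F w) < vfun q b (F z) - s * d z w"
  shows False
proof -
  let ?v = "\<lambda>x. vfun q b (F x)"
  have zM: "z \<in> M" using z by simp
  have uz: "u z = e p q + ?v z" using br z FT[OF zM] unfolding branch_def u_def by auto
  define \<rho> where "\<rho> = m / (48 * s)"
  have \<rho>: "0 < \<rho>" "6 * s * \<rho> = m / 8" unfolding \<rho>_def using m s by auto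
  define \<iota> where "\<iota> = min (m / (4 * s) - d z w) ((?v z - ?v w - s * d z w) / (2 * s))"
  have \<iota>: "0 < \<iota>" "d z w + \<iota> \<le> m / (4 * s)" "s * \<iota> < ?v z - ?v w - s * d z w"
  proof -
    show "0 < \<iota>" "d z w + \<iota> \<le> m / (4 * s)" unfolding \<iota>_def using w drop s by auto
    have "s * \<iota> \<le> s * ((?v z - ?v w - s * d z w) / (2 * s))" unfolding \<iota>_def using s by (intro mult_left_mono) auto
    also have "\<dots> = (?v z - ?v w - s * d z w) / 2" using s by simp
    finally show "s * \<iota> < ?v z - ?v w - s * d z w" using drop by simp
  qed
  obtain n y where y: "y 0 = z" "y n = w" "\<And>i. i \<le> n \<Longrightarrow> y i \<in> M"
    "\<And>i. i < n \<Longrightarrow> d (y i) (y (Suc i)) < \<rho>" "(\<Sum>i<n. d (y i) (y (Suc i))) \<le> d z w + \<iota>"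
    using chain[OF zM w(1) \<iota>(1) \<rho>(1)] by metis
  have len: "(\<Sum>k<i. d (y k) (y (Suc k))) \<le> m / (4 * s)" "d z (y i) \<le> (\<Sum>k<i. d (y k) (y (Suc k)))" if i: "i \<le> n" for i
  proof -
    have "(\<Sum>k<i. d (y k) (y (Suc k))) + d (y i) (y n) \<le> (\<Sum>k<n. d (y k) (y (Suc k)))"
      using chain_ends(2)[of n y i, OF y(3) i] .
    then show "(\<Sum>k<i. d (y k) (y (Suc k))) \<le> m / (4 * s)" using y(5) \<iota>(2) nonneg[of "y i" "y n"] by linarith
    show "d z (y i) \<le> (\<Sum>k<i. d (y k) (y (Suc k)))" using chain_ends(1)[of n y i, OF y(3) i] y(1) by simp
  qed
  have sm: "s * (m / (4 * s)) = m / 4" using s by simp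
  have room: "m / (4 * s) < r - d x0 z"
  proof -
    have "u z \<le> C" using uC[OF z(1)] unfolding u_def .
    then have "3 * m / 4 \<le> s * (r - d x0 z)" using z(3) unfolding cone_def by linarith
    then have "s * (m / (4 * s)) < s * (r - d x0 z)" unfolding sm using m by linarith
    then show ?thesis using s by (simp only: mult_less_cancel_left_pos)
  qed
  show False
  proof (rule branch_no_chain[OF br less_imp_le[OF s], of n y \<rho>])
    show "y i \<in> \<Omega>" if "i \<le> n" for i
    proof -
      have "d x0 (y i) \<le> d x0 z + d z (y i)" using triangle x0 zM y(3)[OF that] by blast
      then show ?thesis using len[OF that] room x0 y(3)[OF that] by simp
    qed
    have "s * (\<Sum>i<n. d (y i) (y (Suc i))) \<le> s * (d z w + \<iota>)" using y(5) s by (intro mult_left_mono) auto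
    then show "?v (y n) < ?v (y 0) - s * (\<Sum>i<n. d (y i) (y (Suc i)))"
      unfolding y(1,2) using \<iota>(3) by (simp add: distrib_left)
    fix i assume i: "i < n"
    have "s * (\<Sum>k<i. d (y k) (y (Suc k))) \<le> s * (m / (4 * s))" using len(1)[of i] i s by (intro mult_left_mono) auto
    then have a: "s * (\<Sum>k<i. d (y k) (y (Suc k))) \<le> m / 4" using sm by simp
    have "cone s (y i) - cone s z \<le> s * d (y i) z" using cone_lip[OF less_imp_le[OF s], of "y i" z] y(3)[of i] i zM by auto
    also have "\<dots> \<le> s * (\<Sum>k<i. d (y k) (y (Suc k)))" using len(2)[of i] i s by (intro mult_left_mono) (auto simp: commute)
    finally show "6 * s * \<rho> < e p q + ?v (y 0) - s * (\<Sum>k<i. d (y k) (y (Suc k))) - cone s (y i)"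
      unfolding y(1) \<rho>(2) using a z(3) uz m by linarith
  qed (use y \<rho> in auto)
qed

text \<open>On the way from \<open>z\<close> to the center the excess stays below \<open>m\<close>, so \<open>u\<close> decreases at almost the rate
  \<open>s\<close>. If \<open>F z\<close> were far from \<open>q\<close>, it would decrease at a rate above \<open>s - m / (4 * r)\<close> inside the
  branch, where even the flatter cone of that slope is still exceeded.\<close>

lemma far_bound:
  assumes br: "branch q b" and z: "z \<in> \<Omega>" "m - \<theta> \<le> u z - cone s z"
  shows "vfun q b (F z) \<le> m / 16"
proof (rule ccontr)
  assume neg: "\<not> ?thesis"
  let ?v = "\<lambda>x. vfun q b (F x)"
  define \<eta> where "\<eta> = ?v z"
  have \<eta>: "m / 16 < \<eta>" using neg unfolding \<eta>_def by simp
  have zM: "z \<in> M" "d x0 z < r" using z by auto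
  have uv: "u x = e p q + ?v x" if "x \<in> M" "0 < ?v x" for x
    using br FT[OF that(1)] that(2) unfolding branch_def u_def by blast
  have uz: "u z = e p q + \<eta>" using uv[OF zM(1)] \<eta> m unfolding \<eta>_def by linarith
  \<comment> \<open>\<open>\<tau> * r = m / 4\<close> is the most by which the cone of slope
    \<open>s - \<tau>\<close> can lie above that of slope \<open>s\<close> in the ball.\<close>
  define \<tau> where "\<tau> = m / (4 * r)"
  define t where "t = s - \<tau>"
  have \<tau>: "0 < \<tau>" "\<tau> * r = m / 4" "\<tau> \<le> s / 4"
  proof -
    show "0 < \<tau>" "\<tau> * r = m / 4" unfolding \<tau>_def using m r by auto
    then have "\<tau> * r \<le> s / 4 * r" using m by simp
    then show "\<tau> \<le> s / 4" using r by (simp only: mult_le_cancel_right_pos)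
  qed
  have t: "0 < t" "t < s" unfolding t_def using \<tau> s by auto
  have gap: "t * \<theta> < \<tau> * \<eta>"
  proof -
    have "s * \<theta> = \<tau> * (m / 16)" unfolding \<tau>_def \<theta>_def using s by simp
    moreover have "t * \<theta> < s * \<theta>" using t \<theta>(1) by simp
    moreover have "\<tau> * (m / 16) < \<tau> * \<eta>" using \<eta> \<tau> by simp
    ultimately show ?thesis by linarith
  qed
  define g where "g = \<tau> * \<eta> - t * \<theta>"
  have g: "0 < g" using gap unfolding g_def by simp
  \<comment> \<open>The last bound keeps the overshoot of the chain,
    \<open>2 * (t * (s * \<rho>))\<close>, below the gap \<open>g\<close>.\<close>
  define \<rho> where "\<rho> = min (m / (32 * s)) (min ((r - d x0 z) / 2) (g / (4 * (t * s))))"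
  have \<rho>: "0 < \<rho>" "\<rho> < r - d x0 z" "t * \<rho> \<le> m / 32" "s * \<rho> \<le> m / 32" "t * (s * \<rho>) < g / 2"
  proof -
    show r0: "0 < \<rho>" unfolding \<rho>_def using m s zM g t by auto
    have "\<rho> \<le> (r - d x0 z) / 2" unfolding \<rho>_def by (rule min.coboundedI2, rule min.cobounded1)
    then show "\<rho> < r - d x0 z" using zM(2) by simp
    have "s * \<rho> \<le> s * (m / (32 * s))" unfolding \<rho>_def using s by (intro mult_left_mono) auto
    then show "s * \<rho> \<le> m / 32" using s by simp
    moreover have "t * \<rho> \<le> s * \<rho>" using t r0 by (intro mult_right_mono) auto
    ultimately show "t * \<rho> \<le> m / 32" by simp
    have "(t * s) * \<rho> \<le> (t * s) * (g / (4 * (t * s)))" unfolding \<rho>_def using s t by (intro mult_left_mono) auto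
    then show "t * (s * \<rho>) < g / 2" using s t g by (simp add: mult.assoc)
  qed
  obtain n y where y: "y 0 = z" "y n = x0" "\<And>i. i \<le> n \<Longrightarrow> y i \<in> M"
    "\<And>i. i < n \<Longrightarrow> d (y i) (y (Suc i)) < \<rho>" "(\<Sum>i<n. d (y i) (y (Suc i))) \<le> d z x0 + \<rho>"
    using chain[OF zM(1) x0 \<rho>(1) \<rho>(1)] by metis
  define l where "l i = (\<Sum>k<i. d (y k) (y (Suc k)))" for i
  have l: "0 \<le> l i" "d x0 (y i) \<le> d x0 z + \<rho> - l i" if "i \<le> n" for i
    using chain_ends(2)[of n y i, OF y(3) that] y(2,5) unfolding l_def by (auto simp: commute sum_nonneg)
  have yO: "y i \<in> \<Omega>" if "i \<le> n" for i using l[OF that] \<rho>(2) y(3)[OF that] x0 by simp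
  have cone_y: "cone \<sigma> (y i) + \<sigma> * l i \<le> cone \<sigma> z + \<sigma> * \<rho>" if "i \<le> n" "0 \<le> \<sigma>" for i \<sigma>
  proof -
    have "\<sigma> * d x0 (y i) \<le> \<sigma> * (d x0 z + \<rho> - l i)" using l[OF that(1)] that(2) by (intro mult_left_mono)
    then show ?thesis unfolding cone_def by (simp add: algebra_simps)
  qed
  \<comment> \<open>Either the branch function stays positive, and its value at the center is known
    from \<open>u0\<close>, or its first zero is reached after a length below
    \<open>\<eta> / t\<close>, by the bound \<open>um\<close> at the preceding point.\<close>
  have "\<exists>j\<le>n. ?v (y j) < ?v (y 0) - t * l j"
  proof (cases "\<exists>j\<le>n. ?v (y j) = 0")
    case False
    have vx0: "0 < ?v x0" using False y(2) vfun_nonneg[of q b "F x0"] by (metis le_refl order_le_less)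
    have "u x0 = C - s * r" using u0 unfolding u_def .
    then have "?v x0 = C - s * r - e p q" using uv[OF x0 vx0] by simp
    moreover have "C - s * r + s * d x0 z + (m - \<theta>) \<le> e p q + \<eta>" using z(2) uz unfolding cone_def by (simp add: algebra_simps)
    moreover have "t * l n \<le> t * (d x0 z + \<rho>)" using y(5) t unfolding l_def by (intro mult_left_mono) (auto simp: commute)
    moreover have "t * d x0 z \<le> s * d x0 z" using t by (intro mult_right_mono) auto
    ultimately have "?v (y n) < ?v (y 0) - t * l n"
      unfolding y(1,2) \<eta>_def[symmetric] using \<rho>(3) \<theta> m by (simp add: distrib_left)
    then show ?thesis by blast
  next
    case True
    define j where "j = (LEAST j. j \<le> n \<and> ?v (y j) = 0)"
    have j: "j \<le> n" "?v (y j) = 0" using LeastI_ex[of "\<lambda>j. j \<le> n \<and> ?v (y j) = 0"] True unfolding j_def by auto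
    have "j \<noteq> 0" using j(2) y(1) \<eta> m unfolding \<eta>_def by (intro notI) auto
    then obtain i where i: "j = Suc i" by (cases j) auto
    have "?v (y i) \<noteq> 0" using not_less_Least[of i "\<lambda>j. j \<le> n \<and> ?v (y j) = 0"] i j unfolding j_def by auto
    then have vi: "0 < ?v (y i)" using vfun_nonneg[of q b "F (y i)"] by linarith
    have iN: "i \<le> n" "i < n" using i j by auto
    have "u (y i) - cone s (y i) \<le> m" using um[OF yO[OF iN(1)]] unfolding u_def cone_def .
    then have "e p q + ?v (y i) + s * l i \<le> cone s z + s * \<rho> + m"
      using uv[OF y(3)[OF iN(1)] vi] cone_y[OF iN(1) less_imp_le[OF s]] by linarith
    then have sl: "s * l i < \<eta> + \<theta> + s * \<rho>" using vi z(2) uz by linarith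
    have "l j = l i + d (y i) (y (Suc i))" unfolding l_def i by simp
    then have "l j < l i + \<rho>" using y(4)[OF iN(2)] by simp
    then have "s * l j < s * (l i + \<rho>)" using s by simp
    then have "s * l j < \<eta> + \<theta> + 2 * (s * \<rho>)" using sl by (simp add: distrib_left)
    then have "t * (s * l j) < t * (\<eta> + \<theta> + 2 * (s * \<rho>))" using t by simp
    also have "\<dots> = t * \<eta> + t * \<theta> + 2 * (t * (s * \<rho>))" by (simp add: algebra_simps)
    also have "\<dots> < t * \<eta> + t * \<theta> + g" using \<rho>(5) by simp
    also have "\<dots> = s * \<eta>" unfolding g_def t_def by (simp add: algebra_simps)
    finally have "s * (t * l j) < s * \<eta>" by (simp add: mult.left_commute)
    then have "t * l j < \<eta>" using s by simp
    then show ?thesis using j y(1) unfolding \<eta>_def by (intro exI[of _ j]) auto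
  qed
  then obtain j where j: "j \<le> n" "?v (y j) < ?v (y 0) - t * l j" by blast
  show False
  proof (rule branch_no_chain[OF br less_imp_le[OF t(1)], of j y \<rho>])
    fix i assume i: "i < j"
    then have iN: "i \<le> n" using j by simp
    have "cone t z - cone s z = \<tau> * (r - d x0 z)" unfolding cone_def t_def by (simp add: algebra_simps)
    also have "\<dots> \<le> \<tau> * r" using \<tau> by (intro mult_left_mono) auto
    finally have "cone t z - cone s z \<le> m / 4" using \<tau> by simp
    moreover have "6 * t * \<rho> = 6 * (t * \<rho>)" by simp
    ultimately show "6 * t * \<rho> < e p q + ?v (y 0) - t * (\<Sum>k<i. d (y k) (y (Suc k))) - cone t (y i)"
      using cone_y[OF iN less_imp_le[OF t(1)]] z(2) uz \<theta> \<rho>(3) m unfolding l_def y(1) \<eta>_def by linarith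
  qed (use j yO y \<rho> in \<open>auto simp: l_def\<close>)
qed

text \<open>If \<open>z\<close> and \<open>z'\<close> are far apart, \<open>far_bound\<close> suffices. Otherwise a path between them reaches \<open>q\<close>
  from one of its ends at a rate above \<open>s\<close>, and this end is excluded by \<open>near_descent\<close>.\<close>

lemma cross_pair:
  assumes br: "branch q A" "branch q A'" and z: "z \<in> \<Omega>" "m - \<theta> \<le> u z - cone s z" "F z = A"
    and z': "z' \<in> \<Omega>" "m - \<theta> \<le> u z' - cone s z'" "F z' = A'"
    and q: "q \<noteq> A" "q \<noteq> A'" "e A A' = e A q + e q A'"
  shows "e A A' \<le> s * d z z'"
proof (rule ccontr)
  assume neg: "\<not> ?thesis"
  let ?v = "\<lambda>x. vfun q A (F x)" and ?v' = "\<lambda>x. vfun q A' (F x)"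
  have T: "q \<in> T" "A \<in> T" "A' \<in> T" using br unfolding branch_def by auto
  have zM: "z \<in> M" "z' \<in> M" using z z' by auto
  have v: "?v z = e q A" "?v' z' = e q A'" using vfun_self T z z' by auto
  have pos: "0 < e q A" "0 < e q A'" using q T by auto
  have ns: "\<not> same q A A'" using not_same T q by blast
  have AA: "e A A' = ?v z + ?v' z'" unfolding v using q by (simp add: tr.commute)
  \<comment> \<open>\<open>far_bound\<close> gives at most m / 16 for each value, so together m / 8
    = s \<open>l0\<close>: pairs at distance at least \<open>l0\<close> satisfy the claim.\<close>
  define l0 where "l0 = m / (8 * s)"
  have l0: "0 < l0" "s * l0 = m / 8" unfolding l0_def using m s by auto
  have near: "d z z' < l0"
  proof (rule ccontr)
    assume "\<not> ?thesis"
    then have "s * l0 \<le> s * d z z'" using s by (intro mult_left_mono) auto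
    then show False using far_bound[OF br(1) z(1,2)] far_bound[OF br(2) z'(1,2)] AA neg l0 by linarith
  qed
  define \<gamma> where "\<gamma> = e A A' - s * d z z'"
  have \<gamma>: "0 < \<gamma>" using neg unfolding \<gamma>_def by simp
  define \<rho> where "\<rho> = min l0 (\<gamma> / (2 * (s + C0)))"
  have \<rho>: "0 < \<rho>" "\<rho> \<le> l0" "s * \<rho> + C0 * \<rho> < \<gamma>"
  proof -
    show "0 < \<rho>" "\<rho> \<le> l0" unfolding \<rho>_def using l0 \<gamma> s C0 by auto
    have "(s + C0) * \<rho> \<le> (s + C0) * (\<gamma> / (2 * (s + C0)))" unfolding \<rho>_def using s C0 by (intro mult_left_mono) auto
    also have "\<dots> = \<gamma> / 2" using s C0 by (simp add: field_simps)
    finally show "s * \<rho> + C0 * \<rho> < \<gamma>" using \<gamma> by (simp add: distrib_right)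
  qed
  obtain n y where y: "y 0 = z" "y n = z'" "\<And>i. i \<le> n \<Longrightarrow> y i \<in> M"
    "\<And>i. i < n \<Longrightarrow> d (y i) (y (Suc i)) < \<rho>" "(\<Sum>i<n. d (y i) (y (Suc i))) \<le> d z z' + \<rho>"
    using chain[OF zM \<rho>(1) \<rho>(1)] by metis
  have "?v (y n) = 0" using ns unfolding vfun_def y(2) z'(3) by simp
  then have ex: "\<exists>j\<le>n. ?v (y j) = 0" by blast
  define j where "j = (LEAST j. j \<le> n \<and> ?v (y j) = 0)"
  have j: "j \<le> n" "?v (y j) = 0" using LeastI_ex[of "\<lambda>j. j \<le> n \<and> ?v (y j) = 0"] ex unfolding j_def by auto
  have "j \<noteq> 0" using j(2) y(1) v pos by (intro notI) auto
  then obtain i where i: "j = Suc i" by (cases j) auto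
  have iM: "i < n" "y i \<in> M" "y j \<in> M" using i j y(3) by auto
  have "?v (y i) \<noteq> 0" using not_less_Least[of i "\<lambda>j. j \<le> n \<and> ?v (y j) = 0"] i j unfolding j_def by auto
  then have "same q A (F (y i))" unfolding vfun_def by (auto split: if_splits)
  \<comment> \<open>At \<open>y i\<close> the value is still on the side of \<open>A\<close>, hence
    not on that of \<open>A'\<close>. One step later the first branch function is 0 and the second
    at most \<open>C0 * \<rho>\<close>.\<close>
  then have "\<not> same q A' (F (y i))" using ns same_trans same_sym T FT[OF iM(2)] by metis
  then have "?v' (y i) = 0" unfolding vfun_def by simp
  then have "?v' (y j) \<le> e (F (y j)) (F (y i))" using vfun_lip[OF T(1,3) FT[OF iM(3)] FT[OF iM(2)]] by simp
  also have "\<dots> \<le> C0 * d (y j) (y i)" using F_lip iM by blast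
  also have "\<dots> \<le> C0 * \<rho>" using y(4)[OF iM(1)] C0 i by (intro mult_left_mono) (auto simp: commute)
  finally have v'j: "?v' (y j) \<le> C0 * \<rho>" .
  have len: "d z (y j) + d (y j) z' \<le> d z z' + \<rho>"
    using chain_ends[of n y j, OF y(3) j(1)] y(1,2,5) by simp
  have small: "d z (y j) < m / (4 * s)" "d z' (y j) < m / (4 * s)"
  proof -
    have "d z (y j) + d (y j) z' < 2 * l0" using len near \<rho> by linarith
    moreover have "2 * l0 = m / (4 * s)" unfolding l0_def using s by (simp add: field_simps)
    ultimately show "d z (y j) < m / (4 * s)" "d z' (y j) < m / (4 * s)"
      using nonneg[of z "y j"] nonneg[of "y j" z'] commute[of z' "y j"] by linarith+
  qed
  have "s * (d z (y j) + d (y j) z') \<le> s * (d z z' + \<rho>)" using len s by (intro mult_left_mono) auto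
  then have "s * d z (y j) + s * d z' (y j) + C0 * \<rho> < ?v z + ?v' z'"
    using \<rho>(3) AA unfolding \<gamma>_def by (simp add: distrib_left commute)
  then have "s * d z (y j) < ?v z \<or> s * d z' (y j) + C0 * \<rho> < ?v' z'" by linarith
  then show False
  proof
    assume "s * d z (y j) < ?v z"
    then show False using near_descent[OF br(1) z(1) _ _ iM(3) small(1)] z(2) \<theta> m j(2) v pos by simp
  next
    assume "s * d z' (y j) + C0 * \<rho> < ?v' z'"
    then show False using near_descent[OF br(2) z'(1) _ _ iM(3) small(2)] z'(2) \<theta> m v'j v pos by simp
  qed
qed


lemma cone_ge: "z \<in> M \<Longrightarrow> 0 \<le> cone s z"
  using u0 vfun_nonneg[of p a "F x0"] mult_nonneg_nonneg[OF less_imp_le[OF s] nonneg[of x0 z]]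
  unfolding cone_def by (simp add: algebra_simps)

lemma excess_lip:
  assumes "x \<in> M" "y \<in> M" shows "(u x - cone s x) - (u y - cone s y) \<le> (C0 + s) * d x y"
proof -
  have "u x - u y \<le> C0 * d x y"
    using vfun_lip[OF pa FT FT, OF assms] F_lip[OF assms] unfolding u_def by linarith
  moreover have "cone s y - cone s x \<le> s * d x y" using cone_lip[of s y x] s assms by (simp add: commute)
  ultimately show ?thesis by (simp add: distrib_right)
qed

section \<open>The excess set and its competitor\<close>

definition U :: "'a set" where "U = {x\<in>\<Omega>. m - \<theta> < u x - cone s x}"

lemma U_sub: "U \<subseteq> M" "U \<subseteq> M - Y" "x0 \<notin> U"
proof -
  show "U \<subseteq> M" "U \<subseteq> M - Y" using ball unfolding U_def by auto
  have "u x0 = cone s x0" using u0 x0 unfolding u_def cone_def by simp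
  then show "x0 \<notin> U" unfolding U_def using \<theta> m by auto
qed

lemma U_open: "openin mtopology U"
  unfolding openin_mtopology
proof (intro conjI allI impI)
  show "U \<subseteq> M" by (rule U_sub)
  fix x assume x: "x \<in> U"
  have xM: "x \<in> M" "d x0 x < r" "m - \<theta> < u x - cone s x" using x unfolding U_def by auto
  define g where "g = (u x - cone s x) - (m - \<theta>)"
  define \<rho> where "\<rho> = min (r - d x0 x) (g / (C0 + s))"
  have g: "0 < g" using xM unfolding g_def by simp
  then have \<rho>: "0 < \<rho>" unfolding \<rho>_def using xM C0 s by auto
  moreover have "mball x \<rho> \<subseteq> U"
  proof
    fix y assume y: "y \<in> mball x \<rho>"
    have yM: "y \<in> M" "d x y < \<rho>" using y by auto
    have "d x0 y < r" using triangle[OF x0 xM(1) yM(1)] yM(2) unfolding \<rho>_def by simp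
    moreover have "(C0 + s) * d x y < g"
    proof -
      have "d x y < g / (C0 + s)" using yM(2) unfolding \<rho>_def by simp
      then show ?thesis using C0 s by (simp add: field_simps)
    qed
    then have "m - \<theta> < u y - cone s y" using excess_lip[OF xM(1) yM(1)] unfolding g_def by linarith
    ultimately show "y \<in> U" unfolding U_def using x0 yM by simp
  qed
  ultimately show "\<exists>r>0. mball x r \<subseteq> U" by blast
qed

text \<open>Since \<open>u\<close> is at most \<open>C\<close>, the excess is small near the sphere
  of radius \<open>r\<close>. So the boundary of \<open>U\<close> stays inside the ball, and
  continuity fixes the excess there.\<close>

lemma bd_U:
  assumes w: "w \<in> bd U" shows "w \<in> \<Omega>" "u w - cone s w = m - \<theta>"
proof -
  have wM: "w \<in> M" "w \<notin> U" and lim: "\<And>\<rho>. 0 < \<rho> \<Longrightarrow> \<exists>x\<in>U. d w x < \<rho>" using w unfolding bd_def by auto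
  show w\<Omega>: "w \<in> \<Omega>"
  proof (rule ccontr)
    assume "w \<notin> \<Omega>"
    then have "r \<le> d x0 w" using wM x0 by auto
    obtain x where x: "x \<in> U" "d w x < m / (2 * s)" using lim[of "m / (2 * s)"] m s by auto
    then have xO: "x \<in> M" "x \<in> \<Omega>" "m - \<theta> < u x - cone s x" unfolding U_def by auto
    have "r - d x0 x \<le> d w x" using triangle'[OF x0 xO(1) wM(1)] \<open>r \<le> d x0 w\<close> by linarith
    then have "s * (r - d x0 x) \<le> s * (m / (2 * s))" using x(2) s by (intro mult_left_mono) auto
    also have "\<dots> = m / 2" using s by simp
    finally have "u x - cone s x \<le> m / 2" using uC[OF xO(2)] unfolding u_def cone_def by linarith
    then show False using xO(3) \<theta> m by linarith
  qed
  show "u w - cone s w = m - \<theta>"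
  proof (rule antisym)
    show "u w - cone s w \<le> m - \<theta>" using w\<Omega> wM(2) unfolding U_def by (simp add: not_less)
    show "m - \<theta> \<le> u w - cone s w"
    proof (rule field_le_epsilon)
      fix \<eta> :: real assume \<eta>: "0 < \<eta>"
      obtain x where x: "x \<in> U" "d w x < \<eta> / (C0 + s)" using lim[of "\<eta> / (C0 + s)"] \<eta> C0 s by auto
      have xO: "x \<in> M" "m - \<theta> < u x - cone s x" using x unfolding U_def by auto
      have "(C0 + s) * d x w \<le> \<eta>" using x(2) C0 s by (simp add: field_simps commute)
      then show "m - \<theta> \<le> u w - cone s w + \<eta>" using excess_lip[OF xO(1) wM(1)] xO(2) by linarith
    qed
  qed
qed

text \<open>Take the median \<open>q\<close> of \<open>p\<close> and the two values. If it is one of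
  them, they lie on one segment from \<open>p\<close>, and their distance is a difference of values
  of \<open>u\<close>, hence of the cone. Otherwise \<open>q\<close> is a branch point, as the
  existential premise in \<open>IH\<close> records, and \<open>cross_pair\<close> applies to the two
  components at \<open>q\<close>.\<close>

lemma lips_bd:
  assumes IH: "\<And>q b. q \<in> T \<Longrightarrow> b \<in> T \<Longrightarrow> same p a b \<Longrightarrow> e p b = e p q + e q b \<Longrightarrow> q \<noteq> p \<Longrightarrow> q \<noteq> b \<Longrightarrow>
      \<exists>y\<in>T. q \<noteq> y \<and> e p y = e p q + e q y \<and> e b y = e b q + e q y \<Longrightarrow>
      subh (M - Y) (\<lambda>x. vfun q b (F x))"
  shows "lips s (bd U) F"
  unfolding lips_def
proof (intro conjI ballI)
  show "F z \<in> T" if "z \<in> bd U" for z using that FT unfolding bd_def by blast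
  fix z z' assume zz: "z \<in> bd U" "z' \<in> bd U"
  have zM: "z \<in> M" "z' \<in> M" using zz unfolding bd_def by auto
  note z = bd_U[OF zz(1)] and z' = bd_U[OF zz(2)]
  define A A' where "A = F z" and "A' = F z'"
  have AT: "A \<in> T" "A' \<in> T" unfolding A_def A'_def using FT zM by auto
  have pos: "0 < u z" "0 < u z'" using z(2) z'(2) cone_ge[OF zM(1)] cone_ge[OF zM(2)] \<theta> m by linarith+
  have sA: "same p a A" "u z = e p A" "same p a A'" "u z' = e p A'"
    using pos unfolding u_def vfun_def A_def A'_def by (auto split: if_splits)
  obtain q where q: "q \<in> T" "e p A = e p q + e q A" "e p A' = e p q + e q A'" "e A A' = e A q + e q A'"
    using median[OF pa(1) AT] by blast
  have "same p A A'" using same_trans[OF pa AT(1)] sA same_sym pa AT by (metis same_trans)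
  then have qp: "q \<noteq> p" using q(4) unfolding same_def by auto
  have "e A A' \<le> s * d z z'"
  proof (cases "q = A \<or> q = A'")
    case True
    then have "e A A' = e p A' - e p A \<or> e A A' = e p A - e p A'"
      using q AT tr.commute[of A A'] by auto
    then have "e A A' = cone s z' - cone s z \<or> e A A' = cone s z - cone s z'" using sA z(2) z'(2) by linarith
    then show ?thesis
      using cone_lip[OF less_imp_le[OF s] zM] cone_lip[OF less_imp_le[OF s] zM(2,1)] by (auto simp: commute)
  next
    case False
    have "branch q A"
      unfolding branch_def
    proof (intro conjI ballI impI)
      show "subh (M - Y) (\<lambda>x. vfun q A (F x))"
        using IH[OF q(1) AT(1) sA(1) q(2) qp] False q AT by blast
      fix w assume w: "w \<in> T" "0 < vfun q A w"
      then have "same q A w" unfolding vfun_def by (auto split: if_splits)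
      then show "vfun p a w = e p q + vfun q A w"
        using branch_extends[OF pa q(1) AT(1) w(1) sA(1) q(2) qp] unfolding vfun_def by simp
    qed (use q AT in auto)
    moreover have "branch q A'"
      unfolding branch_def
    proof (intro conjI ballI impI)
      have "e A' A = e A' q + e q A" using q(4) by (simp add: tr.commute)
      then show "subh (M - Y) (\<lambda>x. vfun q A' (F x))"
        using IH[OF q(1) AT(2) sA(3) q(3) qp] False q AT by blast
      fix w assume w: "w \<in> T" "0 < vfun q A' w"
      then have "same q A' w" unfolding vfun_def by (auto split: if_splits)
      then show "vfun p a w = e p q + vfun q A' w"
        using branch_extends[OF pa q(1) AT(2) w(1) sA(3) q(3) qp] unfolding vfun_def by simp
    qed (use q AT in auto)
    ultimately show ?thesis
      using False z z' q(4) by (intro cross_pair) (auto simp: A_def A'_def)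
  qed
  then show "e (F z) (F z') \<le> s * d z z'" unfolding A_def A'_def .
qed

text \<open>Extending \<open>F\<close> from the boundary of \<open>U\<close> with constant
  \<open>s\<close> gives an admissible competitor, so minimality makes \<open>F\<close> itself
  \<open>s\<close>-Lipschitz up to the boundary. Towards \<open>x0\<close> the cone falls at almost
  the full rate \<open>s\<close>, so no point of \<open>U\<close> can have a larger excess than the
  boundary.\<close>

lemma not_abs_minimal:
  assumes lip: "lips s (bd U) F" and sup: "\<exists>x\<in>\<Omega>. m - \<theta> < u x - cone s x"
  shows "\<not> abs_minimal F"
proof
  assume am: "abs_minimal F"
  obtain y where y: "y \<in> U" using sup unfolding U_def by blast
  have x0U: "x0 \<in> M - U" using U_sub x0 by blast
  have bdM: "bd U \<subseteq> M" unfolding bd_def by blast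
  obtain w0 where w0: "w0 \<in> bd U" using bd_crossing[OF U_open y x0U zero_less_one] by blast
  then have "\<exists>g. (\<forall>x\<in>M. g x \<in> T) \<and> (\<forall>y\<in>bd U. g y = F y) \<and> (\<forall>x\<in>M. \<forall>y\<in>M. e (g x) (g y) \<le> s * d x y)"
    using lip s unfolding lips_def by (intro lipschitz_extension[OF Metric_space_axioms bdM]) auto
  then obtain g where g: "\<And>x. x \<in> M \<Longrightarrow> g x \<in> T" "\<And>y. y \<in> bd U \<Longrightarrow> g y = F y"
    "\<And>x y. x \<in> M \<Longrightarrow> y \<in> M \<Longrightarrow> e (g x) (g y) \<le> s * d x y" by blast
  define h where "h x = (if x \<in> U then g x else F x)" for x
  define K where "K = max s C0"
  have K: "0 < K" "s \<le> K" "C0 \<le> K" unfolding K_def using s by auto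
  have hT: "h x \<in> T" if "x \<in> M" for x unfolding h_def using that g FT by auto
  have mixed: "e (h x) (h z) \<le> K * d x z" if x: "x \<in> U" and z: "z \<in> M - U" for x z
  proof (rule field_le_epsilon)
    fix \<eta> :: real assume "0 < \<eta>"
    then obtain w where w: "w \<in> bd U" "d x w + d w z \<le> d x z + \<eta> / K"
      using bd_crossing[OF U_open x z, of "\<eta> / K"] K by auto
    have M: "x \<in> M" "w \<in> M" "z \<in> M" using x z w bdM U_sub by auto
    have "e (h x) (h z) \<le> e (g x) (g w) + e (F w) (F z)"
      using tr.triangle[of "g x" "g w" "F z"] g(1,2) w FT M x z unfolding h_def by auto
    also have "\<dots> \<le> s * d x w + C0 * d w z" using g(3)[OF M(1,2)] F_lip[OF M(2,3)] by linarith
    also have "\<dots> \<le> K * d x w + K * d w z" using K by (intro add_mono mult_right_mono) auto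
    also have "\<dots> \<le> K * (d x z + \<eta> / K)" using w(2) K by (simp add: distrib_left[symmetric])
    finally show "e (h x) (h z) \<le> K * d x z + \<eta>" using K by (simp add: distrib_left)
  qed
  have "e (h x) (h z) \<le> K * d x z" if xz: "x \<in> M" "z \<in> M" for x z
  proof -
    consider "x \<in> U" "z \<in> U" | "x \<in> U" "z \<notin> U" | "x \<notin> U" "z \<in> U" | "x \<notin> U" "z \<notin> U" by blast
    then show ?thesis
    proof cases
      case 1
      then show ?thesis using g(3)[OF xz] mult_right_mono[OF K(2) nonneg[of x z]] unfolding h_def by simp
    next
      case 2
      then show ?thesis using mixed xz by blast
    next
      case 3
      then show ?thesis using mixed[of z x] xz by (simp add: commute tr.commute)
    next
      case 4
      then show ?thesis using F_lip[OF xz] mult_right_mono[OF K(3) nonneg[of x z]] unfolding h_def by simp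
    qed
  qed
  then have "lips K M h" unfolding lips_def using hT by blast
  moreover have "lips s U h" unfolding lips_def h_def using g(1,3) U_sub(1) by (simp add: subset_iff)
  moreover have "\<forall>x\<in>M - U. h x = F x" unfolding h_def by auto
  ultimately have FU: "lips s U F"
    using am U_open U_sub(2) s unfolding abs_minimal_def by (meson less_imp_le)
  define \<gamma> where "\<gamma> = (u y - cone s y) - (m - \<theta>)"
  have \<gamma>: "0 < \<gamma>" using y unfolding U_def \<gamma>_def by simp
  then obtain w where w: "w \<in> bd U" "d y w + d w x0 \<le> d y x0 + \<gamma> / (2 * s)"
    using bd_crossing[OF U_open y x0U, of "\<gamma> / (2 * s)"] s by auto
  have M: "y \<in> M" "w \<in> M" using y w U_sub bdM by auto
  have "e (F y) (F w) \<le> s * d y w" using lips_closure[OF F FU U_sub(1) _ _ less_imp_le[OF s]] y w by blast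
  then have "u y - u w \<le> s * d y w" using vfun_lip[OF pa FT[OF M(1)] FT[OF M(2)]] unfolding u_def by linarith
  moreover have "s * (d y w + d w x0) \<le> s * (d y x0 + \<gamma> / (2 * s))" using w(2) s by (intro mult_left_mono) auto
  then have "s * d y w + s * d x0 w \<le> s * d x0 y + \<gamma> / 2" using s by (simp add: distrib_left commute)
  moreover have "cone s w - cone s y = s * d x0 w - s * d x0 y" unfolding cone_def by (simp add: algebra_simps)
  ultimately have "\<gamma> \<le> \<gamma> / 2" using bd_U(2)[OF w(1)] unfolding \<gamma>_def by linarith
  then show False using \<gamma> by simp
qed

end

context tree_valued
begin

text \<open>Induction on the number of branch points in the component of \<open>T - {p}\<close> that contains \<open>a\<close>.\<close>

lemma abs_minimal_imp_subh_vfun: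
  assumes am: "abs_minimal F" and "p \<in> T" "a \<in> T"
  shows "subh (M - Y) (\<lambda>x. vfun p a (F x))"
proof -
  obtain C1 where "lips C1 M F" using am unfolding abs_minimal_def by blast
  then obtain C0 where C0: "0 < C0" "lips C0 M F" using lips_pos by blast
  note FT = lipsD(1)[OF C0(2)]
  obtain B where B: "finite B" and br': "\<forall>p\<in>T. \<forall>x\<in>T. \<forall>y\<in>T. \<forall>q\<in>T.
      q \<noteq> p \<longrightarrow> q \<noteq> x \<longrightarrow> q \<noteq> y \<longrightarrow> e p x = e p q + e q x \<longrightarrow> e p y = e p q + e q y \<longrightarrow>
      e x y = e x q + e q y \<longrightarrow> q \<in> B"
    using finite_branching by (elim exE conjE)
  have br: "q \<in> B" if "p \<in> T" "x \<in> T" "y \<in> T" "q \<in> T" "q \<noteq> p" "q \<noteq> x" "q \<noteq> y"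
    "e p x = e p q + e q x" "e p y = e p q + e q y" "e x y = e x q + e q y" for p x y q
    using br'[rule_format, OF that] .
  define N where "N p a = {b\<in>B. b \<in> T \<and> same p a b}" for p a
  have fN: "finite (N p a)" for p a unfolding N_def using B by simp
  show ?thesis
    using assms(2,3)
  proof (induction "card (N p a)" arbitrary: p a rule: less_induct)
    case less
    note pa = less.prems
    let ?u = "\<lambda>x. vfun p a (F x)"
    obtain D where D: "\<And>x y. x \<in> T \<Longrightarrow> y \<in> T \<Longrightarrow> e x y \<le> D" using bounded by blast
    have uD: "?u x \<le> D" if "x \<in> M" for x
    proof -
      have "e p (F x) \<le> D" "0 \<le> D" using D[OF pa(1) FT[OF that]] tr.nonneg[of p "F x"] by linarith+
      then show ?thesis unfolding vfun_def by simp
    qed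
    show ?case
      unfolding subh_def
    proof (intro ballI allI impI, rule ccontr)
      fix x0 R y0 assume x0: "x0 \<in> M" and R: "0 < R" and ball: "mball x0 (3 * R) \<subseteq> M - Y"
        and y0: "y0 \<in> mball x0 R" and neg: "\<not> 2 * ?u y0 \<le> ?u x0 + spr ?u x0 (2 * R)"
      \<comment> \<open>The cone interpolates between \<open>?u x0\<close> at the center and
        \<open>C\<close> at radius \<open>r\<close>. Failure of the inequality means that
        \<open>?u y0\<close> exceeds the mean of these values, hence the cone at a distance below
        \<open>R\<close>.\<close>
      define r where "r = 2 * R"
      define C where "C = spr ?u x0 r"
      define s where "s = (C - ?u x0) / r"
      have r: "0 < r" unfolding r_def using R by simp
      have uC: "?u x \<le> C" if "x \<in> mball x0 r" for x
        using that spr_upper[of ?u D, OF uD x0] unfolding C_def by auto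
      have sr: "s * r = C - ?u x0" unfolding s_def using r by simp
      have y0': "y0 \<in> M" "d x0 y0 < R" "y0 \<in> mball x0 r" using y0 R unfolding r_def by auto
      have neg': "?u x0 + C < 2 * ?u y0" using neg unfolding C_def r_def by simp
      have "?u x0 < C" using neg' uC[OF y0'(3)] by linarith
      then have s: "0 < s" unfolding s_def using r by simp
      define ex where "ex x = ?u x - (C - s * (r - d x0 x))" for x
      have ex_le: "ex x \<le> s * r" if "x \<in> mball x0 r" for x
        using uC[OF that] mult_nonneg_nonneg[OF less_imp_le[OF s] nonneg[of x0 x]] unfolding ex_def
        by (simp add: algebra_simps)
      define m where "m = (SUP x\<in>mball x0 r. ex x)"
      have bdd: "bdd_above (ex ` mball x0 r)" using ex_le by (intro bdd_aboveI2)
      have exm: "ex x \<le> m" if "x \<in> mball x0 r" for x unfolding m_def using that bdd by (rule cSUP_upper)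
      have ne: "mball x0 r \<noteq> {}" using y0'(3) by blast
      have "m \<le> s * r" unfolding m_def using ne ex_le by (rule cSUP_least)
      moreover have "0 < m"
      proof -
        have "s * (r - d x0 y0) \<ge> s * R" using y0' s unfolding r_def by (intro mult_left_mono) auto
        moreover have "2 * (s * R) = C - ?u x0" using sr unfolding r_def by simp
        ultimately have "0 < ex y0" using neg' unfolding ex_def by linarith
        then show ?thesis using exm[OF y0'(3)] by linarith
      qed
      moreover have "mball x0 r \<subseteq> M - Y" using ball R mball_subset_concentric[of r "3 * R" x0] unfolding r_def by auto
      ultimately interpret fb: failing_ball M d T e Y F C0 p a x0 r C s m
        using C0 pa x0 r uC s sr exm unfolding ex_def by unfold_locales auto
      have "lips s (bd fb.U) F"
      proof (rule fb.lips_bd)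
        fix q b assume q: "q \<in> T" "b \<in> T" "same p a b" "e p b = e p q + e q b" "q \<noteq> p" "q \<noteq> b"
          "\<exists>y\<in>T. q \<noteq> y \<and> e p y = e p q + e q y \<and> e b y = e b q + e q y"
        then obtain y where y: "y \<in> T" "q \<noteq> y" "e p y = e p q + e q y" "e b y = e b q + e q y" by blast
        have qB: "q \<in> B" using br[OF pa(1) q(2) y(1) q(1,5,6) y(2) q(4) y(3,4)] .
        have pq: "0 < e p q" using q pa by auto
        \<comment> \<open>Passing from \<open>p\<close> to \<open>q\<close> adds no branch point and
          loses \<open>q\<close> itself.\<close>
        have "N q b \<subseteq> N p a"
          unfolding N_def using branch_extends(2)[OF pa q(1,2) _ q(3,4,5)] by blast
        moreover have "q \<notin> N q b" unfolding N_def same_def using q(1) by simp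
        moreover have "same p b q" using q(4) pq tr.commute[of b q] tr.commute[of b p] unfolding same_def by linarith
        then have "q \<in> N p a" unfolding N_def using qB q same_trans pa by blast
        ultimately have "card (N q b) < card (N p a)" by (intro psubset_card_mono fN) blast
        then show "subh (M - Y) (\<lambda>x. vfun q b (F x))" using less.hyps q by blast
      qed
      moreover have "\<exists>x\<in>mball x0 r. m - fb.\<theta> < fb.u x - fb.cone s x"
      proof -
        have "m - fb.\<theta> < (SUP x\<in>mball x0 r. ex x)" using fb.\<theta>(1) unfolding m_def by simp
        then show ?thesis using less_cSUP_iff[OF ne bdd] unfolding ex_def fb.u_def fb.cone_def by blast
      qed
      ultimately show False using fb.not_abs_minimal am by blast
    qed
  qed
qed

text \<open>For given \<open>y\<close> use the component containing \<open>F y\<close>: its function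
  is at most the full distance everywhere and equal to it at \<open>y\<close>.\<close>

theorem abs_minimal_imp_subharmonic:
  assumes am: "abs_minimal F"
  shows "subharmonic F"
  unfolding subharmonic_def
proof
  fix t assume t: "t \<in> T"
  obtain C0 where C0: "lips C0 M F" using am unfolding abs_minimal_def by blast
  note FT = lipsD(1)[OF C0]
  obtain D where D: "\<And>x y. x \<in> T \<Longrightarrow> y \<in> T \<Longrightarrow> e x y \<le> D" using bounded by blast
  show "subh (M - Y) (\<lambda>x. e t (F x))"
    unfolding subh_def
  proof (intro ballI allI impI)
    fix x R y assume x: "x \<in> M" and R: "0 < R" and ball: "mball x (3 * R) \<subseteq> M - Y" and y: "y \<in> mball x R"
    let ?v = "\<lambda>z. vfun t (F y) (F z)"
    have yM: "y \<in> M" using y by simp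
    have le: "?v z \<le> e t (F z)" for z unfolding vfun_def by simp
    have "2 * ?v y \<le> ?v x + spr ?v x (2 * R)"
      using abs_minimal_imp_subh_vfun[OF am t FT[OF yM]] x R ball y unfolding subh_def by blast
    moreover have "spr ?v x (2 * R) \<le> spr (\<lambda>z. e t (F z)) x (2 * R)"
    proof (rule spr_least[OF x])
      fix z assume z: "z \<in> M" "d x z < 2 * R"
      have "e t (F z) \<le> spr (\<lambda>z. e t (F z)) x (2 * R)"
        by (rule spr_upper[of _ D]) (use D t FT x z in auto)
      then show "?v z \<le> spr (\<lambda>z. e t (F z)) x (2 * R)" using le[of z] by linarith
    qed (use R in simp)
    moreover have "?v y = e t (F y)" using vfun_self t FT[OF yM] by blast
    ultimately show "2 * e t (F y) \<le> e t (F x) + spr (\<lambda>z. e t (F z)) x (2 * R)" using le[of x] by linarith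
  qed
qed

end

section \<open>Gluing an interval to a tree\<close>

lemma (in Metric_space) mcompleteI:
  assumes "\<And>\<sigma>. range \<sigma> \<subseteq> M \<Longrightarrow> MCauchy \<sigma> \<Longrightarrow> \<exists>l\<in>M. (\<lambda>n. d (\<sigma> n) l) \<longlonglongrightarrow> 0"
  shows "mcomplete"
  unfolding mcomplete_def
proof (intro allI impI)
  fix \<sigma> assume c: "MCauchy \<sigma>"
  then have r: "range \<sigma> \<subseteq> M" unfolding MCauchy_def by blast
  then obtain l where "l \<in> M" "(\<lambda>n. d (\<sigma> n) l) \<longlonglongrightarrow> 0" using assms c by blast
  then have "limitin mtopology \<sigma> l sequentially"
    unfolding limitin_metric_dist_null using r by (auto intro!: always_eventually)
  then show "\<exists>x. limitin mtopology \<sigma> x sequentially" by blast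
qed

lemma (in Metric_space) mcompleteD:
  assumes "mcomplete" "MCauchy \<sigma>" obtains l where "l \<in> M" "(\<lambda>n. d (\<sigma> n) l) \<longlonglongrightarrow> 0"
  using assms unfolding mcomplete_def limitin_metric_dist_null by blast

lemma rtree_isometry:
  assumes S: "rtree S \<delta>" and \<phi>: "bij_betw \<phi> S T" and T: "Metric_space T e"
    and iso: "\<And>p q. p \<in> S \<Longrightarrow> q \<in> S \<Longrightarrow> e (\<phi> p) (\<phi> q) = \<delta> p q"
  shows "rtree T e"
proof -
  interpret S: rtree S \<delta> by fact
  interpret T: Metric_space T e by fact
  define \<psi> where "\<psi> = inv_into S \<phi>"
  have \<psi>: "\<psi> x \<in> S" "\<phi> (\<psi> x) = x" if "x \<in> T" for x
    using \<phi> that unfolding \<psi>_def bij_betw_def by (auto simp: inv_into_into f_inv_into_f)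
  have \<phi>T: "\<phi> p \<in> T" if "p \<in> S" for p using \<phi> that bij_betwE by blast
  have e\<psi>: "e x y = \<delta> (\<psi> x) (\<psi> y)" if "x \<in> T" "y \<in> T" for x y
    using iso[of "\<psi> x" "\<psi> y"] \<psi> that by simp
  show ?thesis
  proof (intro rtree.intro rtree_axioms.intro T)
    fix a b t assume "a \<in> T" "b \<in> T" "0 \<le> t" "t \<le> e a b"
    then obtain c where c: "c \<in> S" "\<delta> (\<psi> a) c = t" "\<delta> c (\<psi> b) = \<delta> (\<psi> a) (\<psi> b) - t"
      using S.geodesic[of "\<psi> a" "\<psi> b" t] \<psi> e\<psi> by auto
    then show "\<exists>c\<in>T. e a c = t \<and> e c b = e a b - t"
      using iso[of "\<psi> a" c] iso[of c "\<psi> b"] \<psi> \<phi>T e\<psi> \<open>a \<in> T\<close> \<open>b \<in> T\<close> by (intro bexI[of _ "\<phi> c"]) auto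
  next
    show "e x y + e z w \<le> max (e x z + e y w) (e x w + e y z)" if "x \<in> T" "y \<in> T" "z \<in> T" "w \<in> T" for x y z w
      using S.four_point[of "\<psi> x" "\<psi> y" "\<psi> z" "\<psi> w"] that \<psi> e\<psi> by simp
    show "\<exists>D. \<forall>x\<in>T. \<forall>y\<in>T. e x y \<le> D" using S.bounded \<psi> e\<psi> by metis
    show "T.mcomplete"
    proof (rule T.mcompleteI)
      fix \<sigma> :: "nat \<Rightarrow> 'b" assume r: "range \<sigma> \<subseteq> T" and c: "T.MCauchy \<sigma>"
      have \<sigma>T: "\<sigma> n \<in> T" for n using r by auto
      have "S.tr.MCauchy (\<lambda>n. \<psi> (\<sigma> n))"
        using c \<sigma>T \<psi> unfolding T.MCauchy_def S.tr.MCauchy_def by (auto simp: e\<psi>)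
      then obtain l where l: "l \<in> S" "(\<lambda>n. \<delta> (\<psi> (\<sigma> n)) l) \<longlonglongrightarrow> 0" using S.tr.mcompleteD S.complete by blast
      have "e (\<sigma> n) (\<phi> l) = \<delta> (\<psi> (\<sigma> n)) l" for n using iso[of "\<psi> (\<sigma> n)" l] \<psi> \<sigma>T l by simp
      then show "\<exists>l\<in>T. (\<lambda>n. e (\<sigma> n) l) \<longlonglongrightarrow> 0" using l \<phi>T by (intro bexI[of _ "\<phi> l"]) auto
    qed
    obtain B where B: "finite B" "\<forall>p\<in>S. \<forall>x\<in>S. \<forall>y\<in>S. \<forall>q\<in>S. q \<noteq> p \<longrightarrow> q \<noteq> x \<longrightarrow> q \<noteq> y \<longrightarrow>
      \<delta> p x = \<delta> p q + \<delta> q x \<longrightarrow> \<delta> p y = \<delta> p q + \<delta> q y \<longrightarrow> \<delta> x y = \<delta> x q + \<delta> q y \<longrightarrow> q \<in> B"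
      using S.finite_branching by (elim exE conjE)
    show "\<exists>B. finite B \<and> (\<forall>p\<in>T. \<forall>x\<in>T. \<forall>y\<in>T. \<forall>q\<in>T. q \<noteq> p \<longrightarrow> q \<noteq> x \<longrightarrow> q \<noteq> y \<longrightarrow>
      e p x = e p q + e q x \<longrightarrow> e p y = e p q + e q y \<longrightarrow> e x y = e x q + e q y \<longrightarrow> q \<in> B)"
    proof (intro exI[of _ "\<phi> ` B"] conjI ballI impI)
      fix p x y q assume T: "p \<in> T" "x \<in> T" "y \<in> T" "q \<in> T" and "q \<noteq> p" "q \<noteq> x" "q \<noteq> y"
        and e: "e p x = e p q + e q x" "e p y = e p q + e q y" "e x y = e x q + e q y"
      then have "\<psi> q \<noteq> \<psi> p" "\<psi> q \<noteq> \<psi> x" "\<psi> q \<noteq> \<psi> y" using \<psi>(2) by metis+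
      then have "\<psi> q \<in> B"
        using B(2)[rule_format, OF \<psi>(1)[OF T(1)] \<psi>(1)[OF T(2)] \<psi>(1)[OF T(3)] \<psi>(1)[OF T(4)]] e T by (simp add: e\<psi>)
      then show "q \<in> \<phi> ` B" using \<psi>(2)[OF T(4)] by force
    qed (use B in simp)
  qed
qed

text \<open>\<open>I\<close> is a half-open interval attached at \<open>c\<close>, and
  \<open>h\<close> is the distance from \<open>c\<close> along it. \<open>out\<close> fixes values
  off the set because \<open>Metric_space\<close> demands nonnegativity and symmetry
  everywhere.\<close>

lemma rtree_glue:
  fixes S :: "'c set" and \<delta> :: "'c \<Rightarrow> 'c \<Rightarrow> real" and h :: "'c \<Rightarrow> real"
  assumes S: "rtree S \<delta>" and c: "c \<in> S" and disj: "S \<inter> I = {}" and h: "bij_betw h I {0<..l}"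
    and \<delta>'_def: "\<And>x y. x \<in> S \<union> I \<Longrightarrow> y \<in> S \<union> I \<Longrightarrow> \<delta>' x y = (if x \<in> I \<and> y \<in> I then \<bar>h x - h y\<bar>
      else if x \<in> I then \<delta> c y + h x else if y \<in> I then \<delta> x c + h y else \<delta> x y)"
    and out: "\<And>x y. x \<notin> S \<union> I \<or> y \<notin> S \<union> I \<Longrightarrow> \<delta>' x y = 0"
  shows "rtree (S \<union> I) \<delta>'"
proof -
  interpret S: rtree S \<delta> by fact
  have SS: "\<delta>' x y = \<delta> x y" if "x \<in> S" "y \<in> S" for x y using \<delta>'_def that disj by auto
  have SI: "\<delta>' x y = \<delta> x c + h y" if "x \<in> S" "y \<in> I" for x y using \<delta>'_def that disj by auto
  have IS: "\<delta>' y x = \<delta> x c + h y" if "x \<in> S" "y \<in> I" for x y using \<delta>'_def that disj by (auto simp: S.tr.commute)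
  have II: "\<delta>' x y = \<bar>h x - h y\<bar>" if "x \<in> I" "y \<in> I" for x y using \<delta>'_def that by auto
  note simps = SS SI IS II
  have hpos: "0 < h x" "h x \<le> l" if "x \<in> I" for x using h that bij_betwE by fastforce+
  have hinj: "h x = h y \<longleftrightarrow> x = y" if "x \<in> I" "y \<in> I" for x y
    using h that unfolding bij_betw_def inj_on_def by blast
  have hinv: "\<exists>x\<in>I. h x = t" if "0 < t" "t \<le> l" for t
    using h that unfolding bij_betw_def by (metis greaterThanAtMost_iff imageE)
  have tri: "\<delta> x z \<le> \<delta> x y + \<delta> y z" "\<delta> x z \<le> \<delta> x y + \<delta> z y" "\<delta> x z \<le> \<delta> y x + \<delta> y z" "\<delta> x z \<le> \<delta> y x + \<delta> z y"
    if "x \<in> S" "y \<in> S" "z \<in> S" for x y z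
    using S.tr.triangle[OF that] S.tr.commute[of x y] S.tr.commute[of y z] by auto
  interpret T: Metric_space "S \<union> I" \<delta>'
  proof
    fix x y
    show "0 \<le> \<delta>' x y"
    proof (cases "x \<in> S \<union> I \<and> y \<in> S \<union> I")
      case True
      then show ?thesis using hpos S.tr.nonneg by (fastforce simp: simps intro: add_nonneg_nonneg less_imp_le)
    qed (use out in auto)
    show "\<delta>' x y = \<delta>' y x"
    proof (cases "x \<in> S \<union> I \<and> y \<in> S \<union> I")
      case True
      then show ?thesis by (auto simp: simps S.tr.commute)
    qed (use out in auto)
  next
    fix x y assume "x \<in> S \<union> I" "y \<in> S \<union> I"
    then consider "x \<in> S" "y \<in> S" | "x \<in> S" "y \<in> I" | "x \<in> I" "y \<in> S" | "x \<in> I" "y \<in> I" by blast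
    then show "\<delta>' x y = 0 \<longleftrightarrow> x = y"
    proof cases
      case 2
      then have "0 < \<delta>' x y" using hpos[of y] S.tr.nonneg[of x c] by (simp add: simps add_nonneg_pos)
      then show ?thesis using 2 disj by auto
    next
      case 3
      then have "0 < \<delta>' x y" using hpos[of x] S.tr.nonneg[of y c] by (simp add: simps add_nonneg_pos)
      then show ?thesis using 3 disj by auto
    qed (auto simp: simps hinj)
  next
    fix x y z assume xyz: "x \<in> S \<union> I" "y \<in> S \<union> I" "z \<in> S \<union> I"
    consider "x \<in> S" "y \<in> S" "z \<in> S" | "x \<in> S" "y \<in> S" "z \<in> I" | "x \<in> S" "y \<in> I" "z \<in> S" | "x \<in> S" "y \<in> I" "z \<in> I"
      | "x \<in> I" "y \<in> S" "z \<in> S" | "x \<in> I" "y \<in> S" "z \<in> I" | "x \<in> I" "y \<in> I" "z \<in> S" | "x \<in> I" "y \<in> I" "z \<in> I"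
      using xyz by blast
    then show "\<delta>' x z \<le> \<delta>' x y + \<delta>' y z"
    proof cases
      case 1 then show ?thesis using tri(1)[of x y z] by (simp add: simps)
    next
      case 2 then show ?thesis using tri(1)[of x y c] c by (simp add: simps)
    next
      case 3 then show ?thesis using tri(2)[of x c z] hpos[of y] c by (simp add: simps)
    next
      case 4 then show ?thesis by (simp add: simps)
    next
      case 5 then show ?thesis using tri(4)[of c y z] tri(3)[of z y c] c by (simp add: simps S.tr.commute)
    next
      case 6 then show ?thesis using S.tr.nonneg[of y c] hpos[of x] hpos[of z] by (simp add: simps abs_if)
    next
      case 7 then show ?thesis by (simp add: simps)
    next
      case 8 then show ?thesis by (simp add: simps)
    qed
  qed
  obtain D where D: "\<And>x y. x \<in> S \<Longrightarrow> y \<in> S \<Longrightarrow> \<delta> x y \<le> D" using S.bounded by blast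
  have D0: "0 \<le> D" using D[OF c c] S.tr.nonneg[of c c] by linarith
  show ?thesis
  proof (intro rtree.intro rtree_axioms.intro)
    show "Metric_space (S \<union> I) \<delta>'" by (rule T.Metric_space_axioms)
    have mixed: "\<exists>z\<in>S \<union> I. \<delta>' x z = r \<and> \<delta>' z y = \<delta>' x y - r"
      if x: "x \<in> S" and y: "y \<in> I" and r: "0 \<le> r" "r \<le> \<delta>' x y" for x y r
    proof (cases "r \<le> \<delta> x c")
      case True
      then obtain z where "z \<in> S" "\<delta> x z = r" "\<delta> z c = \<delta> x c - r" using S.geodesic[OF x c r(1)] by blast
      then show ?thesis using x y by (intro bexI[of _ z]) (auto simp: simps)
    next
      case False
      have "r - \<delta> x c \<le> h y" using r x y by (simp add: simps)
      moreover have "r - \<delta> x c \<le> l" using calculation hpos(2)[OF y] by linarith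
      ultimately obtain z where "z \<in> I" "h z = r - \<delta> x c" using hinv[of "r - \<delta> x c"] False by auto
      then show ?thesis using x y \<open>r - \<delta> x c \<le> h y\<close> by (intro bexI[of _ z]) (auto simp: simps)
    qed
    fix x y r assume xy: "x \<in> S \<union> I" "y \<in> S \<union> I" and r: "0 \<le> r" "r \<le> \<delta>' x y"
    then consider "x \<in> S" "y \<in> S" | "x \<in> S" "y \<in> I" | "x \<in> I" "y \<in> S" | "x \<in> I" "y \<in> I" by blast
    then show "\<exists>z\<in>S \<union> I. \<delta>' x z = r \<and> \<delta>' z y = \<delta>' x y - r"
    proof cases
      case 1
      then obtain z where "z \<in> S" "\<delta> x z = r" "\<delta> z y = \<delta> x y - r" using S.geodesic[of x y r] r by (auto simp: simps)
      then show ?thesis using 1 by (intro bexI[of _ z]) (auto simp: simps)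
    next
      case 2
      then show ?thesis using mixed r by blast
    next
      case 3
      then obtain z where "z \<in> S \<union> I" "\<delta>' y z = \<delta>' y x - r" "\<delta>' z x = \<delta>' y x - (\<delta>' y x - r)"
        using mixed[of y x "\<delta>' y x - r"] r T.commute[of x y] by auto
      then show ?thesis by (intro bexI[of _ z]) (auto simp: T.commute)
    next
      case 4
      define t where "t = (if h x \<le> h y then h x + r else h x - r)"
      have t: "min (h x) (h y) \<le> t" "t \<le> max (h x) (h y)" unfolding t_def using r 4 by (auto simp: simps abs_if split: if_splits)
      then have "0 < t" "t \<le> l" using hpos[of x] hpos[of y] 4 by (auto simp: min_def max_def split: if_splits)
      then obtain z where z: "z \<in> I" "h z = t" using hinv by blast
      then show ?thesis using 4 r unfolding t_def
        by (intro bexI[of _ z]) (auto simp: simps abs_if split: if_splits)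
    qed
  next
    fix x y z w assume m: "x \<in> S \<union> I" "y \<in> S \<union> I" "z \<in> S \<union> I" "w \<in> S \<union> I"
    \<comment> \<open>In each of the 16 positions the distances reduce to those of \<open>S\<close>,
      with \<open>c\<close> for points of \<open>I\<close>, plus heights; an inequality in
      \<open>S\<close> or among real numbers remains.\<close>
    have c1: "\<delta>' x y + \<delta>' z w \<le> max (\<delta>' x z + \<delta>' y w) (\<delta>' x w + \<delta>' y z)"
      if 1: "x \<in> S" "y \<in> S" "z \<in> S" "w \<in> S"
    proof -
      from 1 have E: "\<delta>' x y = \<delta> x y" "\<delta>' z w = \<delta> z w" "\<delta>' x z = \<delta> x z"
          "\<delta>' y w = \<delta> y w" "\<delta>' x w = \<delta> x w" "\<delta>' y z = \<delta> y z"
        by (simp_all add: simps)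
      have "\<delta> x y + \<delta> z w \<le> max (\<delta> x z + \<delta> y w) (\<delta> x w + \<delta> y z)"
        by (rule S.four_point) (use 1 c in auto)
      then show ?thesis unfolding E using S.tr.commute[of x z] S.tr.commute[of y z] S.tr.commute[of x w] S.tr.commute[of y w]
        by linarith
    qed
    have c2: "\<delta>' x y + \<delta>' z w \<le> max (\<delta>' x z + \<delta>' y w) (\<delta>' x w + \<delta>' y z)"
      if 2: "x \<in> S" "y \<in> S" "z \<in> S" "w \<in> I"
    proof -
      from 2 have E: "\<delta>' x y = \<delta> x y" "\<delta>' z w = \<delta> z c + h w" "\<delta>' x z = \<delta> x z"
          "\<delta>' y w = \<delta> y c + h w" "\<delta>' x w = \<delta> x c + h w" "\<delta>' y z = \<delta> y z"
        by (simp_all add: simps)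
      have "\<delta> x y + \<delta> z c \<le> max (\<delta> x z + \<delta> y c) (\<delta> x c + \<delta> y z)"
        by (rule S.four_point) (use 2 c in auto)
      then show ?thesis unfolding E using hpos(1)[OF 2(4)] S.tr.commute[of x z] S.tr.commute[of y z] S.tr.commute[of x w] S.tr.commute[of y w]
        by linarith
    qed
    have c3: "\<delta>' x y + \<delta>' z w \<le> max (\<delta>' x z + \<delta>' y w) (\<delta>' x w + \<delta>' y z)"
      if 3: "x \<in> S" "y \<in> S" "z \<in> I" "w \<in> S"
    proof -
      from 3 have E: "\<delta>' x y = \<delta> x y" "\<delta>' z w = \<delta> w c + h z" "\<delta>' x z = \<delta> x c + h z"
          "\<delta>' y w = \<delta> y w" "\<delta>' x w = \<delta> x w" "\<delta>' y z = \<delta> y c + h z"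
        by (simp_all add: simps)
      have "\<delta> x y + \<delta> w c \<le> max (\<delta> x w + \<delta> y c) (\<delta> x c + \<delta> y w)"
        by (rule S.four_point) (use 3 c in auto)
      then show ?thesis unfolding E using hpos(1)[OF 3(3)] S.tr.commute[of x z] S.tr.commute[of y z] S.tr.commute[of x w] S.tr.commute[of y w]
        by linarith
    qed
    have c4: "\<delta>' x y + \<delta>' z w \<le> max (\<delta>' x z + \<delta>' y w) (\<delta>' x w + \<delta>' y z)"
      if 4: "x \<in> S" "y \<in> S" "z \<in> I" "w \<in> I"
    proof -
      from 4 have E: "\<delta>' x y = \<delta> x y" "\<delta>' z w = \<bar>h z - h w\<bar>" "\<delta>' x z = \<delta> x c + h z"
          "\<delta>' y w = \<delta> y c + h w" "\<delta>' x w = \<delta> x c + h w" "\<delta>' y z = \<delta> y c + h z"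
        by (simp_all add: simps)
      have "\<delta> x y \<le> \<delta> x c + \<delta> y c"
        by (rule tri(2)) (use 4 c in auto)
      then show ?thesis unfolding E using hpos(1)[OF 4(3)] hpos(1)[OF 4(4)]
        by linarith
    qed
    have c5: "\<delta>' x y + \<delta>' z w \<le> max (\<delta>' x z + \<delta>' y w) (\<delta>' x w + \<delta>' y z)"
      if 5: "x \<in> S" "y \<in> I" "z \<in> S" "w \<in> S"
    proof -
      from 5 have E: "\<delta>' x y = \<delta> x c + h y" "\<delta>' z w = \<delta> z w" "\<delta>' x z = \<delta> x z"
          "\<delta>' y w = \<delta> w c + h y" "\<delta>' x w = \<delta> x w" "\<delta>' y z = \<delta> z c + h y"
        by (simp_all add: simps)
      have "\<delta> z w + \<delta> x c \<le> max (\<delta> z x + \<delta> w c) (\<delta> z c + \<delta> w x)"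
        by (rule S.four_point) (use 5 c in auto)
      then show ?thesis unfolding E using hpos(1)[OF 5(2)] S.tr.commute[of x z] S.tr.commute[of y z] S.tr.commute[of x w] S.tr.commute[of y w]
        by linarith
    qed
    have c6: "\<delta>' x y + \<delta>' z w \<le> max (\<delta>' x z + \<delta>' y w) (\<delta>' x w + \<delta>' y z)"
      if 6: "x \<in> S" "y \<in> I" "z \<in> S" "w \<in> I"
    proof -
      from 6 have E: "\<delta>' x y = \<delta> x c + h y" "\<delta>' z w = \<delta> z c + h w" "\<delta>' x z = \<delta> x z"
          "\<delta>' y w = \<bar>h y - h w\<bar>" "\<delta>' x w = \<delta> x c + h w" "\<delta>' y z = \<delta> z c + h y"
        by (simp_all add: simps)
      show ?thesis unfolding E using hpos(1)[OF 6(2)] hpos(1)[OF 6(4)]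
        by linarith
    qed
    have c7: "\<delta>' x y + \<delta>' z w \<le> max (\<delta>' x z + \<delta>' y w) (\<delta>' x w + \<delta>' y z)"
      if 7: "x \<in> S" "y \<in> I" "z \<in> I" "w \<in> S"
    proof -
      from 7 have E: "\<delta>' x y = \<delta> x c + h y" "\<delta>' z w = \<delta> w c + h z" "\<delta>' x z = \<delta> x c + h z"
          "\<delta>' y w = \<delta> w c + h y" "\<delta>' x w = \<delta> x w" "\<delta>' y z = \<bar>h y - h z\<bar>"
        by (simp_all add: simps)
      show ?thesis unfolding E using hpos(1)[OF 7(2)] hpos(1)[OF 7(3)]
        by linarith
    qed
    have c8: "\<delta>' x y + \<delta>' z w \<le> max (\<delta>' x z + \<delta>' y w) (\<delta>' x w + \<delta>' y z)"
      if 8: "x \<in> S" "y \<in> I" "z \<in> I" "w \<in> I"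
    proof -
      from 8 have E: "\<delta>' x y = \<delta> x c + h y" "\<delta>' z w = \<bar>h z - h w\<bar>" "\<delta>' x z = \<delta> x c + h z"
          "\<delta>' y w = \<bar>h y - h w\<bar>" "\<delta>' x w = \<delta> x c + h w" "\<delta>' y z = \<bar>h y - h z\<bar>"
        by (simp_all add: simps)
      show ?thesis unfolding E using hpos(1)[OF 8(2)] hpos(1)[OF 8(3)] hpos(1)[OF 8(4)]
        by linarith
    qed
    have c9: "\<delta>' x y + \<delta>' z w \<le> max (\<delta>' x z + \<delta>' y w) (\<delta>' x w + \<delta>' y z)"
      if 9: "x \<in> I" "y \<in> S" "z \<in> S" "w \<in> S"
    proof -
      from 9 have E: "\<delta>' x y = \<delta> y c + h x" "\<delta>' z w = \<delta> z w" "\<delta>' x z = \<delta> z c + h x"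
          "\<delta>' y w = \<delta> y w" "\<delta>' x w = \<delta> w c + h x" "\<delta>' y z = \<delta> y z"
        by (simp_all add: simps)
      have "\<delta> z w + \<delta> y c \<le> max (\<delta> z y + \<delta> w c) (\<delta> z c + \<delta> w y)"
        by (rule S.four_point) (use 9 c in auto)
      then show ?thesis unfolding E using hpos(1)[OF 9(1)] S.tr.commute[of x z] S.tr.commute[of y z] S.tr.commute[of x w] S.tr.commute[of y w]
        by linarith
    qed
    have c10: "\<delta>' x y + \<delta>' z w \<le> max (\<delta>' x z + \<delta>' y w) (\<delta>' x w + \<delta>' y z)"
      if 10: "x \<in> I" "y \<in> S" "z \<in> S" "w \<in> I"
    proof -
      from 10 have E: "\<delta>' x y = \<delta> y c + h x" "\<delta>' z w = \<delta> z c + h w" "\<delta>' x z = \<delta> z c + h x"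
          "\<delta>' y w = \<delta> y c + h w" "\<delta>' x w = \<bar>h x - h w\<bar>" "\<delta>' y z = \<delta> y z"
        by (simp_all add: simps)
      show ?thesis unfolding E using hpos(1)[OF 10(1)] hpos(1)[OF 10(4)]
        by linarith
    qed
    have c11: "\<delta>' x y + \<delta>' z w \<le> max (\<delta>' x z + \<delta>' y w) (\<delta>' x w + \<delta>' y z)"
      if 11: "x \<in> I" "y \<in> S" "z \<in> I" "w \<in> S"
    proof -
      from 11 have E: "\<delta>' x y = \<delta> y c + h x" "\<delta>' z w = \<delta> w c + h z" "\<delta>' x z = \<bar>h x - h z\<bar>"
          "\<delta>' y w = \<delta> y w" "\<delta>' x w = \<delta> w c + h x" "\<delta>' y z = \<delta> y c + h z"
        by (simp_all add: simps)
      show ?thesis unfolding E using hpos(1)[OF 11(1)] hpos(1)[OF 11(3)]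
        by linarith
    qed
    have c12: "\<delta>' x y + \<delta>' z w \<le> max (\<delta>' x z + \<delta>' y w) (\<delta>' x w + \<delta>' y z)"
      if 12: "x \<in> I" "y \<in> S" "z \<in> I" "w \<in> I"
    proof -
      from 12 have E: "\<delta>' x y = \<delta> y c + h x" "\<delta>' z w = \<bar>h z - h w\<bar>" "\<delta>' x z = \<bar>h x - h z\<bar>"
          "\<delta>' y w = \<delta> y c + h w" "\<delta>' x w = \<bar>h x - h w\<bar>" "\<delta>' y z = \<delta> y c + h z"
        by (simp_all add: simps)
      show ?thesis unfolding E using hpos(1)[OF 12(1)] hpos(1)[OF 12(3)] hpos(1)[OF 12(4)]
        by linarith
    qed
    have c13: "\<delta>' x y + \<delta>' z w \<le> max (\<delta>' x z + \<delta>' y w) (\<delta>' x w + \<delta>' y z)"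
      if 13: "x \<in> I" "y \<in> I" "z \<in> S" "w \<in> S"
    proof -
      from 13 have E: "\<delta>' x y = \<bar>h x - h y\<bar>" "\<delta>' z w = \<delta> z w" "\<delta>' x z = \<delta> z c + h x"
          "\<delta>' y w = \<delta> w c + h y" "\<delta>' x w = \<delta> w c + h x" "\<delta>' y z = \<delta> z c + h y"
        by (simp_all add: simps)
      have "\<delta> z w \<le> \<delta> z c + \<delta> w c"
        by (rule tri(2)) (use 13 c in auto)
      then show ?thesis unfolding E using hpos(1)[OF 13(1)] hpos(1)[OF 13(2)]
        by linarith
    qed
    have c14: "\<delta>' x y + \<delta>' z w \<le> max (\<delta>' x z + \<delta>' y w) (\<delta>' x w + \<delta>' y z)"
      if 14: "x \<in> I" "y \<in> I" "z \<in> S" "w \<in> I"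
    proof -
      from 14 have E: "\<delta>' x y = \<bar>h x - h y\<bar>" "\<delta>' z w = \<delta> z c + h w" "\<delta>' x z = \<delta> z c + h x"
          "\<delta>' y w = \<bar>h y - h w\<bar>" "\<delta>' x w = \<bar>h x - h w\<bar>" "\<delta>' y z = \<delta> z c + h y"
        by (simp_all add: simps)
      show ?thesis unfolding E using hpos(1)[OF 14(1)] hpos(1)[OF 14(2)] hpos(1)[OF 14(4)]
        by linarith
    qed
    have c15: "\<delta>' x y + \<delta>' z w \<le> max (\<delta>' x z + \<delta>' y w) (\<delta>' x w + \<delta>' y z)"
      if 15: "x \<in> I" "y \<in> I" "z \<in> I" "w \<in> S"
    proof -
      from 15 have E: "\<delta>' x y = \<bar>h x - h y\<bar>" "\<delta>' z w = \<delta> w c + h z" "\<delta>' x z = \<bar>h x - h z\<bar>"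
          "\<delta>' y w = \<delta> w c + h y" "\<delta>' x w = \<delta> w c + h x" "\<delta>' y z = \<bar>h y - h z\<bar>"
        by (simp_all add: simps)
      show ?thesis unfolding E using hpos(1)[OF 15(1)] hpos(1)[OF 15(2)] hpos(1)[OF 15(3)]
        by linarith
    qed
    have c16: "\<delta>' x y + \<delta>' z w \<le> max (\<delta>' x z + \<delta>' y w) (\<delta>' x w + \<delta>' y z)"
      if 16: "x \<in> I" "y \<in> I" "z \<in> I" "w \<in> I"
    proof -
      from 16 have E: "\<delta>' x y = \<bar>h x - h y\<bar>" "\<delta>' z w = \<bar>h z - h w\<bar>" "\<delta>' x z = \<bar>h x - h z\<bar>"
          "\<delta>' y w = \<bar>h y - h w\<bar>" "\<delta>' x w = \<bar>h x - h w\<bar>" "\<delta>' y z = \<bar>h y - h z\<bar>"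
        by (simp_all add: simps)
      show ?thesis unfolding E using hpos(1)[OF 16(1)] hpos(1)[OF 16(2)] hpos(1)[OF 16(3)] hpos(1)[OF 16(4)]
        by linarith
    qed
    show "\<delta>' x y + \<delta>' z w \<le> max (\<delta>' x z + \<delta>' y w) (\<delta>' x w + \<delta>' y z)"
      using m by (elim UnE) (rule c1, assumption+, rule c2, assumption+, rule c3, assumption+, rule c4, assumption+,
        rule c5, assumption+, rule c6, assumption+, rule c7, assumption+, rule c8, assumption+,
        rule c9, assumption+, rule c10, assumption+, rule c11, assumption+, rule c12, assumption+,
        rule c13, assumption+, rule c14, assumption+, rule c15, assumption+, rule c16, assumption+)
  next
    show "\<exists>D. \<forall>x\<in>S \<union> I. \<forall>y\<in>S \<union> I. \<delta>' x y \<le> D"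
    proof (intro exI ballI)
      fix x y assume "x \<in> S \<union> I" "y \<in> S \<union> I"
      then show "\<delta>' x y \<le> D + \<bar>l\<bar>"
        using D[of x y] D[of x c] D[of y c] hpos[of x] hpos[of y] c D0 by (auto simp: simps abs_if)
    qed
  next
    have "Metric_space.mcomplete S \<delta>'"
    proof -
      have subS: "S \<subseteq> S \<union> I" by blast
      interpret S': Metric_space S \<delta>' by (rule T.subspace[OF subS])
      show ?thesis
      proof (rule S'.mcompleteI)
        fix \<sigma> :: "nat \<Rightarrow> 'c" assume r: "range \<sigma> \<subseteq> S" and ca: "S'.MCauchy \<sigma>"
        have \<sigma>S: "\<sigma> n \<in> S" for n using r by auto
        have "S.tr.MCauchy \<sigma>" using ca \<sigma>S unfolding S'.MCauchy_def S.tr.MCauchy_def by (auto simp: SS)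
        then obtain a where "a \<in> S" "(\<lambda>n. \<delta> (\<sigma> n) a) \<longlonglongrightarrow> 0" using S.tr.mcompleteD S.complete by blast
        then show "\<exists>a\<in>S. (\<lambda>n. \<delta>' (\<sigma> n) a) \<longlonglongrightarrow> 0" using \<sigma>S by (intro bexI[of _ a]) (auto simp: SS)
      qed
    qed
    \<comment> \<open>Adding \<open>c\<close> closes the interval, so heights tending to 0 have a
      limit as well.\<close>
    moreover have "Metric_space.mcomplete (insert c I) \<delta>'"
    proof -
      have subI: "insert c I \<subseteq> S \<union> I" using c by blast
      interpret I': Metric_space "insert c I" \<delta>' by (rule T.subspace[OF subI])
      show ?thesis
      proof (rule I'.mcompleteI)
        fix \<sigma> :: "nat \<Rightarrow> 'c" assume r: "range \<sigma> \<subseteq> insert c I" and ca: "I'.MCauchy \<sigma>"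
        define k where "k x = (if x = c then 0 else h x)" for x
        have cI: "c \<notin> I" using c disj by blast
        have k: "\<delta>' x y = \<bar>k x - k y\<bar>" if "x \<in> insert c I" "y \<in> insert c I" for x y
          using that c cI hpos[of x] hpos[of y] unfolding k_def by (auto simp: simps)
        have \<sigma>I: "\<sigma> n \<in> insert c I" for n using r by auto
        have "Cauchy (\<lambda>n. k (\<sigma> n))"
          using ca \<sigma>I unfolding I'.MCauchy_def Cauchy_def dist_real_def by (auto simp: k)
        then obtain t where t: "(\<lambda>n. k (\<sigma> n)) \<longlonglongrightarrow> t" using Cauchy_convergent convergent_def by blast
        have kb: "0 \<le> k (\<sigma> n)" "k (\<sigma> n) \<le> max 0 l" for n
          using \<sigma>I[of n] hpos[of "\<sigma> n"] unfolding k_def by (auto simp: less_imp_le)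
        have t0: "0 \<le> t" by (rule LIMSEQ_le_const[OF t]) (use kb in auto)
        have tl: "t \<le> max 0 l" by (rule LIMSEQ_le_const2[OF t]) (use kb in auto)
        have "\<exists>a\<in>insert c I. k a = t"
        proof (cases "t = 0")
          case True
          then show ?thesis unfolding k_def by auto
        next
          case False
          then obtain a where "a \<in> I" "h a = t" using hinv[of t] t0 tl by (auto simp: max_def split: if_splits)
          then show ?thesis unfolding k_def using cI by (intro bexI[of _ a]) auto
        qed
        then obtain a where a: "a \<in> insert c I" "k a = t" by blast
        have "(\<lambda>n. \<bar>k (\<sigma> n) - t\<bar>) \<longlonglongrightarrow> 0" using tendsto_rabs[OF tendsto_diff[OF t tendsto_const[of t]]] by simp
        then show "\<exists>a\<in>insert c I. (\<lambda>n. \<delta>' (\<sigma> n) a) \<longlonglongrightarrow> 0"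
          using a \<sigma>I by (intro bexI[of _ a]) (auto simp: k)
      qed
    qed
    ultimately have "Metric_space.mcomplete (S \<union> insert c I) \<delta>'"
      using c by (intro T.mcomplete_Un) (auto simp: Submetric_def Submetric_axioms_def T.Metric_space_axioms)
    moreover have "S \<union> insert c I = S \<union> I" using c by blast
    ultimately show "T.mcomplete" by simp
  next
    obtain B where B: "finite B" "\<forall>p\<in>S. \<forall>x\<in>S. \<forall>y\<in>S. \<forall>q\<in>S. q \<noteq> p \<longrightarrow> q \<noteq> x \<longrightarrow> q \<noteq> y \<longrightarrow>
      \<delta> p x = \<delta> p q + \<delta> q x \<longrightarrow> \<delta> p y = \<delta> p q + \<delta> q y \<longrightarrow> \<delta> x y = \<delta> x q + \<delta> q y \<longrightarrow> q \<in> B"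
      using S.finite_branching by (elim exE conjE)
    \<comment> \<open>The retraction collapses the interval to \<open>c\<close>; a branch point in
      \<open>S\<close> other than \<open>c\<close> remains one afterwards. Only \<open>c\<close> can
      be a new branch point.\<close>
    define \<pi> where "\<pi> x = (if x \<in> S then x else c)" for x
    show "\<exists>B. finite B \<and> (\<forall>p\<in>S \<union> I. \<forall>x\<in>S \<union> I. \<forall>y\<in>S \<union> I. \<forall>q\<in>S \<union> I. q \<noteq> p \<longrightarrow> q \<noteq> x \<longrightarrow> q \<noteq> y \<longrightarrow>
      \<delta>' p x = \<delta>' p q + \<delta>' q x \<longrightarrow> \<delta>' p y = \<delta>' p q + \<delta>' q y \<longrightarrow> \<delta>' x y = \<delta>' x q + \<delta>' q y \<longrightarrow> q \<in> B)"
    proof (intro exI[of _ "insert c B"] conjI ballI impI)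
      fix p x y q assume m: "p \<in> S \<union> I" "x \<in> S \<union> I" "y \<in> S \<union> I" "q \<in> S \<union> I" and ne: "q \<noteq> p" "q \<noteq> x" "q \<noteq> y"
        and b: "\<delta>' p x = \<delta>' p q + \<delta>' q x" "\<delta>' p y = \<delta>' p q + \<delta>' q y" "\<delta>' x y = \<delta>' x q + \<delta>' q y"
      show "q \<in> insert c B"
      proof (cases "q \<in> I")
        case True
        \<comment> \<open>A signed position relative to \<open>c\<close>: three points cannot lie
          pairwise on opposite sides of \<open>q\<close>, so no point of the interval
          branches.\<close>
        define k where "k x = (if x \<in> S then - \<delta> x c else h x)" for x
        have side: "(k a < k q \<and> k q < k b) \<or> (k b < k q \<and> k q < k a)"
          if ab: "a \<in> S \<union> I" "b \<in> S \<union> I" "q \<noteq> a" "q \<noteq> b" "\<delta>' a b = \<delta>' a q + \<delta>' q b" for a b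
        proof -
          have qS: "q \<notin> S" "0 < h q" using True disj hpos by auto
          have ne: "a \<in> I \<Longrightarrow> h a \<noteq> h q" "b \<in> I \<Longrightarrow> h b \<noteq> h q" using hinj True ab by auto
          consider "a \<in> S" "b \<in> S" | "a \<in> S" "b \<in> I" "b \<notin> S" | "a \<in> I" "a \<notin> S" "b \<in> S" | "a \<in> I" "b \<in> I" "a \<notin> S" "b \<notin> S"
            using ab disj by blast
          then show ?thesis
          proof cases
            case 1
            then show ?thesis using ab(5) tri(2)[of a c b] c True qS by (simp add: simps)
          next
            case 2
            have "- \<delta> a c < h q" using qS(2) S.tr.nonneg[of a c] by linarith
            then show ?thesis using 2 ab(5) True qS ne unfolding k_def by (simp add: simps abs_if split: if_splits)
          next
            case 3
            have "- \<delta> b c < h q" using qS(2) S.tr.nonneg[of b c] by linarith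
            then show ?thesis using 3 ab(5) True qS ne unfolding k_def by (simp add: simps abs_if split: if_splits)
          next
            case 4
            then show ?thesis using ab(5) True qS ne unfolding k_def by (simp add: simps abs_if split: if_splits)
          qed
        qed
        show ?thesis using side[OF m(1,2) ne(1,2) b(1)] side[OF m(1,3) ne(1,3) b(2)] side[OF m(2,3) ne(2,3) b(3)] by linarith
      next
        case False
        then have qS: "q \<in> S" using m by blast
        show ?thesis
        proof (cases "q = c")
          case qc: False
          have red: "\<delta> (\<pi> a) (\<pi> b) = \<delta> (\<pi> a) q + \<delta> q (\<pi> b)"
            if ab: "a \<in> S \<union> I" "b \<in> S \<union> I" "\<delta>' a b = \<delta>' a q + \<delta>' q b" for a b
          proof -
            have q0: "0 < \<delta> q c" using qc qS c by simp
            consider "a \<in> S" "b \<in> S" | "a \<in> S" "b \<in> I" "b \<notin> S" | "a \<in> I" "a \<notin> S" "b \<in> S" | "a \<in> I" "b \<in> I" "a \<notin> S" "b \<notin> S"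
              using ab disj by blast
            then show ?thesis
            proof cases
              case 4
              then show ?thesis using ab(3) qS q0 hpos[of a] hpos[of b] by (simp add: simps abs_if split: if_splits)
            qed (use ab(3) qS in \<open>auto simp: simps \<pi>_def S.tr.commute\<close>)
          qed
          have \<pi>S: "\<pi> a \<in> S" for a unfolding \<pi>_def using c by simp
          have "q \<noteq> \<pi> p" "q \<noteq> \<pi> x" "q \<noteq> \<pi> y" using qc ne unfolding \<pi>_def by auto
          then have "q \<in> B" using B(2)[rule_format, OF \<pi>S \<pi>S \<pi>S qS] red[OF m(1,2) b(1)] red[OF m(1,3) b(2)] red[OF m(2,3) b(3)] by blast
          then show ?thesis by blast
        qed simp
      qed
    qed (use B in simp)
  qed
qed

section \<open>Metric trees\<close>

lemma rtree_singleton: "rtree {c} (\<lambda>_ _. 0 :: real)"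
proof (intro rtree.intro rtree_axioms.intro)
  show MS: "Metric_space {c} (\<lambda>_ _. 0 :: real)" by unfold_locales auto
  show "Metric_space.mcomplete {c} (\<lambda>_ _. 0 :: real)"
    by (rule Metric_space.mcompleteI[OF MS], rule bexI[of _ c]) simp_all
  show "\<exists>B. finite B \<and> (\<forall>p\<in>{c}. \<forall>x\<in>{c}. \<forall>y\<in>{c}. \<forall>q\<in>{c}. q \<noteq> p \<longrightarrow> q \<noteq> x \<longrightarrow> q \<noteq> y \<longrightarrow>
      (0 :: real) = 0 + 0 \<longrightarrow> (0 :: real) = 0 + 0 \<longrightarrow> (0 :: real) = 0 + 0 \<longrightarrow> q \<in> B)"
    by (rule exI[of _ "{}"]) simp
qed auto

text \<open>The first vertex of a longest path is a leaf: a second neighbour would extend the path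
  if new, and close a cycle otherwise.\<close>

lemma finite_tree_leaf:
  assumes t: "finite_tree V E" and ne: "E \<noteq> {}"
  obtains v l where "v \<in> V" "l \<in> V" "v \<noteq> l" "{v, l} \<in> E" "\<And>u. {u, l} \<in> E \<Longrightarrow> u = v"
proof -
  have V: "finite V" and sg: "\<And>e. e \<in> E \<Longrightarrow> \<exists>u\<in>V. \<exists>v\<in>V. u \<noteq> v \<and> e = {u, v}"
    and nc: "\<And>c. \<not> graph_cycle E c"
    using t unfolding finite_tree_def simple_graph_def by blast+
  have edge: "u \<in> V \<and> w \<in> V \<and> u \<noteq> w" if "{u, w} \<in> E" for u w
    using sg[OF that] by (auto simp: doubleton_eq_iff)
  define walk where "walk xs \<longleftrightarrow> distinct xs \<and> set xs \<subseteq> V \<and> 2 \<le> length xs \<and>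
    (\<forall>i. Suc i < length xs \<longrightarrow> {xs ! i, xs ! Suc i} \<in> E)" for xs
  obtain e where e: "e \<in> E" using ne by blast
  then obtain a b where ab: "a \<in> V" "b \<in> V" "a \<noteq> b" "e = {a, b}" using sg by blast
  have w0: "walk [a, b]" using ab e unfolding walk_def by auto
  have bound: "length xs < Suc (card V)" if "walk xs" for xs
    using that V card_mono[of V "set xs"] distinct_card[of xs] unfolding walk_def by auto
  obtain xs where xs: "walk xs" "\<And>ys. walk ys \<Longrightarrow> length ys \<le> length xs"
    using ex_has_greatest_nat[of walk "[a, b]" length "Suc (card V)"] w0 bound by auto
  have X: "distinct xs" "set xs \<subseteq> V" "2 \<le> length xs" "\<And>i. Suc i < length xs \<Longrightarrow> {xs ! i, xs ! Suc i} \<in> E"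
    using xs(1) unfolding walk_def by auto
  have E0: "{xs ! 0, xs ! 1} \<in> E" using X(4)[of 0] X(3) by simp
  show ?thesis
  proof (rule that[of "xs ! 1" "xs ! 0"])
    show "xs ! 1 \<in> V" "xs ! 0 \<in> V" "xs ! 1 \<noteq> xs ! 0" using edge[OF E0] by auto
    show "{xs ! 1, xs ! 0} \<in> E" using E0 by (simp add: insert_commute)
    fix u assume u: "{u, xs ! 0} \<in> E"
    have uV: "u \<in> V" "u \<noteq> xs ! 0" using edge[OF u] by auto
    show "u = xs ! 1"
    proof (rule ccontr)
      assume u1: "u \<noteq> xs ! 1"
      show False
      proof (cases "u \<in> set xs")
        case False
        have "walk (u # xs)"
          unfolding walk_def
        proof (intro conjI allI impI)
          fix i assume "Suc i < length (u # xs)"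
          then show "{(u # xs) ! i, (u # xs) ! Suc i} \<in> E" using u X(4) by (cases i) auto
        qed (use X uV False in auto)
        then show False using xs(2) by fastforce
      next
        case True
        then obtain k where k: "k < length xs" "xs ! k = u" by (auto simp: in_set_conv_nth)
        then have k2: "2 \<le> k" using u1 uV by (metis One_nat_def Suc_leI less_2_cases not_less)
        define c where "c = take (Suc k) xs"
        have len: "length c = Suc k" unfolding c_def using k by simp
        have "graph_cycle E c"
          unfolding graph_cycle_def
        proof (intro conjI allI impI)
          show "3 \<le> length c" using len k2 by simp
          show "distinct c" unfolding c_def using X(1) by simp
          fix i assume i: "i < length c"
          show "{c ! i, c ! (Suc i mod length c)} \<in> E"
          proof (cases "i = k")
            case True
            then show ?thesis using u k len unfolding c_def by simp
          next
            case False
            then have "Suc i < length c" using i len by simp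
            then show ?thesis using X(4)[of i] k len unfolding c_def by simp
          qed
        qed
        then show False using nc by blast
      qed
    qed
  qed
qed

lemma finite_tree_remove_leaf:
  assumes t: "finite_tree V E" and vl: "v \<in> V" "l \<in> V" "v \<noteq> l" "{v, l} \<in> E" and leaf: "\<And>u. {u, l} \<in> E \<Longrightarrow> u = v"
  shows "finite_tree (V - {l}) (E - {{v, l}})"
proof -
  have V: "finite V" and sg: "\<And>e. e \<in> E \<Longrightarrow> \<exists>u\<in>V. \<exists>v\<in>V. u \<noteq> v \<and> e = {u, v}"
    and nc: "\<And>c. \<not> graph_cycle E c"
    and conn: "\<And>a b. a \<in> V \<Longrightarrow> b \<in> V \<Longrightarrow> (a, b) \<in> {(a, b). {a, b} \<in> E}\<^sup>*"
    using t unfolding finite_tree_def simple_graph_def graph_connected_def by blast+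
  let ?r = "{(a, b). {a, b} \<in> E - {{v, l}}}"
  show ?thesis
    unfolding finite_tree_def
  proof (intro conjI)
    show "finite (V - {l})" "V - {l} \<noteq> {}" using V vl by auto
    show "simple_graph (V - {l}) (E - {{v, l}})"
      unfolding simple_graph_def
    proof
      fix e assume e: "e \<in> E - {{v, l}}"
      then obtain a b where ab: "a \<in> V" "b \<in> V" "a \<noteq> b" "e = {a, b}" using sg[of e] by auto
      have "a \<noteq> l"
      proof
        assume "a = l"
        then have "b = v" using leaf[of b] e ab by (simp add: insert_commute)
        then show False using e ab \<open>a = l\<close> by (simp add: insert_commute)
      qed
      moreover have "b \<noteq> l"
      proof
        assume "b = l"
        then have "a = v" using leaf[of a] e ab by simp
        then show False using e ab \<open>b = l\<close> by simp
      qed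
      ultimately show "\<exists>u\<in>V - {l}. \<exists>w\<in>V - {l}. u \<noteq> w \<and> e = {u, w}" using ab by blast
    qed
    show "graph_connected (V - {l}) (E - {{v, l}})"
      unfolding graph_connected_def
    proof (intro ballI)
      fix a b assume a: "a \<in> V - {l}" and b: "b \<in> V - {l}"
      \<comment> \<open>Walks in the larger graph are followed with \<open>l\<close> replaced by its
        only neighbour \<open>v\<close>.\<close>
      have "(if b = l then (a, v) \<in> ?r\<^sup>* else (a, b) \<in> ?r\<^sup>*)" if "(a, b) \<in> {(a, b). {a, b} \<in> E}\<^sup>*" for b
        using that
      proof (induction rule: rtrancl_induct)
        case base
        then show ?case using a by simp
      next
        case (step y z)
        then have yz: "{y, z} \<in> E" by simp
        show ?case
        proof (cases "z = l")
          case True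
          then have "y = v" using leaf[of y] yz by simp
          then show ?thesis using step.IH True vl by simp
        next
          case False
          show ?thesis
          proof (cases "y = l")
            case True
            then have "z = v" using leaf[of z] yz by (simp add: insert_commute)
            then show ?thesis using step.IH True False by simp
          next
            case yl: False
            then have "(y, z) \<in> ?r" using yz False by (auto simp: doubleton_eq_iff)
            then show ?thesis using step.IH False yl by (simp add: rtrancl.rtrancl_into_rtrancl)
          qed
        qed
      qed
      then show "(a, b) \<in> ?r\<^sup>*" using conn[of a b] a b by (metis Diff_iff insertI1)
    qed
    show "\<not> (\<exists>c. graph_cycle (E - {{v, l}}) c)"
      using nc unfolding graph_cycle_def by blast
  qed
qed

section \<open>From barycentric coordinates to a tree distance\<close>

definition vtx :: "'v \<Rightarrow> 'v \<Rightarrow> real" where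
  "vtx v = (\<lambda>w. if w = v then 1 else 0)"

lemma face_points_singleton: "face_points {v} = {vtx v}"
  unfolding face_points_def vtx_def by (auto simp: fun_eq_iff)

lemma face_points_pair:
  assumes "v \<noteq> l"
  shows "p \<in> face_points {v, l} \<longleftrightarrow> 0 \<le> p v \<and> 0 \<le> p l \<and> p v + p l = 1 \<and> (\<forall>w. w \<noteq> v \<longrightarrow> w \<noteq> l \<longrightarrow> p w = 0)"
  unfolding face_points_def using assms by (auto; metis order_refl)

lemma edge_dist_pair:
  assumes "v \<noteq> l" "p \<in> face_points {v, l}" "q \<in> face_points {v, l}"
  shows "edge_dist len {v, l} p q = len {v, l} * \<bar>p l - q l\<bar>"
proof -
  have "p v = 1 - p l" "q v = 1 - q l" using assms face_points_pair[OF assms(1)] by (simp_all add: eq_diff_eq)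
  then have "\<bar>p v - q v\<bar> = \<bar>p l - q l\<bar>" by simp
  then show ?thesis unfolding edge_dist_def using assms(1) by simp
qed

lemma complex_path_trans:
  assumes "complex_path E len p q L1" "complex_path E len q r L2" shows "complex_path E len p r (L1 + L2)"
  using assms(2,1)
proof (induction rule: complex_path.induct)
  case (step q' r' L e s)
  then show ?case using complex_path.step[of E len p r' "L1 + L" e s] by (simp add: add.assoc)
qed simp

lemma complex_path_mono:
  assumes "complex_path E len p q L" "E \<subseteq> E'" shows "complex_path E' len p q L"
  using assms
proof (induction rule: complex_path.induct)
  case (step p q L e r)
  then show ?case using complex_path.step[of E' len p q L e r] by blast
qed (rule complex_path.refl)

text \<open>Removing a leaf detaches a half-open edge, which \<open>rtree_glue\<close> puts back.
  The statement also carries what identifies \<open>\<delta>\<close> with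
  \<open>complex_dist\<close>: agreement on edges and realisation by paths.\<close>

lemma finite_tree_rtree:
  fixes V :: "'v set"
  assumes "finite_tree V E" "\<forall>e\<in>E. 0 < len e"
  shows "\<exists>\<delta>. rtree (complex_points V E) \<delta> \<and>
    (\<forall>e\<in>E. \<forall>q\<in>face_points e. \<forall>r\<in>face_points e. \<delta> q r = edge_dist len e q r) \<and>
    (\<forall>p\<in>complex_points V E. \<forall>q\<in>complex_points V E. complex_path E len p q (\<delta> p q))"
  using assms
proof (induction "card V" arbitrary: V E rule: less_induct)
  case less
  note t = less.prems(1)
  show ?case
  proof (cases "E = {}")
    case True
    obtain v where v: "v \<in> V" using t unfolding finite_tree_def by blast
    have "V = {v}" using t v True unfolding finite_tree_def graph_connected_def by auto
    then have "complex_points V E = face_points {v}" unfolding complex_points_def using True by simp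
    then have "complex_points V E = {vtx v}" using face_points_singleton by simp
    then show ?thesis using rtree_singleton[of "vtx v"] True complex_path.refl[of E len "vtx v"]
      by (intro exI[of _ "\<lambda>_ _. 0"]) auto
  next
    case False
    obtain v l where vl: "v \<in> V" "l \<in> V" "v \<noteq> l" "{v, l} \<in> E" and leaf: "\<And>u. {u, l} \<in> E \<Longrightarrow> u = v"
      using finite_tree_leaf[OF t False] by blast
    define V1 E1 where "V1 = V - {l}" and "E1 = E - {{v, l}}"
    have t1: "finite_tree V1 E1" unfolding V1_def E1_def using finite_tree_remove_leaf[OF t vl leaf] .
    have EE: "E = insert {v, l} E1" "E1 \<subseteq> E" unfolding E1_def using vl by auto
    have "card V1 < card V" unfolding V1_def using t vl unfolding finite_tree_def by (intro card_Diff1_less) auto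
    moreover have "\<forall>e\<in>E1. 0 < len e" using less.prems(2) EE by auto
    ultimately obtain \<delta> where \<delta>: "rtree (complex_points V1 E1) \<delta>"
      "\<And>e q r. e \<in> E1 \<Longrightarrow> q \<in> face_points e \<Longrightarrow> r \<in> face_points e \<Longrightarrow> \<delta> q r = edge_dist len e q r"
      "\<And>p q. p \<in> complex_points V1 E1 \<Longrightarrow> q \<in> complex_points V1 E1 \<Longrightarrow> complex_path E1 len p q (\<delta> p q)"
      using less.hyps[of V1 E1] t1 by blast
    interpret S: rtree "complex_points V1 E1" \<delta> by fact
    define S where "S = complex_points V1 E1"
    \<comment> \<open>The new edge without its end \<open>v\<close>, which already belongs to
      \<open>S\<close>.\<close>
    define I where "I = {p\<in>face_points {v, l}. 0 < p l}"
    define a where "a = len {v, l}"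
    have a: "0 < a" unfolding a_def using less.prems(2) vl by blast
    define h where "h p = a * p l" for p :: "'v \<Rightarrow> real"
    define c where "c = vtx v"
    have vV1: "v \<in> V1" unfolding V1_def using vl by simp
    have cS: "c \<in> S" unfolding S_def complex_points_def c_def using vV1 face_points_singleton[of v] by blast
    have cf: "c \<in> face_points {v, l}" unfolding c_def vtx_def using vl face_points_pair[OF vl(3)] by auto
    have Sl: "p l = 0" if p: "p \<in> S" for p
    proof -
      have "\<exists>s. l \<notin> s \<and> p \<in> face_points s"
      proof (cases "\<exists>w\<in>V1. p \<in> face_points {w}")
        case True
        then obtain w where "w \<noteq> l" "p \<in> face_points {w}" unfolding V1_def by blast
        then show ?thesis by (intro exI[of _ "{w}"]) simp
      next
        case False
        then obtain e where "e \<in> E1" "p \<in> face_points e" using p unfolding S_def complex_points_def by blast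
        moreover have "l \<notin> e"
        proof -
          have "\<forall>e\<in>E1. \<exists>u\<in>V1. \<exists>w\<in>V1. u \<noteq> w \<and> e = {u, w}"
            using t1 unfolding finite_tree_def simple_graph_def by blast
          then obtain u w where "u \<in> V1" "w \<in> V1" "e = {u, w}" using \<open>e \<in> E1\<close> by blast
          then show ?thesis unfolding V1_def by auto
        qed
        ultimately show ?thesis by (intro exI[of _ e]) simp
      qed
      then show ?thesis unfolding face_points_def by blast
    qed
    have disj: "S \<inter> I = {}" using Sl unfolding I_def by fastforce
    have face: "p = c \<or> p \<in> I" if "p \<in> face_points {v, l}" for p
    proof (cases "0 < p l")
      case True
      then show ?thesis using that unfolding I_def by blast
    next
      case F: False
      have "p = c"
      proof
        fix w
        have "p v = 1" "p l = 0" "w \<noteq> v \<Longrightarrow> w \<noteq> l \<Longrightarrow> p w = 0" using that F face_points_pair[OF vl(3)] by auto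
        then show "p w = c w" unfolding c_def vtx_def using vl(3) by (cases "w = l") auto
      qed
      then show ?thesis by blast
    qed
    have points: "complex_points V E = S \<union> I"
    proof
      show "complex_points V E \<subseteq> S \<union> I"
      proof
        fix p assume "p \<in> complex_points V E"
        then consider w where "w \<in> V1" "p \<in> face_points {w}" | "p \<in> face_points {l}" | e where "e \<in> E1" "p \<in> face_points e"
          | "p \<in> face_points {v, l}"
          unfolding complex_points_def EE(1) V1_def by blast
        then show "p \<in> S \<union> I"
        proof cases
          case 2
          then have "p = vtx l" using face_points_singleton[of l] by simp
          then show ?thesis unfolding I_def vtx_def using face_points_pair[OF vl(3)] vl(3) by auto
        next
          case 4
          then show ?thesis using face cS by blast
        qed (auto simp: S_def complex_points_def)
      qed
      show "S \<union> I \<subseteq> complex_points V E"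
        unfolding S_def I_def complex_points_def EE(1) V1_def by blast
    qed
    have h: "bij_betw h I {0<..a}"
      unfolding bij_betw_def
    proof
      show "inj_on h I"
      proof (rule inj_onI, rule ext)
        fix p q w assume pq: "p \<in> I" "q \<in> I" "h p = h q"
        then have "p l = q l" unfolding h_def using a by simp
        then show "p w = q w" using pq unfolding I_def face_points_pair[OF vl(3)]
          by (cases "w = l"; cases "w = v") auto
      qed
      show "h ` I = {0<..a}"
      proof
        show "h ` I \<subseteq> {0<..a}"
        proof
          fix t assume "t \<in> h ` I"
          then obtain p where p: "p \<in> I" "t = a * p l" unfolding h_def by blast
          then have "0 < p l" "p l \<le> 1" unfolding I_def face_points_pair[OF vl(3)] by auto
          then show "t \<in> {0<..a}" using p a by (simp add: mult_le_cancel_left1)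
        qed
        show "{0<..a} \<subseteq> h ` I"
        proof
          fix t assume t: "t \<in> {0<..a}"
          define p where "p w = (if w = l then t / a else if w = v then 1 - t / a else 0)" for w
          have "p \<in> I" unfolding I_def face_points_pair[OF vl(3)] p_def using t a vl(3) by (auto simp: field_simps)
          moreover have "h p = t" unfolding h_def p_def using a by simp
          ultimately show "t \<in> h ` I" by blast
        qed
      qed
    qed
    define \<delta>' where "\<delta>' x y = (if x \<in> S \<union> I \<and> y \<in> S \<union> I then (if x \<in> I \<and> y \<in> I then \<bar>h x - h y\<bar>
      else if x \<in> I then \<delta> c y + h x else if y \<in> I then \<delta> x c + h y else \<delta> x y) else 0)" for x y
    have R: "rtree (S \<union> I) \<delta>'"
      by (rule rtree_glue[OF \<delta>(1)[folded S_def] cS disj h]) (auto simp: \<delta>'_def)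
    interpret G: rtree "S \<union> I" \<delta>' by fact
    have hdiff: "\<bar>h p - h q\<bar> = edge_dist len {v, l} p q" if "p \<in> face_points {v, l}" "q \<in> face_points {v, l}" for p q
      using edge_dist_pair[OF vl(3) that, of len] a unfolding h_def a_def
      by (simp add: abs_mult right_diff_distrib[symmetric])
    have cI: "c \<notin> I" "h c = 0" using cS disj Sl[OF cS] unfolding h_def by auto
    have cc: "\<delta> c c = 0" using cS unfolding S_def by simp
    have hI: "0 < h p" if "p \<in> I" for p using h that bij_betwE by fastforce
    have edge_new: "\<delta>' p q = edge_dist len {v, l} p q" if pq: "p \<in> face_points {v, l}" "q \<in> face_points {v, l}" for p q
    proof -
      consider "p \<in> I" "q \<in> I" | "p \<in> I" "q = c" | "p = c" "q \<in> I" | "p = c" "q = c" using face pq by blast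
      then have "\<delta>' p q = \<bar>h p - h q\<bar>"
        unfolding \<delta>'_def using cI cS cc hI[of p] hI[of q] by cases auto
      then show ?thesis using hdiff[OF pq] by simp
    qed
    have fS: "p \<in> S" if "e \<in> E1" "p \<in> face_points e" for e p using that unfolding S_def complex_points_def by blast
    have edges: "\<delta>' q r = edge_dist len e q r" if e: "e \<in> E" "q \<in> face_points e" "r \<in> face_points e" for e q r
    proof (cases "e = {v, l}")
      case True
      then show ?thesis using edge_new e by simp
    next
      case False
      then have e1: "e \<in> E1" using e EE by blast
      then have "q \<in> S" "r \<in> S" using fS e by auto
      then have "\<delta>' q r = \<delta> q r" unfolding \<delta>'_def using disj by auto
      then show ?thesis using \<delta>(2)[OF e1 e(2,3)] by simp
    qed
    have If: "p \<in> face_points {v, l}" if "p \<in> I" for p using that unfolding I_def by blast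
    have stepI: "complex_path E len p q (\<delta>' p q)" if "p \<in> face_points {v, l}" "q \<in> face_points {v, l}" for p q
      using complex_path.step[OF complex_path.refl[of E len p] vl(4) that] edge_new[OF that] by simp
    have pS: "complex_path E len p q (\<delta> p q)" if "p \<in> S" "q \<in> S" for p q
      using complex_path_mono[OF \<delta>(3) EE(2)] that unfolding S_def by blast
    have paths: "complex_path E len p q (\<delta>' p q)" if pq: "p \<in> S \<union> I" "q \<in> S \<union> I" for p q
    proof -
      have notI: "p \<in> S \<Longrightarrow> p \<notin> I" "q \<in> S \<Longrightarrow> q \<notin> I" using disj by auto
      consider "p \<in> S" "q \<in> S" | "p \<in> S" "q \<in> I" | "p \<in> I" "q \<in> S" | "p \<in> I" "q \<in> I" using pq by blast
      then show ?thesis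
      proof cases
        case 1
        then show ?thesis using pS[OF 1] notI unfolding \<delta>'_def by simp
      next
        case 2
        have "complex_path E len p q (\<delta> p c + \<delta>' c q)"
          by (rule complex_path_trans[OF pS[OF 2(1) cS] stepI[OF cf If[OF 2(2)]]])
        moreover have "\<delta>' p q = \<delta> p c + h q" "\<delta>' c q = h q" unfolding \<delta>'_def using 2 notI cI cS cc by auto
        ultimately show ?thesis by simp
      next
        case 3
        have "complex_path E len p q (\<delta>' p c + \<delta> c q)"
          by (rule complex_path_trans[OF stepI[OF If[OF 3(1)] cf] pS[OF cS 3(2)]])
        moreover have "\<delta>' p q = \<delta> c q + h p" "\<delta>' p c = h p" unfolding \<delta>'_def using 3 notI cI cS cc by auto
        ultimately show ?thesis by (simp add: add.commute)
      next
        case 4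
        then show ?thesis using stepI If by blast
      qed
    qed
    show ?thesis unfolding points using R edges paths by blast
  qed
qed

text \<open>By the triangle inequality \<open>\<delta>\<close> is below the length of every path,
  and some path attains it, so the infimum in \<open>complex_dist\<close> is a minimum.\<close>

lemma metric_tree_rtree:
  assumes "metric_tree T"
  shows "rtree (mspace T) (mdist T)"
proof -
  obtain V :: "nat set" and E len \<phi> where t: "finite_tree V E" "\<forall>e\<in>E. 0 < len e"
    and \<phi>: "bij_betw \<phi> (complex_points V E) (mspace T)"
    and iso: "\<And>p q. p \<in> complex_points V E \<Longrightarrow> q \<in> complex_points V E \<Longrightarrow>
      mdist T (\<phi> p) (\<phi> q) = complex_dist E len p q"
    using assms unfolding metric_tree_def by blast
  obtain \<delta> where R: "rtree (complex_points V E) \<delta>"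
    and edge: "\<And>e q r. e \<in> E \<Longrightarrow> q \<in> face_points e \<Longrightarrow> r \<in> face_points e \<Longrightarrow> \<delta> q r = edge_dist len e q r"
    and path: "\<And>p q. p \<in> complex_points V E \<Longrightarrow> q \<in> complex_points V E \<Longrightarrow> complex_path E len p q (\<delta> p q)"
    using finite_tree_rtree[OF t] by blast
  interpret R: rtree "complex_points V E" \<delta> by fact
  have faces: "q \<in> complex_points V E" if "e \<in> E" "q \<in> face_points e" for e q
    using that unfolding complex_points_def by blast
  have lower: "q \<in> complex_points V E \<and> \<delta> p q \<le> L" if "complex_path E len p q L" "p \<in> complex_points V E" for p q L
    using that
  proof (induction rule: complex_path.induct)
    case (refl p)
    then show ?case by simp
  next
    case (step p q L e r)
    have "\<delta> p r \<le> \<delta> p q + \<delta> q r" using step faces by (intro R.tr.triangle) auto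
    then show ?case using step faces[OF step.hyps(2,4)] edge[OF step.hyps(2-4)] by auto
  qed
  have "complex_dist E len p q = \<delta> p q" if "p \<in> complex_points V E" "q \<in> complex_points V E" for p q
    unfolding complex_dist_def using path[OF that] lower that by (intro cInf_eq_minimum) auto
  then show ?thesis using iso by (intro rtree_isometry[OF R \<phi>]) auto
qed

section \<open>Translation from the definitions to the locales\<close>

lemma length_space_len_metric:
  assumes "length_space X"
  shows "len_metric (mspace X) (mdist X)"
proof (intro len_metric.intro len_metric_axioms.intro)
  show "Metric_space (mspace X) (mdist X)" by simp
  fix a b and \<iota> :: real assume ab: "a \<in> mspace X" "b \<in> mspace X" and \<iota>: "0 < \<iota>"
  have "(INF g \<in> {g. pathin (mtopology_of X) g \<and> g 0 = a \<and> g 1 = b}. curve_length X g) < ennreal (mdist X a b + \<iota>)"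
  proof -
    have "ennreal (mdist X a b) < ennreal (mdist X a b + \<iota>)" using \<iota> by (intro ennreal_lessI) (auto simp: add_nonneg_pos)
    moreover have "ennreal (mdist X a b) =
        (INF g \<in> {g. pathin (mtopology_of X) g \<and> g 0 = a \<and> g 1 = b}. curve_length X g)"
      using assms ab unfolding length_space_def by blast
    ultimately show ?thesis by simp
  qed
  then obtain g where g: "pathin (mtopology_of X) g" "g 0 = a" "g 1 = b" "curve_length X g < ennreal (mdist X a b + \<iota>)"
    unfolding INF_less_iff by blast
  have "(\<Sum>i<length ts - 1. mdist X (g (ts ! i)) (g (ts ! Suc i))) \<le> mdist X a b + \<iota>"
    if "sorted ts" "set ts \<subseteq> {0..1}" for ts
  proof -
    have "(\<Sum>i<length ts - 1. ennreal (mdist X (g (ts ! i)) (g (ts ! Suc i)))) \<le> curve_length X g"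
      unfolding curve_length_def using that by (intro SUP_upper) auto
    also have "\<dots> \<le> ennreal (mdist X a b + \<iota>)" using g by simp
    finally have "ennreal (\<Sum>i<length ts - 1. mdist X (g (ts ! i)) (g (ts ! Suc i))) \<le> ennreal (mdist X a b + \<iota>)"
      by (simp add: sum_ennreal)
    moreover have "0 \<le> mdist X a b + \<iota>" using \<iota> by (simp add: add_nonneg_nonneg)
    ultimately show ?thesis by (simp add: ennreal_le_iff)
  qed
  then show "\<exists>g. pathin (Metric_space.mtopology (mspace X) (mdist X)) g \<and> g 0 = a \<and> g 1 = b \<and>
      (\<forall>ts. sorted ts \<and> set ts \<subseteq> {0..1} \<longrightarrow>
        (\<Sum>i<length ts - 1. mdist X (g (ts ! i)) (g (ts ! Suc i))) \<le> mdist X a b + \<iota>)"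
    using g unfolding mtopology_of_def by blast
qed

lemma Lip_le_iff:
  assumes U: "U \<subseteq> mspace X" and h: "\<And>x. x \<in> U \<Longrightarrow> h x \<in> mspace Z" and K: "0 \<le> K"
  shows "Lip X Z U h \<le> ennreal K \<longleftrightarrow> (\<forall>x\<in>U. \<forall>y\<in>U. mdist Z (h x) (h y) \<le> K * mdist X x y)"
proof -
  have "mdist Z (h x) (h y) / mdist X x y \<le> K \<longleftrightarrow> mdist Z (h x) (h y) \<le> K * mdist X x y"
    if "x \<in> U" "y \<in> U" "x \<noteq> y" for x y
  proof -
    have "mdist X x y \<noteq> 0" using that U mdist_zero[of x X y] by blast
    then have "0 < mdist X x y" using mdist_nonneg[of X x y] by linarith
    then show ?thesis by (simp add: divide_le_eq)
  qed
  moreover have "mdist Z (h x) (h x) \<le> K * mdist X x x" if "x \<in> U" for x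
  proof -
    have "mdist Z (h x) (h x) = 0" using h[OF that] by simp
    moreover have "mdist X x x = 0" using subsetD[OF U that] by simp
    ultimately show ?thesis by simp
  qed
  ultimately show ?thesis unfolding Lip_def using K by (auto simp: SUP_le_iff ennreal_le_iff; metis)
qed

lemma (in len_metric) subh_cong:
  assumes "\<And>x. x \<in> M \<Longrightarrow> u x = v x" "subh U u"
  shows "subh U v"
proof -
  have "spr u x R = spr v x R" for x R unfolding spr_def using assms(1) by (intro SUP_cong) auto
  then show ?thesis using assms unfolding subh_def by auto
qed

text \<open>\<open>AMLE\<close> says nothing about values outside the carrier of \<open>X\<close>,
  so uniqueness is stated among extensional functions.\<close>

theorem theorem1:
  fixes X :: "'a metric" and T :: "'b metric" and Y :: "'a set" and f :: "'a \<Rightarrow> 'b"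
  assumes "length_space X"
    and "locally_compact_space (mtopology_of X)"
    and "metric_tree T"
    and "closedin (mtopology_of X) Y"
    and "Y \<noteq> {}"
    and "Lipschitz_continuous_map (submetric X Y) T f"
  shows "\<exists>!F. F \<in> extensional (mspace X) \<and> AMLE X T Y f F"
proof -
  interpret tree_valued "mspace X" "mdist X" "mspace T" "mdist T" Y
    using length_space_len_metric[OF assms(1)] metric_tree_rtree[OF assms(3)] assms(4,5)
    by (intro tree_valued.intro tree_valued_axioms.intro) (auto simp: mtopology_of_def)
  have lips_iff: "Lipschitz_continuous_map X T F \<longleftrightarrow> (\<exists>K. lips K (mspace X) F)" for F
    unfolding Lipschitz_continuous_map_def lips_def by auto
  have AMLE_iff: "AMLE X T Y f F \<longleftrightarrow> (\<forall>y\<in>Y. F y = f y) \<and> abs_minimal F" for F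
  proof -
    \<comment> \<open>Values of \<open>Lip\<close> are compared through their real upper bounds; an
      infinite value for the competitor is a trivial case.\<close>
    have "Lip X T U F \<le> Lip X T U h \<longleftrightarrow> (\<forall>K\<ge>0. lips K U h \<longrightarrow> lips K U F)"
      if F: "Lipschitz_continuous_map X T F" and h: "Lipschitz_continuous_map X T h" and U: "U \<subseteq> mspace X - Y" for U h
    proof -
      have FT: "F x \<in> mspace T" "h x \<in> mspace T" if "x \<in> U" for x
        using F h that U unfolding Lipschitz_continuous_map_def by auto
      have LK: "Lip X T U g \<le> ennreal K \<longleftrightarrow> lips K U g" if "0 \<le> K" "g = F \<or> g = h" for g K
        using Lip_le_iff[of U X g T K] U FT that unfolding lips_def by auto
      show ?thesis
      proof
        assume le: "Lip X T U F \<le> Lip X T U h"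
        show "\<forall>K\<ge>0. lips K U h \<longrightarrow> lips K U F"
        proof (intro allI impI)
          fix K :: real assume K: "0 \<le> K" "lips K U h"
          then have "Lip X T U h \<le> ennreal K" using LK[of K h] by simp
          then have "Lip X T U F \<le> ennreal K" using le by (rule order_trans[rotated])
          then show "lips K U F" using LK[of K F] K by simp
        qed
      next
        assume *: "\<forall>K\<ge>0. lips K U h \<longrightarrow> lips K U F"
        show "Lip X T U F \<le> Lip X T U h"
        proof (cases "Lip X T U h")
          case (real K)
          then have "lips K U h" using LK[of K h] by simp
          then have "Lip X T U F \<le> ennreal K" using * LK[of K F] real by blast
          then show ?thesis using real by simp
        qed simp
      qed
    qed
    note key = this
    show ?thesis
    proof
      assume am: "AMLE X T Y f F"
      then have F: "Lipschitz_continuous_map X T F" and bF: "\<forall>y\<in>Y. F y = f y" unfolding AMLE_def by simp_all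
      have "lips K U F"
        if "openin mtopology U" "U \<subseteq> mspace X - Y" "\<exists>K. lips K (mspace X) h" "\<forall>x\<in>mspace X - U. h x = F x"
          "0 \<le> K" "lips K U h" for U h K
      proof -
        have h: "Lipschitz_continuous_map X T h" using that(3) lips_iff by blast
        have "Lip X T U F \<le> Lip X T U h" using am h that(1,2,4) unfolding AMLE_def mtopology_of_def by blast
        then show ?thesis using key[OF F h that(2)] that(5,6) by blast
      qed
      then have "abs_minimal F" using F lips_iff unfolding abs_minimal_def by blast
      then show "(\<forall>y\<in>Y. F y = f y) \<and> abs_minimal F" using bF by blast
    next
      assume am: "(\<forall>y\<in>Y. F y = f y) \<and> abs_minimal F"
      have F: "Lipschitz_continuous_map X T F" using am lips_iff unfolding abs_minimal_def by blast
      have "Lip X T U F \<le> Lip X T U h"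
        if "openin (mtopology_of X) U" "U \<subseteq> mspace X - Y" and h: "Lipschitz_continuous_map X T h"
          and "\<forall>x\<in>mspace X - U. h x = F x" for U h
      proof -
        have "\<exists>K. lips K (mspace X) h" using h lips_iff by blast
        then have "\<forall>K\<ge>0. lips K U h \<longrightarrow> lips K U F"
          using am that(1,2,4) unfolding abs_minimal_def mtopology_of_def by blast
        then show ?thesis using key[OF F h that(2)] by blast
      qed
      then show "AMLE X T Y f F" using am F unfolding AMLE_def by blast
    qed
  qed
  obtain L0 where f: "f \<in> Y \<rightarrow> mspace T" "\<forall>x\<in>Y. \<forall>y\<in>Y. mdist T (f x) (f y) \<le> L0 * mdist X x y"
    using assms(6) Int_absorb2[OF YM] unfolding Lipschitz_continuous_map_def by auto
  then have L0: "mdist T (f x) (f y) \<le> L0 * mdist X x y" if "x \<in> Y" "y \<in> Y" for x y using that by blast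
  have fT: "f y \<in> mspace T" if "y \<in> Y" for y using f(1) that by blast
  define L where "L = max 1 L0"
  interpret bdry: boundary_data "mspace X" "mdist X" "mspace T" "mdist T" Y f L
  proof
    show "Y \<subseteq> mspace X" "Y \<noteq> {}" "0 < L" using YM assms(5) unfolding L_def by auto
    show "f y \<in> mspace T" if "y \<in> Y" for y using fT that .
    fix y y' assume "y \<in> Y" "y' \<in> Y"
    then have "mdist T (f y) (f y') \<le> L0 * mdist X y y'" using L0 by blast
    also have "\<dots> \<le> L * mdist X y y'" unfolding L_def by (intro mult_right_mono) auto
    finally show "mdist T (f y) (f y') \<le> L * mdist X y y'" .
  qed
  obtain G where G: "\<forall>x\<in>mspace X. G x \<in> mspace T" "\<forall>y\<in>Y. G y = f y"
    "\<forall>x\<in>mspace X. \<forall>y\<in>mspace X. mdist T (G x) (G y) \<le> L * mdist X x y"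
    "\<forall>t\<in>mspace T. subh (mspace X - Y) (\<lambda>x. mdist T t (G x))"
    using bdry.subharmonic_extension by blast
  define F where "F = restrict G (mspace X)"
  have "lips L (mspace X) F" unfolding lips_def F_def using G by simp
  moreover have "subharmonic F"
    unfolding subharmonic_def
  proof
    fix t assume "t \<in> mspace T"
    then have "subh (mspace X - Y) (\<lambda>x. mdist T t (G x))" using G(4) by blast
    then show "subh (mspace X - Y) (\<lambda>x. mdist T t (F x))"
      by (rule subh_cong[rotated]) (simp add: F_def)
  qed
  ultimately have "abs_minimal F" by (rule subharmonic_imp_abs_minimal)
  moreover have "\<forall>y\<in>Y. F y = f y" using G(2) YM unfolding F_def by auto
  ultimately have "AMLE X T Y f F" using AMLE_iff by blast
  moreover have "F \<in> extensional (mspace X)" unfolding F_def by simp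
  moreover have "F1 = F2" if "F1 \<in> extensional (mspace X)" "AMLE X T Y f F1"
    "F2 \<in> extensional (mspace X)" "AMLE X T Y f F2" for F1 F2
  proof (rule extensionalityI[OF that(1,3)])
    fix x assume x: "x \<in> mspace X"
    have am: "abs_minimal F1" "abs_minimal F2" and eq: "\<And>y. y \<in> Y \<Longrightarrow> F1 y = F2 y"
      using that(2,4) unfolding AMLE_iff by auto
    obtain C1 where C1: "lips C1 (mspace X) F1" using am(1) unfolding abs_minimal_def by (elim conjE exE)
    obtain C2 where C2: "lips C2 (mspace X) F2" using am(2) unfolding abs_minimal_def by (elim conjE exE)
    show "F1 x = F2 x"
      by (rule subharmonic_unique[OF C1 abs_minimal_imp_subharmonic[OF am(1)]
            C2 abs_minimal_imp_subharmonic[OF am(2)] eq x])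
  qed
  ultimately show ?thesis by blast
qed

end
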